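(* Let $n\ge1$ and $0<\varepsilon<1$. The two bounded (odd) KK-cycles $(\mathcal E,\mathfrak b(S))$ and $(\mathcal E_{CS},F)$ between $C(\mathbb{S}^n)$ and $C_0(\mathbb{R}^{n+1})$ are homotopic and, consequently, they define the same class in $KK(C(\mathbb{S}^n),C_0(\mathbb{R}^{n+1}))$.
   Context: In spherical coordinates on $\mathbb{R}^{n+1}\setminus\{0\}$ let $\tilde\imath:\mathbb{S}^n\times(-\varepsilon,\varepsilon)\to\mathbb{R}^{n+1}$, $\tilde\imath(\vec\theta,s)=(\vec\theta,s+1)$ (radius $r=s+1$). $\mathcal E$ is $C_0(\mathbb{S}^n\times(-\varepsilon,\varepsilon))$ with inner product $\langle\psi,\phi\rangle_{\mathcal E}(\vec\theta,r)=\frac1{r^n}\overline{\psi}(\tilde\imath^{-1}(\vec\theta,r))\phi(\tilde\imath^{-1}(\vec\theta,r))$ on the image of $\tilde\imath$ and $0$ elsewhere, and actions $(g\cdot\psi\cdot h)(\vec\theta,s)=g(\vec\theta)\psi(\vec\theta,s)h(\tilde\imath(\vec\theta,s))$ for $g\in C(\mathbb{S}^n)$, $h\in C_0(\mathbb{R}^{n+1})$. With $\alpha=\frac{\pi}{2\varepsilon}$, $f(s)=\alpha\tan(\alpha s)$, $S$ is multiplication by $f(s)$ on $\mathrm{dom}(S)=\{\psi\in\mathcal E:f\psi\in\mathcal E\}$, and $\mathfrak b(S)=S(1+S^2)^{-1/2}$ is its bounded transform. Let $\tilde\imath_{CS}:\mathbb{S}^n\times\mathbb{R}\to\mathbb{R}^{n+1}$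 be a map which is a diffeomorphism onto a tubular neighbourhood of $\mathbb{S}^n\subset\mathbb{R}^{n+1}$ and satisfies $\tilde\imath_{CS}|_{\mathbb{S}^n\times(-\varepsilon,\varepsilon)}=\tilde\imath$. $\mathcal E_{CS}$ is the Hilbert $C(\mathbb{S}^n)$-$C_0(\mathbb{R}^{n+1})$-bimodule obtained by completing $C_c(\mathbb{S}^n\times\mathbb{R})$ with respect to $\langle\psi,\phi\rangle_{CS}(x)=\overline\psi(\tilde\imath_{CS}^{-1}(x))\phi(\tilde\imath_{CS}^{-1}(x))$ for $x$ in the tubular neighbourhood and $0$ elsewhere, with actions $(g\cdot\psi\cdot h)(\vec\theta,s)=g(\vec\theta)\psi(\vec\theta,s)h(\tilde\imath_{CS}(\vec\theta,s))$; thus $\mathcal E_{CS}=C_0(\mathbb{S}^n\times\mathbb{R})$. The operator $F$ on $\mathcal E_{CS}$ is $$(F\psi)(\theta,s)=\begin{cases}-\psi(\theta,s),&s\le-\varepsilon,\\ \frac{f(s)}{\sqrt{1+f(s)^2}}\psi(\theta,s),&s\in(-\varepsilon,\varepsilon),\\ \psi(\theta,s),&s\ge\varepsilon.\end{cases}$$ ($(\mathcal E_{CS},F)$ is the shriek cycle of Connes and Skandalis for $\mathbb{S}^n\hookrightarrow\mathbb{R}^{n+1}$.) A homotopy between two $A$-$B$ cycles is a Kasparov $A$-$B\otimes C([0,1])$ cycle whose evaluations at $0$ and $1$ are unitarily equivalent to the given cycles. *)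

theory Defs
  imports "HOL-Analysis.Analysis" "HOL-Algebra.Module" "HOL-Algebra.AbelCoset"
begin

section \<open>C*-algebras\<close>

definition complex_ring :: "complex ring" where
  "complex_ring = \<lparr>carrier = UNIV, mult = (*), one = 1, zero = 0, add = (+)\<rparr>"

text \<open>Algebras need not be unital and the Hilbert modules below have no multiplication, so the
  inherited record fields \<open>one\<close> and (for modules) \<open>mult\<close> carry no information and are never
  referred to.\<close>

record 'a cstar = "(complex, 'a) module" +
  star :: "'a \<Rightarrow> 'a"
  nrm :: "'a \<Rightarrow> real"

definition norm_complete :: "('e, 'm) ring_scheme \<Rightarrow> ('e \<Rightarrow> real) \<Rightarrow> bool" where
  "norm_complete M N \<longleftrightarrow>
     (\<forall>X. (\<forall>k::nat. X k \<in> carrier M) \<longrightarrow>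
          (\<forall>e>0. \<exists>k0. \<forall>k\<ge>k0. \<forall>l\<ge>k0. N (X k \<ominus>\<^bsub>M\<^esub> X l) < e) \<longrightarrow>
          (\<exists>x\<in>carrier M. (\<lambda>k. N (X k \<ominus>\<^bsub>M\<^esub> x)) \<longlonglongrightarrow> 0))"

locale cstar_algebra = module complex_ring A for A :: "('a, 'm) cstar_scheme" +
  assumes mult_closed:
      "\<lbrakk>x \<in> carrier A; y \<in> carrier A\<rbrakk> \<Longrightarrow> x \<otimes>\<^bsub>A\<^esub> y \<in> carrier A"
    and mult_assoc:
      "\<lbrakk>x \<in> carrier A; y \<in> carrier A; z \<in> carrier A\<rbrakk> \<Longrightarrow>
        (x \<otimes>\<^bsub>A\<^esub> y) \<otimes>\<^bsub>A\<^esub> z = x \<otimes>\<^bsub>A\<^esub> (y \<otimes>\<^bsub>A\<^esub> z)"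
    and mult_l_distr:
      "\<lbrakk>x \<in> carrier A; y \<in> carrier A; z \<in> carrier A\<rbrakk> \<Longrightarrow>
        (x \<oplus>\<^bsub>A\<^esub> y) \<otimes>\<^bsub>A\<^esub> z = x \<otimes>\<^bsub>A\<^esub> z \<oplus>\<^bsub>A\<^esub> y \<otimes>\<^bsub>A\<^esub> z"
    and mult_r_distr:
      "\<lbrakk>x \<in> carrier A; y \<in> carrier A; z \<in> carrier A\<rbrakk> \<Longrightarrow>
        x \<otimes>\<^bsub>A\<^esub> (y \<oplus>\<^bsub>A\<^esub> z) = x \<otimes>\<^bsub>A\<^esub> y \<oplus>\<^bsub>A\<^esub> x \<otimes>\<^bsub>A\<^esub> z"
    and smult_mult_l:
      "\<lbrakk>x \<in> carrier A; y \<in> carrier A\<rbrakk> \<Longrightarrow>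
        (c \<odot>\<^bsub>A\<^esub> x) \<otimes>\<^bsub>A\<^esub> y = c \<odot>\<^bsub>A\<^esub> (x \<otimes>\<^bsub>A\<^esub> y)"
    and smult_mult_r:
      "\<lbrakk>x \<in> carrier A; y \<in> carrier A\<rbrakk> \<Longrightarrow>
        x \<otimes>\<^bsub>A\<^esub> (c \<odot>\<^bsub>A\<^esub> y) = c \<odot>\<^bsub>A\<^esub> (x \<otimes>\<^bsub>A\<^esub> y)"
    and star_closed: "x \<in> carrier A \<Longrightarrow> star A x \<in> carrier A"
    and star_star: "x \<in> carrier A \<Longrightarrow> star A (star A x) = x"
    and star_add:
      "\<lbrakk>x \<in> carrier A; y \<in> carrier A\<rbrakk> \<Longrightarrow> star A (x \<oplus>\<^bsub>A\<^esub> y) = star A x \<oplus>\<^bsub>A\<^esub> star A y"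
    and star_smult: "x \<in> carrier A \<Longrightarrow> star A (c \<odot>\<^bsub>A\<^esub> x) = cnj c \<odot>\<^bsub>A\<^esub> star A x"
    and star_mult:
      "\<lbrakk>x \<in> carrier A; y \<in> carrier A\<rbrakk> \<Longrightarrow> star A (x \<otimes>\<^bsub>A\<^esub> y) = star A y \<otimes>\<^bsub>A\<^esub> star A x"
    and nrm_nonneg: "x \<in> carrier A \<Longrightarrow> 0 \<le> nrm A x"
    and nrm_eq_0: "x \<in> carrier A \<Longrightarrow> nrm A x = 0 \<longleftrightarrow> x = \<zero>\<^bsub>A\<^esub>"
    and nrm_smult: "x \<in> carrier A \<Longrightarrow> nrm A (c \<odot>\<^bsub>A\<^esub> x) = cmod c * nrm A x"
    and nrm_triangle:
      "\<lbrakk>x \<in> carrier A; y \<in> carrier A\<rbrakk> \<Longrightarrow> nrm A (x \<oplus>\<^bsub>A\<^esub> y) \<le> nrm A x + nrm A y"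
    and nrm_mult:
      "\<lbrakk>x \<in> carrier A; y \<in> carrier A\<rbrakk> \<Longrightarrow> nrm A (x \<otimes>\<^bsub>A\<^esub> y) \<le> nrm A x * nrm A y"
    and nrm_star_mult: "x \<in> carrier A \<Longrightarrow> nrm A (star A x \<otimes>\<^bsub>A\<^esub> x) = (nrm A x)\<^sup>2"
    and complete: "norm_complete A (nrm A)"

definition positive_elements :: "('a, 'm) cstar_scheme \<Rightarrow> 'a set" where
  "positive_elements A = {star A x \<otimes>\<^bsub>A\<^esub> x | x. x \<in> carrier A}"

text \<open>Functions on a subset \<open>X\<close> are represented by functions on the ambient type that are \<open>0\<close>
  outside \<open>X\<close>. For compact \<open>X\<close> the decay condition is void, so that \<open>C0_algebra X\<close> is \<open>C(X)\<close>.\<close>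

definition C0 :: "'x::topological_space set \<Rightarrow> ('x \<Rightarrow> complex) set" where
  "C0 X = {f. continuous_on X f \<and>
              (\<forall>e>0. \<exists>K. compact K \<and> K \<subseteq> X \<and> (\<forall>x\<in>X - K. cmod (f x) < e)) \<and>
              (\<forall>x. x \<notin> X \<longrightarrow> f x = 0)}"

definition C0_algebra :: "'x::topological_space set \<Rightarrow> ('x \<Rightarrow> complex) cstar" where
  "C0_algebra X =
    \<lparr>carrier = C0 X,
     mult = (\<lambda>f g x. f x * g x),
     one = undefined,
     zero = (\<lambda>x. 0),
     add = (\<lambda>f g x. f x + g x),
     smult = (\<lambda>c f x. c * f x),
     star = (\<lambda>f x. cnj (f x)),
     nrm = (\<lambda>f. SUP x. cmod (f x))\<rparr>"

text \<open>The algebra \<open>C([0,1], B)\<close>, which is the standard model of the C*-tensor product of \<open>B\<close>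
  with \<open>C([0,1])\<close>. Its elements are extended by \<open>0\<close> outside the unit interval.\<close>

definition path_algebra :: "('b, 'm) cstar_scheme \<Rightarrow> (real \<Rightarrow> 'b) cstar" where
  "path_algebra B =
    \<lparr>carrier = {g. (\<forall>t\<in>{0..1}. g t \<in> carrier B) \<and>
                   (\<forall>t. t \<notin> {0..1} \<longrightarrow> g t = \<zero>\<^bsub>B\<^esub>) \<and>
                   (\<forall>t\<in>{0..1}. \<forall>e>0. \<exists>d>0. \<forall>s\<in>{0..1}. \<bar>s - t\<bar> < d \<longrightarrow> nrm B (g s \<ominus>\<^bsub>B\<^esub> g t) < e)},
     mult = (\<lambda>g h t. if t \<in> {0..1} then g t \<otimes>\<^bsub>B\<^esub> h t else \<zero>\<^bsub>B\<^esub>),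
     one = undefined,
     zero = (\<lambda>t. \<zero>\<^bsub>B\<^esub>),
     add = (\<lambda>g h t. if t \<in> {0..1} then g t \<oplus>\<^bsub>B\<^esub> h t else \<zero>\<^bsub>B\<^esub>),
     smult = (\<lambda>c g t. if t \<in> {0..1} then c \<odot>\<^bsub>B\<^esub> g t else \<zero>\<^bsub>B\<^esub>),
     star = (\<lambda>g t. if t \<in> {0..1} then star B (g t) else \<zero>\<^bsub>B\<^esub>),
     nrm = (\<lambda>g. SUP t\<in>{0..1}. nrm B (g t))\<rparr>"

section \<open>Hilbert bimodules\<close>

record ('a, 'b, 'e) bimod = "(complex, 'e) module" +
  ip :: "'e \<Rightarrow> 'e \<Rightarrow> 'b"
  ract :: "'e \<Rightarrow> 'b \<Rightarrow> 'e"
  lact :: "'a \<Rightarrow> 'e \<Rightarrow> 'e"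

definition hnorm :: "('b, 'm) cstar_scheme \<Rightarrow> ('a, 'b, 'e) bimod \<Rightarrow> 'e \<Rightarrow> real" where
  "hnorm B E x = sqrt (nrm B (ip E x x))"

locale hilbert_module = B: cstar_algebra B + module complex_ring E
  for B :: "('b, 'm) cstar_scheme" and E :: "('a, 'b, 'e) bimod" +
  assumes ract_closed: "\<lbrakk>x \<in> carrier E; b \<in> carrier B\<rbrakk> \<Longrightarrow> ract E x b \<in> carrier E"
    and ract_add_l:
      "\<lbrakk>x \<in> carrier E; y \<in> carrier E; b \<in> carrier B\<rbrakk> \<Longrightarrow>
        ract E (x \<oplus>\<^bsub>E\<^esub> y) b = ract E x b \<oplus>\<^bsub>E\<^esub> ract E y b"
    and ract_add_r:
      "\<lbrakk>x \<in> carrier E; b \<in> carrier B; c \<in> carrier B\<rbrakk> \<Longrightarrow>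
        ract E x (b \<oplus>\<^bsub>B\<^esub> c) = ract E x b \<oplus>\<^bsub>E\<^esub> ract E x c"
    and ract_mult:
      "\<lbrakk>x \<in> carrier E; b \<in> carrier B; c \<in> carrier B\<rbrakk> \<Longrightarrow>
        ract E x (b \<otimes>\<^bsub>B\<^esub> c) = ract E (ract E x b) c"
    and ract_smult_l:
      "\<lbrakk>x \<in> carrier E; b \<in> carrier B\<rbrakk> \<Longrightarrow> ract E (z \<odot>\<^bsub>E\<^esub> x) b = z \<odot>\<^bsub>E\<^esub> ract E x b"
    and ract_smult_r:
      "\<lbrakk>x \<in> carrier E; b \<in> carrier B\<rbrakk> \<Longrightarrow> ract E x (z \<odot>\<^bsub>B\<^esub> b) = z \<odot>\<^bsub>E\<^esub> ract E x b"
    and ip_closed: "\<lbrakk>x \<in> carrier E; y \<in> carrier E\<rbrakk> \<Longrightarrow> ip E x y \<in> carrier B"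
    and ip_add:
      "\<lbrakk>x \<in> carrier E; y \<in> carrier E; w \<in> carrier E\<rbrakk> \<Longrightarrow>
        ip E x (y \<oplus>\<^bsub>E\<^esub> w) = ip E x y \<oplus>\<^bsub>B\<^esub> ip E x w"
    and ip_smult:
      "\<lbrakk>x \<in> carrier E; y \<in> carrier E\<rbrakk> \<Longrightarrow> ip E x (z \<odot>\<^bsub>E\<^esub> y) = z \<odot>\<^bsub>B\<^esub> ip E x y"
    and ip_ract:
      "\<lbrakk>x \<in> carrier E; y \<in> carrier E; b \<in> carrier B\<rbrakk> \<Longrightarrow>
        ip E x (ract E y b) = ip E x y \<otimes>\<^bsub>B\<^esub> b"
    and ip_star: "\<lbrakk>x \<in> carrier E; y \<in> carrier E\<rbrakk> \<Longrightarrow> star B (ip E x y) = ip E y x"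
    and ip_pos: "x \<in> carrier E \<Longrightarrow> ip E x x \<in> positive_elements B"
    and ip_definite: "\<lbrakk>x \<in> carrier E; ip E x x = \<zero>\<^bsub>B\<^esub>\<rbrakk> \<Longrightarrow> x = \<zero>\<^bsub>E\<^esub>"
    and hnorm_complete: "norm_complete E (hnorm B E)"

text \<open>The last assumption makes every \<open>lact E a\<close> adjointable with adjoint \<open>lact E (star A a)\<close>.\<close>

locale hilbert_bimodule = A: cstar_algebra A + hilbert_module B E
  for A :: "('a, 'k) cstar_scheme" and B :: "('b, 'm) cstar_scheme"
    and E :: "('a, 'b, 'e) bimod" +
  assumes lact_closed: "\<lbrakk>a \<in> carrier A; x \<in> carrier E\<rbrakk> \<Longrightarrow> lact E a x \<in> carrier E"
    and lact_add_l:
      "\<lbrakk>a \<in> carrier A; a' \<in> carrier A; x \<in> carrier E\<rbrakk> \<Longrightarrow>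
        lact E (a \<oplus>\<^bsub>A\<^esub> a') x = lact E a x \<oplus>\<^bsub>E\<^esub> lact E a' x"
    and lact_smult_l:
      "\<lbrakk>a \<in> carrier A; x \<in> carrier E\<rbrakk> \<Longrightarrow> lact E (z \<odot>\<^bsub>A\<^esub> a) x = z \<odot>\<^bsub>E\<^esub> lact E a x"
    and lact_mult:
      "\<lbrakk>a \<in> carrier A; a' \<in> carrier A; x \<in> carrier E\<rbrakk> \<Longrightarrow>
        lact E (a \<otimes>\<^bsub>A\<^esub> a') x = lact E a (lact E a' x)"
    and lact_add_r:
      "\<lbrakk>a \<in> carrier A; x \<in> carrier E; y \<in> carrier E\<rbrakk> \<Longrightarrow>
        lact E a (x \<oplus>\<^bsub>E\<^esub> y) = lact E a x \<oplus>\<^bsub>E\<^esub> lact E a y"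
    and lact_smult_r:
      "\<lbrakk>a \<in> carrier A; x \<in> carrier E\<rbrakk> \<Longrightarrow> lact E a (z \<odot>\<^bsub>E\<^esub> x) = z \<odot>\<^bsub>E\<^esub> lact E a x"
    and lact_ract:
      "\<lbrakk>a \<in> carrier A; x \<in> carrier E; b \<in> carrier B\<rbrakk> \<Longrightarrow>
        lact E a (ract E x b) = ract E (lact E a x) b"
    and ip_lact:
      "\<lbrakk>a \<in> carrier A; x \<in> carrier E; y \<in> carrier E\<rbrakk> \<Longrightarrow>
        ip E (lact E a x) y = ip E x (lact E (star A a) y)"

inductive_set generated_submodule ::
    "('b, 'm) cstar_scheme \<Rightarrow> ('a, 'b, 'e) bimod \<Rightarrow> 'e set \<Rightarrow> 'e set"
  for B :: "('b, 'm) cstar_scheme" and E :: "('a, 'b, 'e) bimod" and G :: "'e set" where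
  zero: "\<zero>\<^bsub>E\<^esub> \<in> generated_submodule B E G"
| add: "\<lbrakk>y \<in> generated_submodule B E G; g \<in> G; b \<in> carrier B\<rbrakk> \<Longrightarrow>
    y \<oplus>\<^bsub>E\<^esub> ract E g b \<in> generated_submodule B E G"

definition countably_generated :: "('b, 'm) cstar_scheme \<Rightarrow> ('a, 'b, 'e) bimod \<Rightarrow> bool" where
  "countably_generated B E \<longleftrightarrow>
     (\<exists>G. countable G \<and> G \<subseteq> carrier E \<and>
        (\<forall>x\<in>carrier E. \<forall>e>0. \<exists>y\<in>generated_submodule B E G. hnorm B E (x \<ominus>\<^bsub>E\<^esub> y) < e))"

section \<open>Adjointable and compact operators, bounded transform\<close>

definition adjoint_pair :: "('a, 'b, 'e) bimod \<Rightarrow> ('e \<Rightarrow> 'e) \<Rightarrow> ('e \<Rightarrow> 'e) \<Rightarrow> bool" where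
  "adjoint_pair E T T' \<longleftrightarrow>
     T \<in> carrier E \<rightarrow>\<^sub>E carrier E \<and> T' \<in> carrier E \<rightarrow>\<^sub>E carrier E \<and>
     (\<forall>x\<in>carrier E. \<forall>y\<in>carrier E. ip E (T x) y = ip E x (T' y))"

definition adjointable_ops :: "('a, 'b, 'e) bimod \<Rightarrow> ('e \<Rightarrow> 'e) set" where
  "adjointable_ops E = {T. \<exists>T'. adjoint_pair E T T'}"

definition op_adjoint :: "('a, 'b, 'e) bimod \<Rightarrow> ('e \<Rightarrow> 'e) \<Rightarrow> 'e \<Rightarrow> 'e" where
  "op_adjoint E T = (THE T'. adjoint_pair E T T')"

text \<open>The linear span of the operators \<open>z \<mapsto> x \<langle>y, z\<rangle>\<close>; complex scalars are absorbed in \<open>x\<close>.\<close>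

inductive_set finite_rank_ops :: "('a, 'b, 'e) bimod \<Rightarrow> ('e \<Rightarrow> 'e) set"
  for E :: "('a, 'b, 'e) bimod" where
  zero: "(\<lambda>z\<in>carrier E. \<zero>\<^bsub>E\<^esub>) \<in> finite_rank_ops E"
| add: "\<lbrakk>T \<in> finite_rank_ops E; x \<in> carrier E; y \<in> carrier E\<rbrakk> \<Longrightarrow>
    (\<lambda>z\<in>carrier E. T z \<oplus>\<^bsub>E\<^esub> ract E x (ip E y z)) \<in> finite_rank_ops E"

definition compact_ops ::
    "('b, 'm) cstar_scheme \<Rightarrow> ('a, 'b, 'e) bimod \<Rightarrow> ('e \<Rightarrow> 'e) set" where
  "compact_ops B E = {T \<in> adjointable_ops E.
     \<forall>e>0. \<exists>R\<in>finite_rank_ops E. \<forall>x\<in>carrier E. hnorm B E (T x \<ominus>\<^bsub>E\<^esub> R x) \<le> e * hnorm B E x}"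

definition positive_ops :: "('a, 'b, 'e) bimod \<Rightarrow> ('e \<Rightarrow> 'e) set" where
  "positive_ops E = {(\<lambda>x\<in>carrier E. op_adjoint E T (T x)) | T. T \<in> adjointable_ops E}"

definition op_sqrt :: "('a, 'b, 'e) bimod \<Rightarrow> ('e \<Rightarrow> 'e) \<Rightarrow> 'e \<Rightarrow> 'e" where
  "op_sqrt E R = (THE Q. Q \<in> positive_ops E \<and> (\<forall>x\<in>carrier E. Q (Q x) = R x))"

text \<open>An unbounded operator is given by its domain \<open>D\<close> and its action \<open>S\<close>.
  \<open>resolvent_sq E D S\<close> is \<open>(1 + S\<^sup>2)\<inverse>\<close>, with \<open>S\<^sup>2\<close> on its natural domain, and
  \<open>bounded_transform E D S\<close> is \<open>S (1 + S\<^sup>2)\<close> to the power \<open>-1/2\<close>. These are meaningful when \<open>S\<close> is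
  regular and self-adjoint.\<close>

definition resolvent_sq :: "('a, 'b, 'e) bimod \<Rightarrow> 'e set \<Rightarrow> ('e \<Rightarrow> 'e) \<Rightarrow> 'e \<Rightarrow> 'e" where
  "resolvent_sq E D S =
     (\<lambda>y\<in>carrier E. THE x. x \<in> D \<and> S x \<in> D \<and> x \<oplus>\<^bsub>E\<^esub> S (S x) = y)"

definition bounded_transform :: "('a, 'b, 'e) bimod \<Rightarrow> 'e set \<Rightarrow> ('e \<Rightarrow> 'e) \<Rightarrow> 'e \<Rightarrow> 'e" where
  "bounded_transform E D S = (\<lambda>x\<in>carrier E. S (op_sqrt E (resolvent_sq E D S) x))"

section \<open>Bounded KK-cycles, homotopy and KK\<close>

text \<open>All cycles are odd, that is, ungraded.\<close>

type_synonym ('a, 'b, 'e) cycle = "('a, 'b, 'e) bimod \<times> ('e \<Rightarrow> 'e)"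

definition kk_cycle ::
    "('a, 'k) cstar_scheme \<Rightarrow> ('b, 'm) cstar_scheme \<Rightarrow> ('a, 'b, 'e) cycle \<Rightarrow> bool" where
  "kk_cycle A B = (\<lambda>(E, F).
     hilbert_bimodule A B E \<and> countably_generated B E \<and> F \<in> adjointable_ops E \<and>
     (\<forall>a\<in>carrier A.
        (\<lambda>x\<in>carrier E. F (lact E a x) \<ominus>\<^bsub>E\<^esub> lact E a (F x)) \<in> compact_ops B E \<and>
        (\<lambda>x\<in>carrier E. lact E a (F (F x) \<ominus>\<^bsub>E\<^esub> x)) \<in> compact_ops B E \<and>
        (\<lambda>x\<in>carrier E. lact E a (F x \<ominus>\<^bsub>E\<^esub> op_adjoint E F x)) \<in> compact_ops B E))"

definition unitarily_equivalent ::
    "('a, 'k) cstar_scheme \<Rightarrow> ('b, 'm) cstar_scheme \<Rightarrow>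
     ('a, 'b, 'e) cycle \<Rightarrow> ('a, 'b, 'f) cycle \<Rightarrow> bool" where
  "unitarily_equivalent A B = (\<lambda>(E, F) (E', F').
     \<exists>U. bij_betw U (carrier E) (carrier E') \<and>
       (\<forall>x\<in>carrier E. \<forall>y\<in>carrier E. U (x \<oplus>\<^bsub>E\<^esub> y) = U x \<oplus>\<^bsub>E'\<^esub> U y) \<and>
       (\<forall>x\<in>carrier E. \<forall>c. U (c \<odot>\<^bsub>E\<^esub> x) = c \<odot>\<^bsub>E'\<^esub> U x) \<and>
       (\<forall>x\<in>carrier E. \<forall>b\<in>carrier B. U (ract E x b) = ract E' (U x) b) \<and>
       (\<forall>x\<in>carrier E. \<forall>y\<in>carrier E. ip E' (U x) (U y) = ip E x y) \<and>
       (\<forall>a\<in>carrier A. \<forall>x\<in>carrier E. U (lact E a x) = lact E' a (U x)) \<and>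
       (\<forall>x\<in>carrier E. U (F x) = F' (U x)))"

text \<open>Evaluation at \<open>t\<close> of a cycle over \<open>path_algebra B\<close>. Since \<open>g \<mapsto> g t\<close> is surjective onto \<open>B\<close>,
  the interior tensor product of \<open>E\<close> with \<open>B\<close> along this map is the quotient of \<open>E\<close> by the
  submodule of all \<open>x\<close> with \<open>\<langle>x, x\<rangle> t = 0\<close>; an element \<open>b\<close> acts on it through any lift \<open>g\<close> with
  \<open>g t = b\<close>.\<close>

definition ev_null :: "('b, 'm) cstar_scheme \<Rightarrow> real \<Rightarrow> ('a, real \<Rightarrow> 'b, 'e) bimod \<Rightarrow> 'e set" where
  "ev_null B t E = {x \<in> carrier E. ip E x x t = \<zero>\<^bsub>B\<^esub>}"

definition ev_bimod ::
    "('b, 'm) cstar_scheme \<Rightarrow> real \<Rightarrow> ('a, real \<Rightarrow> 'b, 'e) bimod \<Rightarrow> ('a, 'b, 'e set) bimod" where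
  "ev_bimod B t E = (let N = ev_null B t E in
    \<lparr>carrier = a_rcosets\<^bsub>E\<^esub> N,
     mult = undefined,
     one = undefined,
     zero = N,
     add = set_add E,
     smult = (\<lambda>c X. \<Union>x\<in>X. N +>\<^bsub>E\<^esub> (c \<odot>\<^bsub>E\<^esub> x)),
     ip = (\<lambda>X Y. THE b. \<exists>x\<in>X. \<exists>y\<in>Y. b = ip E x y t),
     ract = (\<lambda>X b. \<Union>x\<in>X. \<Union>g\<in>{g \<in> carrier (path_algebra B). g t = b}. N +>\<^bsub>E\<^esub> ract E x g),
     lact = (\<lambda>a X. \<Union>x\<in>X. N +>\<^bsub>E\<^esub> lact E a x)\<rparr>)"

definition ev_op ::
    "('b, 'm) cstar_scheme \<Rightarrow> real \<Rightarrow> ('a, real \<Rightarrow> 'b, 'e) bimod \<Rightarrow> ('e \<Rightarrow> 'e) \<Rightarrow> 'e set \<Rightarrow> 'e set" where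
  "ev_op B t E F = (\<lambda>X\<in>carrier (ev_bimod B t E). \<Union>x\<in>X. ev_null B t E +>\<^bsub>E\<^esub> F x)"

definition ev_cycle ::
    "('b, 'm) cstar_scheme \<Rightarrow> real \<Rightarrow> ('a, real \<Rightarrow> 'b, 'e) cycle \<Rightarrow> ('a, 'b, 'e set) cycle" where
  "ev_cycle B t = (\<lambda>(E, F). (ev_bimod B t E, ev_op B t E F))"

text \<open>A type of carriers has to be fixed for the cycles. A countably generated Hilbert module over
  a separable C*-algebra has at most the cardinality of the continuum, so whenever \<open>'e\<close> has at
  least this cardinality, every cycle and every homotopy has, up to unitary equivalence, carriers
  in \<open>'e\<close> and in \<open>real \<Rightarrow> 'e\<close>, respectively.\<close>

definition kk_homotopic ::
    "('a, 'k) cstar_scheme \<Rightarrow> ('b, 'm) cstar_scheme \<Rightarrow>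
     ('a, 'b, 'e) cycle \<Rightarrow> ('a, 'b, 'e) cycle \<Rightarrow> bool" where
  "kk_homotopic A B c0 c1 \<longleftrightarrow>
     kk_cycle A B c0 \<and> kk_cycle A B c1 \<and>
     (\<exists>h :: ('a, real \<Rightarrow> 'b, real \<Rightarrow> 'e) cycle.
        kk_cycle A (path_algebra B) h \<and>
        unitarily_equivalent A B (ev_cycle B 0 h) c0 \<and>
        unitarily_equivalent A B (ev_cycle B 1 h) c1)"

text \<open>The equivalence relation given by finite chains of homotopies, its set of classes, and the
  class of a cycle. These are the elements of the odd KK-group; its addition is not needed.\<close>

definition kk_rel ::
    "('a, 'k) cstar_scheme \<Rightarrow> ('b, 'm) cstar_scheme \<Rightarrow>
     (('a, 'b, 'e) cycle \<times> ('a, 'b, 'e) cycle) set" where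
  "kk_rel A B = {(x, y). kk_cycle A B x \<and> kk_cycle A B y \<and> equivclp (kk_homotopic A B) x y}"

definition KK ::
    "('a, 'k) cstar_scheme \<Rightarrow> ('b, 'm) cstar_scheme \<Rightarrow> ('a, 'b, 'e) cycle set set" where
  "KK A B = {x. kk_cycle A B x} // kk_rel A B"

definition kk_class ::
    "('a, 'k) cstar_scheme \<Rightarrow> ('b, 'm) cstar_scheme \<Rightarrow>
     ('a, 'b, 'e) cycle \<Rightarrow> ('a, 'b, 'e) cycle set" where
  "kk_class A B x = kk_rel A B `` {x}"

section \<open>Smooth maps and tubular neighbourhoods of the sphere\<close>

fun times_differentiable_on ::
    "nat \<Rightarrow> 'a::real_normed_vector set \<Rightarrow> ('a \<Rightarrow> 'b::real_normed_vector) \<Rightarrow> bool" where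
  "times_differentiable_on 0 U g \<longleftrightarrow> continuous_on U g"
| "times_differentiable_on (Suc k) U g \<longleftrightarrow>
     (\<forall>x\<in>U. g differentiable (at x)) \<and>
     (\<forall>v. times_differentiable_on k U (\<lambda>x. frechet_derivative g (at x) v))"

text \<open>Smoothness on an arbitrary subset of a Euclidean space, in particular on an embedded
  submanifold: local existence of smooth extensions.\<close>

definition smooth_map ::
    "'a::euclidean_space set \<Rightarrow> ('a \<Rightarrow> 'b::euclidean_space) \<Rightarrow> bool" where
  "smooth_map M f \<longleftrightarrow>
     (\<forall>x\<in>M. \<exists>U g. open U \<and> x \<in> U \<and> (\<forall>k. times_differentiable_on k U g) \<and>
        (\<forall>y\<in>U \<inter> M. g y = f y))"

definition diffeomorphism_onto ::
    "'a::euclidean_space set \<Rightarrow> 'b::euclidean_space set \<Rightarrow> ('a \<Rightarrow> 'b) \<Rightarrow> bool" where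
  "diffeomorphism_onto M N f \<longleftrightarrow>
     bij_betw f M N \<and> smooth_map M f \<and> smooth_map N (inv_into M f)"

text \<open>The normal bundle of the unit sphere is trivial; its zero section goes to the sphere
  itself.\<close>

definition tubular_neighbourhood_map :: "('v::euclidean_space \<times> real \<Rightarrow> 'v) \<Rightarrow> bool" where
  "tubular_neighbourhood_map j \<longleftrightarrow>
     (\<exists>T. open T \<and> sphere 0 1 \<subseteq> T \<and> diffeomorphism_onto (sphere 0 1 \<times> UNIV) T j) \<and>
     (\<forall>\<theta>\<in>sphere 0 1. j (\<theta>, 0) = \<theta>)"

section \<open>The cycles of the sphere\<close>

text \<open>The bimodule \<open>C\<^sub>0(X)\<close>, for \<open>X\<close> a subset of sphere times line, with right action and inner
  product transported along an injective map \<open>j\<close> on \<open>X\<close>, the inner product being weighted by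
  \<open>w\<close>.\<close>

definition transported_bimod ::
    "('v::euclidean_space \<times> real) set \<Rightarrow> ('v \<Rightarrow> real) \<Rightarrow> ('v \<times> real \<Rightarrow> 'v) \<Rightarrow>
     ('v \<Rightarrow> complex, 'v \<Rightarrow> complex, 'v \<times> real \<Rightarrow> complex) bimod" where
  "transported_bimod X w j =
    \<lparr>carrier = C0 X,
     mult = undefined,
     one = undefined,
     zero = (\<lambda>p. 0),
     add = (\<lambda>\<psi> \<phi> p. \<psi> p + \<phi> p),
     smult = (\<lambda>c \<psi> p. c * \<psi> p),
     ip = (\<lambda>\<psi> \<phi> x. if x \<in> j ` X
        then of_real (w x) * cnj (\<psi> (inv_into X j x)) * \<phi> (inv_into X j x) else 0),
     ract = (\<lambda>\<psi> h p. \<psi> p * h (j p)),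
     lact = (\<lambda>g \<psi> p. g (fst p) * \<psi> p)\<rparr>"

text \<open>In Cartesian terms, the point with spherical coordinates \<open>(\<theta>, r)\<close> is \<open>r *\<^sub>R \<theta>\<close>, and \<open>r\<close> is the
  norm of the point.\<close>

definition sph_emb :: "'v::euclidean_space \<times> real \<Rightarrow> 'v" where
  "sph_emb = (\<lambda>(\<theta>, s). (s + 1) *\<^sub>R \<theta>)"

definition E_mod ::
    "nat \<Rightarrow> real \<Rightarrow> ('v::euclidean_space \<Rightarrow> complex, 'v \<Rightarrow> complex, 'v \<times> real \<Rightarrow> complex) bimod" where
  "E_mod n \<epsilon> =
     transported_bimod (sphere 0 1 \<times> {-\<epsilon><..<\<epsilon>}) (\<lambda>x. 1 / norm x ^ n) sph_emb"

definition f_fun :: "real \<Rightarrow> real \<Rightarrow> real" where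
  "f_fun \<epsilon> s = (let \<alpha> = pi / (2 * \<epsilon>) in \<alpha> * tan (\<alpha> * s))"

definition S_op :: "real \<Rightarrow> ('v \<times> real \<Rightarrow> complex) \<Rightarrow> 'v \<times> real \<Rightarrow> complex" where
  "S_op \<epsilon> \<psi> = (\<lambda>(\<theta>, s). of_real (f_fun \<epsilon> s) * \<psi> (\<theta>, s))"

definition S_dom :: "nat \<Rightarrow> real \<Rightarrow> ('v::euclidean_space \<times> real \<Rightarrow> complex) set" where
  "S_dom n \<epsilon> = {\<psi> \<in> carrier (E_mod n \<epsilon>). S_op \<epsilon> \<psi> \<in> carrier (E_mod n \<epsilon>)}"

definition bS_op ::
    "nat \<Rightarrow> real \<Rightarrow> ('v::euclidean_space \<times> real \<Rightarrow> complex) \<Rightarrow> 'v \<times> real \<Rightarrow> complex" where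
  "bS_op n \<epsilon> = bounded_transform (E_mod n \<epsilon>) (S_dom n \<epsilon>) (S_op \<epsilon>)"

text \<open>The completion of \<open>C\<^sub>c\<close> in the unweighted inner product is \<open>C\<^sub>0\<close>, as its norm is the supremum
  norm.\<close>

definition E_CS ::
    "('v::euclidean_space \<times> real \<Rightarrow> 'v) \<Rightarrow>
     ('v \<Rightarrow> complex, 'v \<Rightarrow> complex, 'v \<times> real \<Rightarrow> complex) bimod" where
  "E_CS j = transported_bimod (sphere 0 1 \<times> UNIV) (\<lambda>x. 1) j"

definition F_CS ::
    "real \<Rightarrow> ('v::euclidean_space \<times> real \<Rightarrow> 'v) \<Rightarrow>
     ('v \<times> real \<Rightarrow> complex) \<Rightarrow> 'v \<times> real \<Rightarrow> complex" where
  "F_CS \<epsilon> j = (\<lambda>\<psi>\<in>carrier (E_CS j). \<lambda>(\<theta>, s).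
     if s \<le> -\<epsilon> then - \<psi> (\<theta>, s)
     else if s < \<epsilon> then of_real (f_fun \<epsilon> s / sqrt (1 + (f_fun \<epsilon> s)\<^sup>2)) * \<psi> (\<theta>, s)
     else \<psi> (\<theta>, s))"

end

(* The two inner products differ by the weight r^(-n), which is absorbed by multiplication with
   r^(n/2), and b(S) is multiplication by f / sqrt (1 + f^2), the restriction of the multiplier b
   of F. Hence both cycles are given by multiplication with the same function b(s), on
   S^n x (-eps, eps) and on S^n x R. Let W be the set of all (t, theta, s) in [0,1] x S^n x R with
   t > 0 or |s| < eps, which is open there. Then C_0(W) with multiplication by b(s) is a homotopy:
   its slices at t = 0 and t = 1 are the two cycles, and b^2 - 1 vanishes for |s| >= eps, so that
   it lies in C_0(W) and multiplication by it is compact. *)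

theory Submission
  imports Defs
begin

section \<open>Continuous functions vanishing at infinity\<close>

text \<open>The module itself has to change along the homotopy: up to the rescaling, C_0 of the thin
  tube is a proper submodule of C_0 of the whole tube, and a change of the operator alone cannot
  bridge that. Openness of W makes the family legitimate, for it lets functions on W be extended by
  zero to [0,1] x R^(n+1), so that inner products are norm continuous paths in C_0(R^(n+1)). The
  other difficulty is that adjoints, square roots, resolvents and evaluated modules are given by
  unique descriptions or quotients. All three modules look like C_0(X) with X open in the space
  underlying the coefficient algebra, so every adjointable operator multiplies by a function, and
  uniqueness becomes a statement about numbers at each point. One strictly positive function in
  C_0(X) drives this: it tests operators for equality, generates the module, and gives the rank-one
  approximations behind compactness. The quotient that defines an evaluation is replaced by a
  surjection that has the null submodule as its kernel.\<close>

lemma C0D: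
  assumes "f \<in> C0 X"
  shows "continuous_on X f" "x \<notin> X \<Longrightarrow> f x = 0"
    and "e > 0 \<Longrightarrow> \<exists>K. compact K \<and> K \<subseteq> X \<and> (\<forall>x. x \<notin> K \<longrightarrow> cmod (f x) < e)"
proof -
  show "continuous_on X f" "x \<notin> X \<Longrightarrow> f x = 0"
    using assms unfolding C0_def by auto
  assume "e > 0"
  then obtain K where K: "compact K" "K \<subseteq> X" "\<forall>x\<in>X - K. cmod (f x) < e"
    using assms unfolding C0_def by blast
  \<comment> \<open>Off \<open>X\<close> the value is 0, so the bound extends from
    \<open>X - K\<close> to every point outside \<open>K\<close>; later arguments split only on
    membership in \<open>K\<close>.\<close>
  have "\<forall>x. x \<notin> K \<longrightarrow> cmod (f x) < e"
    using K assms \<open>e > 0\<close> unfolding C0_def by (metis (mono_tags, lifting) DiffI mem_Collect_eq norm_zero)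
  then show "\<exists>K. compact K \<and> K \<subseteq> X \<and> (\<forall>x. x \<notin> K \<longrightarrow> cmod (f x) < e)"
    using K by blast
qed

lemma C0I:
  assumes "continuous_on X f" "\<And>x. x \<notin> X \<Longrightarrow> f x = 0"
    and "\<And>e. e > 0 \<Longrightarrow> \<exists>K. compact K \<and> K \<subseteq> X \<and> (\<forall>x\<in>X - K. cmod (f x) < e)"
  shows "f \<in> C0 X"
  using assms unfolding C0_def by auto

lemma C0_bounded:
  assumes "f \<in> C0 X"
  obtains c where "c > 0" "\<And>x. cmod (f x) \<le> c"
proof -
  obtain K where K: "compact K" "K \<subseteq> X" "\<forall>x. x \<notin> K \<longrightarrow> cmod (f x) < 1"
    using C0D(3)[OF assms, of 1] by auto
  have "compact (f ` K)"
    using C0D(1)[OF assms] K compact_continuous_image continuous_on_subset by blast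
  then obtain b where "\<forall>z\<in>f ` K. norm z \<le> b"
    using compact_imp_bounded bounded_iff by blast
  then have "cmod (f x) \<le> max b 1" for x
    using K(3) by (cases "x \<in> K") (auto simp: le_max_iff_disj less_imp_le)
  then show thesis using that[of "max b 1"] by auto
qed

text \<open>The supremum runs over the whole ambient type, where functions vanish off their space,
  so it is never a supremum over the empty set.\<close>

definition sup_norm :: "('x \<Rightarrow> complex) \<Rightarrow> real" where
  "sup_norm f = (SUP x. cmod (f x))"

lemma C0_le_sup_norm: "f \<in> C0 X \<Longrightarrow> cmod (f x) \<le> sup_norm f"
  unfolding sup_norm_def
  by (rule cSUP_upper) (auto elim!: C0_bounded simp: bdd_above_def)

lemma sup_norm_le: "(\<And>x. cmod (f x) \<le> c) \<Longrightarrow> sup_norm f \<le> c"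
  unfolding sup_norm_def by (rule cSUP_least) auto

lemma sup_norm_nonneg: "f \<in> C0 X \<Longrightarrow> 0 \<le> sup_norm f"
  using C0_le_sup_norm norm_ge_zero order_trans by blast

lemma C0_zero [simp]: "(\<lambda>x. 0) \<in> C0 X"
  by (rule C0I) auto

lemma C0_add:
  assumes "f \<in> C0 X" "g \<in> C0 X"
  shows "(\<lambda>x. f x + g x) \<in> C0 X"
proof (rule C0I)
  show "continuous_on X (\<lambda>x. f x + g x)"
    using assms C0D(1) by (intro continuous_intros) auto
  show "f x + g x = 0" if "x \<notin> X" for x
    using that by (simp add: C0D(2)[OF assms(1)] C0D(2)[OF assms(2)])
  fix e :: real assume "e > 0"
  then obtain K L where "compact K" "K \<subseteq> X" "\<forall>x. x \<notin> K \<longrightarrow> cmod (f x) < e / 2"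
      "compact L" "L \<subseteq> X" "\<forall>x. x \<notin> L \<longrightarrow> cmod (g x) < e / 2"
    using C0D(3)[OF assms(1), of "e/2"] C0D(3)[OF assms(2), of "e/2"] by auto
  then show "\<exists>K. compact K \<and> K \<subseteq> X \<and> (\<forall>x\<in>X - K. cmod (f x + g x) < e)"
    by (intro exI[of _ "K \<union> L"]) (auto intro!: norm_triangle_lt simp: compact_Un; smt (verit) field_sum_of_halves)
qed

lemma C0_mult_bounded:
  assumes "f \<in> C0 X" "continuous_on X g" "\<And>x. x \<in> X \<Longrightarrow> cmod (g x) \<le> c"
  shows "(\<lambda>x. g x * f x) \<in> C0 X"
proof (rule C0I)
  show "continuous_on X (\<lambda>x. g x * f x)"
    using assms C0D(1) by (intro continuous_intros) auto
  show "g x * f x = 0" if "x \<notin> X" for x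
    using that by (simp add: C0D(2)[OF assms(1)])
  fix e :: real assume "e > 0"
  \<comment> \<open>\<open>c\<close> bounds \<open>g\<close> only on \<open>X\<close> and may be
    zero, or negative when \<open>X\<close> is empty; adding 1 to its absolute value keeps the
    divisor positive.\<close>
  define d where "d = e / (\<bar>c\<bar> + 1)"
  have "d > 0" using \<open>e > 0\<close> by (auto simp: d_def)
  then obtain K where K: "compact K" "K \<subseteq> X" "\<forall>x. x \<notin> K \<longrightarrow> cmod (f x) < d"
    using C0D(3)[OF assms(1)] by blast
  have "cmod (g x * f x) < e" if "x \<in> X - K" for x
  proof -
    have "cmod (g x * f x) \<le> (\<bar>c\<bar> + 1) * cmod (f x)"
      using assms(3)[of x] that by (auto simp: norm_mult intro!: mult_right_mono)
    also have "\<dots> < (\<bar>c\<bar> + 1) * d"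
      using K that by (intro mult_strict_left_mono) auto
    finally show ?thesis by (simp add: d_def)
  qed
  then show "\<exists>K. compact K \<and> K \<subseteq> X \<and> (\<forall>x\<in>X - K. cmod (g x * f x) < e)"
    using K by blast
qed

lemma C0_smult: "f \<in> C0 X \<Longrightarrow> (\<lambda>x. c * f x) \<in> C0 X"
  by (rule C0_mult_bounded[where c = "cmod c"]) auto

lemma C0_diff: "f \<in> C0 X \<Longrightarrow> g \<in> C0 X \<Longrightarrow> (\<lambda>x. f x - g x) \<in> C0 X"
  using C0_add[of f X "\<lambda>x. -1 * g x"] C0_smult[of g X "-1"] by simp

lemma C0_mult:
  assumes "f \<in> C0 X" "g \<in> C0 X"
  shows "(\<lambda>x. f x * g x) \<in> C0 X"
proof -
  obtain c where "\<And>x. cmod (f x) \<le> c" using C0_bounded[OF assms(1)] by blast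
  then show ?thesis using C0_mult_bounded[OF assms(2) C0D(1)[OF assms(1)]] by blast
qed

lemma C0_cnj:
  assumes "f \<in> C0 X"
  shows "(\<lambda>x. cnj (f x)) \<in> C0 X"
proof (rule C0I)
  show "continuous_on X (\<lambda>x. cnj (f x))"
    using assms C0D(1) by (intro continuous_intros) auto
  show "\<exists>K. compact K \<and> K \<subseteq> X \<and> (\<forall>x\<in>X - K. cmod (cnj (f x)) < e)" if "e > 0" for e
    using C0D(3)[OF assms that] by auto
qed (simp add: C0D(2)[OF assms])

lemma C0_divide_shift:
  assumes "f \<in> C0 X" "continuous_on X h" "\<And>x. x \<in> X \<Longrightarrow> 0 < h x" "d > 0"
  shows "(\<lambda>x. of_real (1 / (h x + d)) * f x) \<in> C0 X"
proof (rule C0_mult_bounded[OF assms(1), where c = "1/d"])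
  have "h x + d \<noteq> 0" if "x \<in> X" for x using assms(3)[OF that] \<open>d > 0\<close> by auto
  then show "continuous_on X (\<lambda>x. complex_of_real (1 / (h x + d)))"
    using assms(2) by (intro continuous_intros) auto
  show "cmod (complex_of_real (1 / (h x + d))) \<le> 1 / d" if "x \<in> X" for x
    unfolding norm_of_real using assms(3)[OF that] \<open>d > 0\<close> by (simp add: frac_le)
qed

text \<open>Since \<open>f - f h / (h + d) = f d / (h + d)\<close>, a strictly positive \<open>h \<in> C\<^sub>0(X)\<close> yields an
  approximate unit.\<close>

lemma C0_approximate_unit:
  assumes f: "f \<in> C0 X" and h: "continuous_on X h" "\<And>x. x \<in> X \<Longrightarrow> 0 < h x" and "e > 0"
  obtains d where "d > 0" "\<And>x. cmod (f x - of_real (h x / (h x + d)) * f x) < e"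
proof -
  obtain K where K: "compact K" "K \<subseteq> X" "\<forall>x. x \<notin> K \<longrightarrow> cmod (f x) < e"
    using C0D(3)[OF f \<open>e > 0\<close>] by blast
  obtain c where c: "c > 0" "\<And>x. cmod (f x) \<le> c" using C0_bounded[OF f] by blast
  obtain m where m: "m > 0" "\<And>x. x \<in> K \<Longrightarrow> m \<le> h x"
  proof (cases "K = {}")
    case True
    then show ?thesis using that[of 1] by auto
  next
    case False
    then obtain z where "z \<in> K" "\<forall>x\<in>K. h z \<le> h x"
      using continuous_attains_inf[OF K(1)] h(1) K(2) continuous_on_subset by blast
    then show ?thesis using that[of "h z"] h(2) K(2) by auto
  qed
  \<comment> \<open>\<open>m\<close> is a lower bound of \<open>h\<close> on \<open>K\<close> and
    \<open>c\<close> a bound of |f|, so the error on \<open>K\<close> is at most d / m * c = e / 2.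
    Off \<open>K\<close> the factor d / (h + d) is at most 1 and \<open>f\<close> itself is below
    \<open>e\<close>.\<close>
  define d where "d = m * e / (2 * c)"
  have d: "d > 0" using m c \<open>e > 0\<close> by (simp add: d_def)
  have "cmod (f x - of_real (h x / (h x + d)) * f x) < e" for x
  proof (cases "x \<in> X")
    case False
    then show ?thesis using C0D(2)[OF f] \<open>e > 0\<close> by simp
  next
    case True
    have p: "h x > 0" using h(2) True by blast
    have "f x - of_real (h x / (h x + d)) * f x = of_real (d / (h x + d)) * f x"
    proof -
      have "1 - h x / (h x + d) = d / (h x + d)" using p d by (simp add: field_simps)
      then show ?thesis by (metis left_diff_distrib mult_1 of_real_1 of_real_diff)
    qed
    then have *: "cmod (f x - of_real (h x / (h x + d)) * f x) = d / (h x + d) * cmod (f x)"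
      using p d by (simp add: norm_mult norm_divide del: of_real_add)
    show ?thesis
    proof (cases "x \<in> K")
      case True
      have "d / (h x + d) * cmod (f x) \<le> d / m * c"
        using m(2)[OF True] m(1) d c(2)[of x] by (intro mult_mono frac_le) auto
      also have "\<dots> < e" using m c \<open>e > 0\<close> by (simp add: d_def)
      finally show ?thesis using * by simp
    next
      case False
      have "d / (h x + d) * cmod (f x) \<le> 1 * cmod (f x)"
        using p d by (intro mult_right_mono) auto
      then show ?thesis using * K(3) False by fastforce
    qed
  qed
  then show thesis using that d by blast
qed

section \<open>Completeness in the supremum norm\<close>

lemma C0_uniform_limit:
  assumes "\<And>k::nat. f k \<in> C0 X" and lim: "uniform_limit UNIV f g sequentially"
  shows "g \<in> C0 X"
proof (rule C0I)
  show "continuous_on X g"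
    by (rule uniform_limit_theorem[where F = sequentially and f = f])
      (auto intro!: always_eventually C0D(1)[OF assms(1)] uniform_limit_on_subset[OF lim])
  show "g x = 0" if "x \<notin> X" for x
    using tendsto_uniform_limitI[OF lim, of x] C0D(2)[OF assms(1) that]
    by (simp add: LIMSEQ_const_iff)
  fix e :: real assume "e > 0"
  then obtain k where k: "\<forall>x. dist (f k x) (g x) < e / 2"
    using uniform_limitD[OF lim, of "e/2"] by (auto simp: eventually_sequentially)
  obtain K where K: "compact K" "K \<subseteq> X" "\<forall>x. x \<notin> K \<longrightarrow> cmod (f k x) < e / 2"
    using C0D(3)[OF assms(1), of "e/2" k] \<open>e > 0\<close> by auto
  have "cmod (g x) < e" if "x \<notin> K" for x
    using K(3) that spec[OF k, of x] norm_triangle_sub[of "g x" "f k x"]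
    by (smt (verit) dist_norm field_sum_of_halves norm_minus_commute)
  then show "\<exists>K. compact K \<and> K \<subseteq> X \<and> (\<forall>x\<in>X - K. cmod (g x) < e)"
    using K by blast
qed

lemma C0_complete:
  assumes "\<And>k::nat. f k \<in> C0 X"
    and "\<And>e. e > 0 \<Longrightarrow> \<exists>k0. \<forall>k\<ge>k0. \<forall>l\<ge>k0. sup_norm (\<lambda>x. f k x - f l x) < e"
  obtains g where "g \<in> C0 X" "(\<lambda>k. sup_norm (\<lambda>x. f k x - g x)) \<longlonglongrightarrow> 0"
proof -
  have "uniformly_Cauchy_on UNIV f"
    unfolding uniformly_Cauchy_on_def dist_norm
    using assms(2) C0_le_sup_norm[OF C0_diff[OF assms(1) assms(1)]]
    by (metis order_le_less_trans)
  then obtain g where g: "uniform_limit UNIV f g sequentially"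
    using uniformly_convergent_eq_Cauchy uniformly_convergent_on_def by metis
  have gC: "g \<in> C0 X" using C0_uniform_limit[OF assms(1) g] .
  have "(\<lambda>k. sup_norm (\<lambda>x. f k x - g x)) \<longlonglongrightarrow> 0"
  proof (rule LIMSEQ_I)
    fix e :: real assume "e > 0"
    then obtain k0 where k0: "\<And>k x. k \<ge> k0 \<Longrightarrow> dist (f k x) (g x) < e / 2"
      using uniform_limitD[OF g, of "e/2"] by (auto simp: eventually_sequentially)
    have "norm (sup_norm (\<lambda>x. f k x - g x) - 0) < e" if "k \<ge> k0" for k
    proof -
      have "sup_norm (\<lambda>x. f k x - g x) \<le> e / 2"
        by (rule sup_norm_le) (use k0[OF that] in \<open>auto simp: dist_norm less_imp_le\<close>)
      then show ?thesis
        using sup_norm_nonneg[OF C0_diff[OF assms(1)[of k] gC]] \<open>e > 0\<close> by simp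
    qed
    then show "\<exists>k0. \<forall>k\<ge>k0. norm (sup_norm (\<lambda>x. f k x - g x) - 0) < e" by blast
  qed
  then show thesis using that gC by blast
qed

section \<open>Open embeddings and extension by zero\<close>

definition open_embedding ::
    "'x::topological_space set \<Rightarrow> 'y::topological_space set \<Rightarrow> ('x \<Rightarrow> 'y) \<Rightarrow> bool" where
  "open_embedding X Y j \<longleftrightarrow> inj_on j X \<and> continuous_on X j \<and>
     continuous_on (j ` X) (inv_into X j) \<and> openin (top_of_set Y) (j ` X)"

text \<open>The extension-by-zero homomorphism from C_0(X) to C_0(Y) that an open embedding induces;
  inner products and coefficient elements are built from it. Openness is taken relative to Y because
  Y = [0,1] x R^(n+1) must be allowed.\<close>

definition push :: "'x set \<Rightarrow> ('x \<Rightarrow> 'y) \<Rightarrow> ('x \<Rightarrow> complex) \<Rightarrow> 'y \<Rightarrow> complex" where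
  "push X j \<phi> = (\<lambda>y. if y \<in> j ` X then \<phi> (inv_into X j y) else 0)"

lemma push_embedded [simp]: "open_embedding X Y j \<Longrightarrow> x \<in> X \<Longrightarrow> push X j \<phi> (j x) = \<phi> x"
  by (auto simp: push_def open_embedding_def)

lemma push_outside: "y \<notin> j ` X \<Longrightarrow> push X j \<phi> y = 0"
  by (auto simp: push_def)

text \<open>Openness of j(X) settles continuity at image points, since near them only j(X) is seen.
  At any other point y decay takes over: the image of the compact set is closed and misses y, so the
  function is below e on a neighbourhood of y.\<close>

lemma push_C0:
  fixes j :: "'x::topological_space \<Rightarrow> 'y::t2_space"
  assumes j: "open_embedding X Y j" and \<phi>: "\<phi> \<in> C0 X"
  shows "push X j \<phi> \<in> C0 Y"
proof (rule C0I)
  have jD: "inj_on j X" "continuous_on X j" "continuous_on (j ` X) (inv_into X j)"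
      "openin (top_of_set Y) (j ` X)"
    using j by (auto simp: open_embedding_def)
  obtain U where U: "open U" "j ` X = Y \<inter> U" using jD(4) by (auto simp: openin_open)
  have decay: "\<exists>K. compact K \<and> K \<subseteq> j ` X \<and> (\<forall>y. y \<notin> K \<longrightarrow> cmod (push X j \<phi> y) < e)"
    if "e > 0" for e
  proof -
    obtain K where K: "compact K" "K \<subseteq> X" "\<forall>x. x \<notin> K \<longrightarrow> cmod (\<phi> x) < e"
      using C0D(3)[OF \<phi> \<open>e > 0\<close>] by blast
    have "compact (j ` K)" using K jD(2) compact_continuous_image continuous_on_subset by blast
    moreover have "cmod (push X j \<phi> y) < e" if "y \<notin> j ` K" for y
      using that K(3) \<open>e > 0\<close> unfolding push_def
      by (auto simp: inv_into_f_f[OF jD(1)])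
    ultimately show ?thesis using K(2) by blast
  qed
  show "continuous_on Y (push X j \<phi>)"
    unfolding continuous_on_def
  proof
    fix y assume y: "y \<in> Y"
    show "(push X j \<phi> \<longlongrightarrow> push X j \<phi> y) (at y within Y)"
    proof (cases "y \<in> j ` X")
      case True
      have "continuous_on (j ` X) (\<lambda>y. \<phi> (inv_into X j y))"
        by (rule continuous_on_compose2[OF C0D(1)[OF \<phi>] jD(3)]) (blast intro: inv_into_into)
      then have "continuous_on (j ` X) (push X j \<phi>)"
        by (rule continuous_on_eq) (auto simp: push_def)
      moreover have "at y within Y = at y within (j ` X)"
        using at_within_nhd[OF _ U(1), of y Y "j ` X"] True U(2) by auto
      ultimately show ?thesis using True unfolding continuous_on_def by metis
    next
      case False
      show ?thesis
      proof (rule tendstoI)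
        fix e :: real assume "e > 0"
        then obtain K where K: "compact K" "K \<subseteq> j ` X" "\<forall>y. y \<notin> K \<longrightarrow> cmod (push X j \<phi> y) < e"
          using decay by blast
        have "open (- K)" "y \<in> - K" using K(1,2) False compact_imp_closed by auto
        then have "\<forall>\<^sub>F z in at y within Y. z \<in> - K"
          by (metis eventually_at_topological)
        then show "\<forall>\<^sub>F z in at y within Y. dist (push X j \<phi> z) (push X j \<phi> y) < e"
          by (rule eventually_mono) (use K(3) False push_outside in \<open>fastforce simp: dist_norm\<close>)
      qed
    qed
  qed
  have sub: "j ` X \<subseteq> Y" using jD(4) openin_imp_subset by blast
  show "push X j \<phi> y = 0" if "y \<notin> Y" for y
    by (rule push_outside) (use that sub in blast)
  show "\<exists>K. compact K \<and> K \<subseteq> Y \<and> (\<forall>y\<in>Y - K. cmod (push X j \<phi> y) < e)" if "e > 0" for e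
    using decay[OF that] sub by (meson DiffD2 subset_trans)
qed

text \<open>The inclusion is an open embedding, and pushing along it changes nothing, since elements
  of C_0(X) already are 0 off \<open>X\<close>.\<close>

lemma C0_openin_mono:
  fixes X :: "'x::t2_space set"
  assumes "openin (top_of_set Y) X" "f \<in> C0 X"
  shows "f \<in> C0 Y"
proof -
  have inv: "inv_into X (\<lambda>x. x) x = x" if "x \<in> X" for x
    using that by (metis inj_on_def inv_into_f_f)
  have "continuous_on X (inv_into X (\<lambda>x. x))"
    by (rule continuous_on_eq[OF continuous_on_id]) (use inv in auto)
  then have "open_embedding X Y (\<lambda>x. x)"
    using assms(1) by (auto simp: open_embedding_def inj_on_def continuous_on_id)
  then have "push X (\<lambda>x. x) f \<in> C0 Y" using push_C0 assms(2) by blast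
  moreover have "push X (\<lambda>x. x) f = f"
    using C0D(2)[OF assms(2)] inv by (auto simp: push_def fun_eq_iff)
  ultimately show ?thesis by simp
qed

text \<open>The distance to the complement, cut off at 1, forces decay towards the boundary, and
  division by 1 + |x| forces it at infinity; closedness of \<open>Y\<close> then makes the relevant
  superlevel sets compact.\<close>

lemma strictly_positive_C0:
  fixes Y :: "'y::euclidean_space set"
  assumes "closed Y" "openin (top_of_set Y) X"
  obtains h :: "'y \<Rightarrow> real" where "\<And>x. x \<in> X \<Longrightarrow> 0 < h x" "(\<lambda>x. of_real (h x)) \<in> C0 X"
proof -
  obtain U where U: "open U" "X = Y \<inter> U" using assms(2) by (auto simp: openin_open)
  \<comment> \<open>\<open>infdist\<close> to the empty set is 0 by convention, which would destroy
    positivity when \<open>U\<close> is the whole space.\<close>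
  define r where "r x = (if U = UNIV then 1 else min 1 (infdist x (- U)))" for x :: 'y
  define h where "h x = (if x \<in> X then r x / (1 + norm x) else 0)" for x :: 'y
  have r: "0 \<le> r x" "r x \<le> 1" for x by (auto simp: r_def infdist_nonneg)
  have rU: "0 < r x \<longleftrightarrow> x \<in> U" for x
    using U(1) infdist_pos_not_in_closed[of "- U" x]
    by (auto simp: r_def closed_def) (metis ComplI infdist_zero less_irrefl)
  have cr: "continuous_on UNIV r"
    by (cases "U = UNIV") (auto simp: r_def intro!: continuous_on_min continuous_on_infdist)
  have n1: "1 + norm x > 0" for x :: 'y by (smt (verit) norm_ge_zero)
  have pos: "0 < h x" if "x \<in> X" for x
    using that U rU n1 by (auto simp: h_def)
  moreover have "(\<lambda>x. complex_of_real (h x)) \<in> C0 X"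
  proof (rule C0I)
    have "continuous_on X (\<lambda>x. complex_of_real (r x / (1 + norm x)))"
      using n1 by (intro continuous_intros continuous_on_subset[OF cr]) (auto simp: less_imp_neq[symmetric])
    then show "continuous_on X (\<lambda>x. complex_of_real (h x))"
      by (rule continuous_on_eq) (auto simp: h_def)
    show "complex_of_real (h x) = 0" if "x \<notin> X" for x using that by (simp add: h_def)
    fix e :: real assume e: "e > 0"
    \<comment> \<open>Beyond radius 1/e the denominator alone brings r / (1 + |x|) below e, because
      r is at most 1.\<close>
    define K where "K = Y \<inter> {x. e \<le> r x} \<inter> cball 0 (1/e)"
    have "closed {x. e \<le> r x}"
      using continuous_closed_preimage[OF cr, of "{e..}"] by (auto simp: vimage_def)
    then have "compact K"
      unfolding K_def using assms(1) by (intro closed_Int_compact) auto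
    moreover have "K \<subseteq> X"
    proof
      fix x assume "x \<in> K"
      then have "x \<in> Y" "0 < r x" using e by (auto simp: K_def)
      then show "x \<in> X" using rU U(2) by blast
    qed
    moreover have "cmod (complex_of_real (h x)) < e" if "x \<in> X - K" for x
    proof -
      have x: "x \<in> X" "r x < e \<or> 1 / e < norm x" using that U by (auto simp: K_def)
      have "r x / (1 + norm x) < e"
        using x(2)
      proof
        assume "r x < e"
        moreover have "r x / (1 + norm x) \<le> r x / 1" using r n1 by (intro frac_le) auto
        ultimately show ?thesis by simp
      next
        assume "1 / e < norm x"
        then have "1 < e * norm x" using e by (simp add: field_simps)
        then have "1 < e * (1 + norm x)" using e by (simp add: algebra_simps)
        then show ?thesis using n1[of x] r(2)[of x] by (simp add: divide_less_eq) 
      qed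
      then show ?thesis
        unfolding norm_of_real using x(1) r(1)[of x] n1[of x] by (simp add: h_def)
    qed
    ultimately show "\<exists>K. compact K \<and> K \<subseteq> X \<and> (\<forall>x\<in>X - K. cmod (complex_of_real (h x)) < e)"
      by blast
  qed
  ultimately show thesis using that by blast
qed

section \<open>Function algebras\<close>

lemma complex_ring_simps [simp]:
  "carrier complex_ring = UNIV" "\<one>\<^bsub>complex_ring\<^esub> = 1" "\<zero>\<^bsub>complex_ring\<^esub> = 0"
  "a \<otimes>\<^bsub>complex_ring\<^esub> b = a * b" "a \<oplus>\<^bsub>complex_ring\<^esub> b = a + b"
  by (simp_all add: complex_ring_def)

lemma cring_complex_ring: "cring complex_ring"
proof (rule cringI)
  show "abelian_group complex_ring"
  proof (rule abelian_groupI)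
    show "\<exists>y\<in>carrier complex_ring. y \<oplus>\<^bsub>complex_ring\<^esub> x = \<zero>\<^bsub>complex_ring\<^esub>" for x
      by (rule bexI[of _ "- x"]) simp_all
  qed (auto simp: add.assoc add.commute)
  show "Group.comm_monoid complex_ring"
    by (rule comm_monoidI) (auto simp: mult.assoc mult.commute)
qed (auto simp: distrib_right)

text \<open>A vector space whose elements are functions in \<open>C\<^sub>0(X)\<close> up to a relabelling \<open>\<Psi>\<close> of the
  ambient type; the relabelling is the identity or currying.\<close>

locale c0_space =
  fixes M :: "(complex, 'e, 'm) module_scheme" and \<Psi> :: "'e \<Rightarrow> 'x::topological_space \<Rightarrow> complex"
    and X :: "'x set"
  assumes bij: "bij \<Psi>"
    and carrier_iff: "x \<in> carrier M \<longleftrightarrow> \<Psi> x \<in> C0 X"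
    and zero: "\<Psi> \<zero>\<^bsub>M\<^esub> = (\<lambda>p. 0)"
    and add: "\<lbrakk>x \<in> carrier M; y \<in> carrier M\<rbrakk> \<Longrightarrow> \<Psi> (x \<oplus>\<^bsub>M\<^esub> y) = (\<lambda>p. \<Psi> x p + \<Psi> y p)"
    and smult: "x \<in> carrier M \<Longrightarrow> \<Psi> (c \<odot>\<^bsub>M\<^esub> x) = (\<lambda>p. c * \<Psi> x p)"
begin

lemma eqI: "(\<And>p. \<Psi> x p = \<Psi> y p) \<Longrightarrow> x = y"
  using bij by (metis bij_pointE ext)

lemma lift:
  assumes "f \<in> C0 X"
  obtains x where "x \<in> carrier M" "\<Psi> x = f"
  using assms bij carrier_iff by (metis bij_pointE)

lemma zero_closed: "\<zero>\<^bsub>M\<^esub> \<in> carrier M"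
  by (simp add: carrier_iff zero)

lemma add_closed: "x \<in> carrier M \<Longrightarrow> y \<in> carrier M \<Longrightarrow> x \<oplus>\<^bsub>M\<^esub> y \<in> carrier M"
  using add[of x y] C0_add[of "\<Psi> x" X "\<Psi> y"] by (simp add: carrier_iff)

lemma smult_closed: "x \<in> carrier M \<Longrightarrow> c \<odot>\<^bsub>M\<^esub> x \<in> carrier M"
  using smult[of x c] C0_smult[of "\<Psi> x" X c] by (simp add: carrier_iff)

lemma module: "module complex_ring M"
proof (rule moduleI[OF cring_complex_ring])
  show "abelian_group M"
  proof (rule abelian_groupI)
    fix x assume x: "x \<in> carrier M"
    show "\<exists>y\<in>carrier M. y \<oplus>\<^bsub>M\<^esub> x = \<zero>\<^bsub>M\<^esub>"
      by (rule bexI[of _ "(-1) \<odot>\<^bsub>M\<^esub> x"]) (auto intro!: eqI simp: x add smult smult_closed zero)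
  qed (auto intro!: eqI simp: add add_closed zero_closed zero algebra_simps)
qed (auto intro!: eqI simp: add smult smult_closed add_closed algebra_simps)

sublocale module complex_ring M
  by (rule module)

text \<open>The abstract difference comes with no formula for the inverse; it is pinned down by
  adding \<open>y\<close> back.\<close>

lemma minus:
  assumes "x \<in> carrier M" "y \<in> carrier M"
  shows "\<Psi> (x \<ominus>\<^bsub>M\<^esub> y) = (\<lambda>p. \<Psi> x p - \<Psi> y p)"
proof
  fix p
  have "\<Psi> ((x \<ominus>\<^bsub>M\<^esub> y) \<oplus>\<^bsub>M\<^esub> y) p = \<Psi> (x \<ominus>\<^bsub>M\<^esub> y) p + \<Psi> y p"
    using assms by (simp add: add)
  moreover have "(x \<ominus>\<^bsub>M\<^esub> y) \<oplus>\<^bsub>M\<^esub> y = x"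
    using assms by (simp add: a_minus_def M.a_assoc M.l_neg)
  ultimately show "\<Psi> (x \<ominus>\<^bsub>M\<^esub> y) p = \<Psi> x p - \<Psi> y p" by simp
qed

text \<open>Completeness passes to any \<open>N\<close> equivalent to the supremum norm. The
  algebras use this with both constants 1, the modules with constants taken from the bounds of their
  weight.\<close>

lemma norm_completeI:
  assumes "b > 0"
    and le: "\<And>x. x \<in> carrier M \<Longrightarrow> sup_norm (\<Psi> x) \<le> a * N x"
    and ge: "\<And>x. x \<in> carrier M \<Longrightarrow> N x \<le> b * sup_norm (\<Psi> x)"
    and N0: "\<And>x. x \<in> carrier M \<Longrightarrow> 0 \<le> N x"
  shows "norm_complete M N"
  unfolding norm_complete_def
proof (intro allI impI)
  fix f :: "nat \<Rightarrow> 'e"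
  assume f: "\<forall>k. f k \<in> carrier M"
    and cauchy: "\<forall>e>0. \<exists>k0. \<forall>k\<ge>k0. \<forall>l\<ge>k0. N (f k \<ominus>\<^bsub>M\<^esub> f l) < e"
  have closed: "x \<ominus>\<^bsub>M\<^esub> y \<in> carrier M" if "x \<in> carrier M" "y \<in> carrier M" for x y
    using that by simp
  have "\<exists>k0. \<forall>k\<ge>k0. \<forall>l\<ge>k0. sup_norm (\<lambda>x. \<Psi> (f k) x - \<Psi> (f l) x) < e" if "e > 0" for e :: real
  proof -
    define d where "d = e / (\<bar>a\<bar> + 1)"
    have "d > 0" using that by (simp add: d_def)
    then obtain k0 where k0: "\<And>k l. k \<ge> k0 \<Longrightarrow> l \<ge> k0 \<Longrightarrow> N (f k \<ominus>\<^bsub>M\<^esub> f l) < d"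
      using cauchy by blast
    have "sup_norm (\<lambda>x. \<Psi> (f k) x - \<Psi> (f l) x) < e" if kl: "k \<ge> k0" "l \<ge> k0" for k l
    proof -
      have "sup_norm (\<Psi> (f k \<ominus>\<^bsub>M\<^esub> f l)) \<le> a * N (f k \<ominus>\<^bsub>M\<^esub> f l)"
        using le closed f by blast
      also have "\<dots> \<le> (\<bar>a\<bar> + 1) * N (f k \<ominus>\<^bsub>M\<^esub> f l)"
        using N0 closed f by (intro mult_right_mono) auto
      also have "\<dots> < (\<bar>a\<bar> + 1) * d" using k0[OF kl] by (intro mult_strict_left_mono) auto
      also have "\<dots> = e" by (simp add: d_def)
      finally show ?thesis using f by (simp add: minus)
    qed
    then show ?thesis by blast
  qed
  moreover have "\<Psi> (f k) \<in> C0 X" for k using f carrier_iff by blast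
  ultimately obtain g where g: "g \<in> C0 X" "(\<lambda>k. sup_norm (\<lambda>x. \<Psi> (f k) x - g x)) \<longlonglongrightarrow> 0"
    using C0_complete[of "\<lambda>k. \<Psi> (f k)" X] by blast
  obtain x where x: "x \<in> carrier M" "\<Psi> x = g" using lift[OF g(1)] .
  have "(\<lambda>k. N (f k \<ominus>\<^bsub>M\<^esub> x)) \<longlonglongrightarrow> 0"
  proof (rule tendsto_sandwich)
    show "\<forall>\<^sub>F k in sequentially. 0 \<le> N (f k \<ominus>\<^bsub>M\<^esub> x)"
      using N0 closed f x by (intro always_eventually) blast
    have "N (f k \<ominus>\<^bsub>M\<^esub> x) \<le> b * sup_norm (\<lambda>p. \<Psi> (f k) p - g p)" for k
      using ge[OF closed, of "f k" x] f x by (simp add: minus)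
    then show "\<forall>\<^sub>F k in sequentially. N (f k \<ominus>\<^bsub>M\<^esub> x) \<le> b * sup_norm (\<lambda>p. \<Psi> (f k) p - g p)"
      by (intro always_eventually) blast
    show "(\<lambda>k. b * sup_norm (\<lambda>p. \<Psi> (f k) p - g p)) \<longlonglongrightarrow> 0"
      using tendsto_mult_right_zero[OF g(2)] by blast
  qed auto
  then show "\<exists>x\<in>carrier M. (\<lambda>k. N (f k \<ominus>\<^bsub>M\<^esub> x)) \<longlonglongrightarrow> 0"
    using x(1) by blast
qed

end

text \<open>Common setting for the two kinds of coefficient algebra: C_0(Y), with the identity as
  relabelling, and the path algebra, with uncurrying. Hilbert modules over both are thereby treated
  at once.\<close>

locale function_algebra = c0_space B \<Phi> Y
  for B :: "('b, 'm) cstar_scheme" and \<Phi> :: "'b \<Rightarrow> 'y::t2_space \<Rightarrow> complex" and Y +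
  assumes mult: "\<lbrakk>x \<in> carrier B; y \<in> carrier B\<rbrakk> \<Longrightarrow> \<Phi> (x \<otimes>\<^bsub>B\<^esub> y) = (\<lambda>p. \<Phi> x p * \<Phi> y p)"
    and star: "x \<in> carrier B \<Longrightarrow> \<Phi> (star B x) = (\<lambda>p. cnj (\<Phi> x p))"
    and nrm: "x \<in> carrier B \<Longrightarrow> nrm B x = sup_norm (\<Phi> x)"
begin

lemma mult_closed: "x \<in> carrier B \<Longrightarrow> y \<in> carrier B \<Longrightarrow> x \<otimes>\<^bsub>B\<^esub> y \<in> carrier B"
  using mult[of x y] C0_mult[of "\<Phi> x" Y "\<Phi> y"] by (simp add: carrier_iff)

lemma star_closed: "x \<in> carrier B \<Longrightarrow> star B x \<in> carrier B"
  using star[of x] C0_cnj[of "\<Phi> x" Y] by (simp add: carrier_iff)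

lemma le_nrm: "x \<in> carrier B \<Longrightarrow> cmod (\<Phi> x p) \<le> nrm B x"
  using C0_le_sup_norm[of "\<Phi> x" Y p] by (simp add: carrier_iff nrm)

lemma nrm_le: "x \<in> carrier B \<Longrightarrow> (\<And>p. cmod (\<Phi> x p) \<le> c) \<Longrightarrow> nrm B x \<le> c"
  by (simp add: nrm sup_norm_le)

lemma nrm_ge0: "x \<in> carrier B \<Longrightarrow> 0 \<le> nrm B x"
  using le_nrm norm_ge_zero order_trans by blast

lemma cstar_algebra: "cstar_algebra B"
proof
  fix x assume x: "x \<in> carrier B"
  show "nrm B x = 0 \<longleftrightarrow> x = \<zero>\<^bsub>B\<^esub>"
  proof
    assume "nrm B x = 0"
    then show "x = \<zero>\<^bsub>B\<^esub>" using le_nrm[OF x] by (intro eqI) (simp add: zero)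
  next
    assume "x = \<zero>\<^bsub>B\<^esub>"
    then show "nrm B x = 0" using x by (simp add: nrm zero sup_norm_def)
  qed
  show "nrm B (c \<odot>\<^bsub>B\<^esub> x) = cmod c * nrm B x" for c
  proof (rule antisym)
    show "nrm B (c \<odot>\<^bsub>B\<^esub> x) \<le> cmod c * nrm B x"
      using x by (intro nrm_le) (auto simp: smult norm_mult intro!: mult_left_mono le_nrm)
    show "cmod c * nrm B x \<le> nrm B (c \<odot>\<^bsub>B\<^esub> x)"
    proof (cases "c = 0")
      case True
      then show ?thesis using x nrm_ge0 by simp
    next
      case False
      have "cmod (\<Phi> x p) \<le> nrm B (c \<odot>\<^bsub>B\<^esub> x) / cmod c" for p
        using le_nrm[of "c \<odot>\<^bsub>B\<^esub> x" p] x False by (simp add: smult norm_mult field_simps)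
      then have "nrm B x \<le> nrm B (c \<odot>\<^bsub>B\<^esub> x) / cmod c" by (rule nrm_le[OF x])
      then show ?thesis using False by (simp add: field_simps)
    qed
  qed
  show "nrm B (star B x \<otimes>\<^bsub>B\<^esub> x) = (nrm B x)\<^sup>2"
  proof (rule antisym)
    show "nrm B (star B x \<otimes>\<^bsub>B\<^esub> x) \<le> (nrm B x)\<^sup>2"
      using x by (intro nrm_le)
        (auto simp: mult mult_closed star star_closed norm_mult power2_eq_square intro!: mult_mono le_nrm nrm_ge0)
    \<comment> \<open>A bound for |x|^2 at each point becomes one for |x| by taking roots, which
      avoids computing a supremum of squares.\<close>
    have "cmod (\<Phi> x p) \<le> sqrt (nrm B (star B x \<otimes>\<^bsub>B\<^esub> x))" for p
      using le_nrm[of "star B x \<otimes>\<^bsub>B\<^esub> x" p] x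
      by (intro real_le_rsqrt) (simp add: mult mult_closed star star_closed norm_mult power2_eq_square)
    then have "nrm B x \<le> sqrt (nrm B (star B x \<otimes>\<^bsub>B\<^esub> x))" by (rule nrm_le[OF x])
    then have "(nrm B x)\<^sup>2 \<le> (sqrt (nrm B (star B x \<otimes>\<^bsub>B\<^esub> x)))\<^sup>2"
      using nrm_ge0[OF x] by (rule power_mono)
    then show "(nrm B x)\<^sup>2 \<le> nrm B (star B x \<otimes>\<^bsub>B\<^esub> x)"
      using x nrm_ge0 by (simp add: mult_closed star_closed)
  qed
  fix y assume y: "y \<in> carrier B"
  show "nrm B (x \<oplus>\<^bsub>B\<^esub> y) \<le> nrm B x + nrm B y"
    using x y by (intro nrm_le) (auto simp: add intro!: norm_triangle_mono le_nrm)
  show "nrm B (x \<otimes>\<^bsub>B\<^esub> y) \<le> nrm B x * nrm B y"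
    using x y by (intro nrm_le) (auto simp: mult mult_closed norm_mult intro!: mult_mono le_nrm nrm_ge0)
next
  show "norm_complete B (nrm B)"
    by (rule norm_completeI[of 1 1]) (auto simp: nrm[symmetric] nrm_ge0)
qed (auto intro!: eqI simp: add mult mult_closed star star_closed smult nrm_ge0 algebra_simps)

end

lemma C0_algebra_simps [simp]:
  "carrier (C0_algebra Y) = C0 Y" "\<zero>\<^bsub>C0_algebra Y\<^esub> = (\<lambda>x. 0)"
  "f \<otimes>\<^bsub>C0_algebra Y\<^esub> g = (\<lambda>x. f x * g x)" "f \<oplus>\<^bsub>C0_algebra Y\<^esub> g = (\<lambda>x. f x + g x)"
  "c \<odot>\<^bsub>C0_algebra Y\<^esub> f = (\<lambda>x. c * f x)" "star (C0_algebra Y) f = (\<lambda>x. cnj (f x))"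
  "nrm (C0_algebra Y) f = sup_norm f"
  by (simp_all add: C0_algebra_def sup_norm_def)

lemma function_algebra_C0: "function_algebra (C0_algebra Y) (\<lambda>f. f) Y"
  by unfold_locales (auto simp: bij_def)

lemma cstar_algebra_C0: "cstar_algebra (C0_algebra (Y :: 'y::t2_space set))"
  using function_algebra.cstar_algebra[OF function_algebra_C0] .

lemma C0_algebra_minus:
  fixes Y :: "'y::t2_space set"
  assumes "f \<in> C0 Y" "g \<in> C0 Y"
  shows "f \<ominus>\<^bsub>C0_algebra Y\<^esub> g = (\<lambda>y. f y - g y)"
proof -
  interpret function_algebra "C0_algebra Y" "\<lambda>f. f" Y by (rule function_algebra_C0)
  show ?thesis using minus[of f g] assms by (simp add: carrier_iff)
qed

section \<open>The path algebra as an algebra of functions on a cylinder\<close>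

lemma bij_case_prod: "bij case_prod"
  by (rule o_bij[of curry]) (auto simp: fun_eq_iff)

text \<open>The compact set for the slice is the projection of the part of \<open>K\<close> above
  \<open>t\<close>, which is compact because points are closed.\<close>

lemma C0_slice:
  fixes f :: "'t::t2_space \<times> 'x::t2_space \<Rightarrow> complex"
  assumes "f \<in> C0 W"
  shows "(\<lambda>x. f (t, x)) \<in> C0 {x. (t, x) \<in> W}"
proof (rule C0I)
  show "continuous_on {x. (t, x) \<in> W} (\<lambda>x. f (t, x))"
    by (rule continuous_on_compose2[OF C0D(1)[OF assms]]) (auto intro!: continuous_intros)
  show "f (t, x) = 0" if "x \<notin> {x. (t, x) \<in> W}" for x
    using that C0D(2)[OF assms] by simp
  fix e :: real assume "e > 0"
  then obtain K where K: "compact K" "K \<subseteq> W" "\<forall>p. p \<notin> K \<longrightarrow> cmod (f p) < e"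
    using C0D(3)[OF assms] by blast
  have "compact (snd ` (K \<inter> {t} \<times> UNIV))"
    by (intro compact_continuous_image compact_Int_closed K(1) closed_Times continuous_intros
        closed_singleton closed_UNIV)
  then show "\<exists>K. compact K \<and> K \<subseteq> {x. (t, x) \<in> W} \<and> (\<forall>x\<in>{x. (t, x) \<in> W} - K. cmod (f (t, x)) < e)"
  proof (intro exI conjI ballI)
    show "snd ` (K \<inter> {t} \<times> UNIV) \<subseteq> {x. (t, x) \<in> W}" using K(2) by auto
    fix x assume "x \<in> {x. (t, x) \<in> W} - snd ` (K \<inter> {t} \<times> UNIV)"
    then have "(t, x) \<notin> K" by force
    then show "cmod (f (t, x)) < e" using K(3) by blast
  qed
qed

text \<open>The pointwise formula for the difference inside the norm is available only between
  elements of C_0, hence the split on whether all slices belong to it; if one does not, both sides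
  are false.\<close>

lemma path_algebra_C0_carrier:
  fixes f :: "real \<Rightarrow> 'x::t2_space \<Rightarrow> complex"
  shows "f \<in> carrier (path_algebra (C0_algebra UNIV)) \<longleftrightarrow>
    (\<forall>t\<in>{0..1}. f t \<in> C0 UNIV) \<and> (\<forall>t. t \<notin> {0..1} \<longrightarrow> f t = (\<lambda>x. 0)) \<and>
    (\<forall>t\<in>{0..1}. \<forall>e>0. \<exists>d>0. \<forall>s\<in>{0..1}. \<bar>s - t\<bar> < d \<longrightarrow> sup_norm (\<lambda>x. f s x - f t x) < e)"
proof (cases "\<forall>t\<in>{0..1}. f t \<in> C0 UNIV")
  case True
  then have "f s \<ominus>\<^bsub>C0_algebra UNIV\<^esub> f t = (\<lambda>x. f s x - f t x)" if "s \<in> {0..1}" "t \<in> {0..1}" for s t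
    using that by (simp add: C0_algebra_minus)
  then show ?thesis
    using True by (simp add: path_algebra_def del: atLeastAtMost_iff cong: ball_cong)
next
  case False
  then show ?thesis unfolding path_algebra_def partial_object.simps C0_algebra_simps by blast
qed

text \<open>With its converse below, this identifies C([0,1], C_0(V)) with C_0([0,1] x V). Decay
  disposes of points off a compact set, and uniform continuity makes the remaining estimate
  independent of x.\<close>

lemma C0_box_imp_path:
  fixes f :: "real \<Rightarrow> 'x::euclidean_space \<Rightarrow> complex"
  assumes f: "case_prod f \<in> C0 ({0..1} \<times> UNIV)"
  shows "f \<in> carrier (path_algebra (C0_algebra UNIV))"
proof -
  have sl: "f t \<in> C0 UNIV" if "t \<in> {0..1}" for t
    using C0_slice[OF f, of t] that by simp
  have "\<exists>d>0. \<forall>s\<in>{0..1}. \<bar>s - t\<bar> < d \<longrightarrow> sup_norm (\<lambda>x. f s x - f t x) < e"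
    if t: "t \<in> {0..1}" and e: "e > 0" for t e
  proof -
    obtain K where K: "compact K" "K \<subseteq> {0..1} \<times> UNIV" "\<forall>p. p \<notin> K \<longrightarrow> cmod (case_prod f p) < e / 4"
      using C0D(3)[OF f, of "e/4"] e by auto
    \<comment> \<open>Filling in all of [0,1] above the projection of \<open>K\<close> ensures that
      for each x either both (s, x) and (t, x) lie in \<open>L\<close> or both lie off
      \<open>K\<close>.\<close>
    define L where "L = {0..1::real} \<times> snd ` K"
    have "compact L" unfolding L_def
      by (intro compact_Times compact_continuous_image K(1) continuous_intros) auto
    then have "uniformly_continuous_on L (case_prod f)"
      by (intro compact_uniformly_continuous continuous_on_subset[OF C0D(1)[OF f]]) (auto simp: L_def)
    then obtain d where d: "d > 0" "\<And>p q. p \<in> L \<Longrightarrow> q \<in> L \<Longrightarrow> dist q p < d \<Longrightarrow>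
        dist (case_prod f q) (case_prod f p) < e / 2"
      using e unfolding uniformly_continuous_on_def by (meson half_gt_zero)
    have "sup_norm (\<lambda>x. f s x - f t x) < e" if s: "s \<in> {0..1}" "\<bar>s - t\<bar> < d" for s
    proof -
      have "cmod (f s x - f t x) \<le> e / 2" for x
      proof (cases "x \<in> snd ` K")
        case True
        then show ?thesis using d(2)[of "(t, x)" "(s, x)"] s t
          by (simp add: L_def dist_Pair_Pair dist_norm less_imp_le)
      next
        case False
        then have "(s, x) \<notin> K" "(t, x) \<notin> K" by force+
        then have "cmod (f s x) < e / 4" "cmod (f t x) < e / 4" using K(3) by fastforce+
        then show ?thesis using norm_triangle_ineq4[of "f s x" "f t x"] by linarith
      qed
      then have "sup_norm (\<lambda>x. f s x - f t x) \<le> e / 2" by (rule sup_norm_le)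
      then show ?thesis using e by linarith
    qed
    then show ?thesis using d(1) by blast
  qed
  moreover have "f t = (\<lambda>x. 0)" if "t \<notin> {0..1}" for t
    using C0D(2)[OF f, of "(t, x)" for x] that by auto
  ultimately show ?thesis
    using sl unfolding path_algebra_C0_carrier by blast
qed

text \<open>The compact set has to serve all t at once. One that works for \<open>f t\<close> with
  e/2 works for nearby slices with e, and finitely many such neighbourhoods cover [0,1].\<close>

lemma path_imp_C0_box:
  fixes f :: "real \<Rightarrow> 'x::euclidean_space \<Rightarrow> complex"
  assumes f: "f \<in> carrier (path_algebra (C0_algebra UNIV))"
  shows "case_prod f \<in> C0 ({0..1} \<times> UNIV)"
proof -
  have sl: "f t \<in> C0 UNIV" if "t \<in> {0..1}" for t
    using f that unfolding path_algebra_C0_carrier by blast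
  have out: "f t = (\<lambda>x. 0)" if "t \<notin> {0..1}" for t
    using f that unfolding path_algebra_C0_carrier by blast
  have near: "\<exists>d>0. \<forall>s\<in>{0..1}. \<bar>s - t\<bar> < d \<longrightarrow> (\<forall>x. cmod (f s x - f t x) < e)"
    if t: "t \<in> {0..1}" and "e > 0" for t e
  proof -
    obtain d where d: "d > 0" "\<forall>s\<in>{0..1}. \<bar>s - t\<bar> < d \<longrightarrow> sup_norm (\<lambda>x. f s x - f t x) < e"
      using f t \<open>e > 0\<close> unfolding path_algebra_C0_carrier by blast
    have "cmod (f s x - f t x) < e" if s: "s \<in> {0..1}" "\<bar>s - t\<bar> < d" for s x
    proof -
      have "sup_norm (\<lambda>x. f s x - f t x) < e" using d(2) s by blast
      then show ?thesis
        using C0_le_sup_norm[OF C0_diff[OF sl[OF s(1)] sl[OF t]], of x] by simp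
    qed
    then show ?thesis using d(1) by blast
  qed
  show ?thesis
  proof (rule C0I)
    show "continuous_on ({0..1} \<times> UNIV) (case_prod f)"
      unfolding continuous_on_iff
    proof (intro ballI allI impI)
      fix p :: "real \<times> 'x" and e :: real assume "p \<in> {0..1} \<times> UNIV" and e: "e > 0"
      then obtain t x where p: "p = (t, x)" and t: "t \<in> {0..1}" by blast
      obtain d where d: "d > 0" "\<forall>s\<in>{0..1}. \<bar>s - t\<bar> < d \<longrightarrow> (\<forall>x. cmod (f s x - f t x) < e / 2)"
        using near[OF t, of "e/2"] e by auto
      have "continuous_on UNIV (f t)" using C0D(1)[OF sl[OF t]] .
      then obtain c where c: "c > 0" "\<forall>y. dist y x < c \<longrightarrow> dist (f t y) (f t x) < e / 2"
        using e unfolding continuous_on_iff by (meson UNIV_I half_gt_zero)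
      have "dist (f s y) (f t x) < e"
        if "s \<in> {0..1}" "dist (s, y) (t, x) < min c d" for s y
      proof -
        have "\<bar>s - t\<bar> < d" "dist y x < c"
          using that(2) dist_fst_le[of "(s, y)" "(t, x)"] dist_snd_le[of "(s, y)" "(t, x)"]
          by (auto simp: dist_real_def)
        then have "dist (f s y) (f t y) < e / 2" "dist (f t y) (f t x) < e / 2"
          using c(2) d(2) that(1) by (auto simp: dist_norm)
        then show ?thesis using dist_triangle[of "f s y" "f t x" "f t y"] by linarith
      qed
      then show "\<exists>d>0. \<forall>q\<in>{0..1} \<times> UNIV. dist q p < d \<longrightarrow>
          dist (case_prod f q) (case_prod f p) < e"
        using c(1) d(1) unfolding p by (intro exI[of _ "min c d"]) auto
    qed
    show "case_prod f p = 0" if "p \<notin> {0..1} \<times> UNIV" for p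
      using that out by (cases p) auto
    fix e :: real assume e: "e > 0"
    have "\<exists>d>0. \<exists>K. compact K \<and> (\<forall>s\<in>{0..1}. \<bar>s - t\<bar> < d \<longrightarrow> (\<forall>x. x \<notin> K \<longrightarrow> cmod (f s x) < e))"
      if t: "t \<in> {0..1}" for t
    proof -
      obtain d where d: "d > 0" "\<forall>s\<in>{0..1}. \<bar>s - t\<bar> < d \<longrightarrow> (\<forall>x. cmod (f s x - f t x) < e / 2)"
        using near[OF t, of "e/2"] e by auto
      obtain K where K: "compact K" "\<forall>x. x \<notin> K \<longrightarrow> cmod (f t x) < e / 2"
        using C0D(3)[OF sl[OF t], of "e/2"] e by auto
      have "cmod (f s x) < e" if "s \<in> {0..1}" "\<bar>s - t\<bar> < d" "x \<notin> K" for s x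
      proof -
        have "cmod (f s x - f t x) < e / 2" "cmod (f t x) < e / 2" using that d K by auto
        then show ?thesis using norm_triangle_sub[of "f s x" "f t x"] by linarith
      qed
      then show ?thesis using d(1) K(1) by blast
    qed
    then obtain d K where dK: "\<And>t. t \<in> {0..1} \<Longrightarrow> d t > 0 \<and> compact (K t) \<and>
        (\<forall>s\<in>{0..1}. \<bar>s - t\<bar> < d t \<longrightarrow> (\<forall>x. x \<notin> K t \<longrightarrow> cmod (f s x) < e))"
      by metis
    have "{0..1} \<subseteq> (\<Union>t\<in>{0..1}. ball t (d t))" using dK by fastforce
    then obtain T where T: "T \<subseteq> {0..1}" "finite T" "{0..1} \<subseteq> (\<Union>t\<in>T. ball t (d t))"
      by (rule compactE_image[OF compact_Icc, rotated]) auto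
    define L where "L = {0..1::real} \<times> (\<Union>t\<in>T. K t)"
    have "compact L" unfolding L_def using T dK by (intro compact_Times compact_UN) auto
    moreover have "cmod (f s x) < e" if "s \<in> {0..1}" "(s, x) \<notin> L" for s x
    proof -
      obtain t where "t \<in> T" "\<bar>s - t\<bar> < d t"
        using T(3) \<open>s \<in> {0..1}\<close> by (auto simp: dist_real_def)
      then show ?thesis using dK[of t] T(1) that by (auto simp: L_def)
    qed
    moreover have "L \<subseteq> {0..1} \<times> UNIV" by (auto simp: L_def)
    ultimately show "\<exists>K. compact K \<and> K \<subseteq> {0..1} \<times> UNIV \<and>
        (\<forall>p\<in>{0..1} \<times> UNIV - K. cmod (case_prod f p) < e)"
      by (intro exI[of _ L] conjI ballI) (assumption | clarsimp)+
  qed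
qed

lemma function_algebra_path:
  "function_algebra (path_algebra (C0_algebra (UNIV :: 'x::euclidean_space set))) case_prod
     ({0..1} \<times> UNIV)"
proof unfold_locales
  let ?P = "path_algebra (C0_algebra (UNIV :: 'x set))"
  have out: "f t = (\<lambda>x. 0)" if "f \<in> carrier ?P" "t \<notin> {0..1}" for f t
    using that unfolding path_algebra_C0_carrier by blast
  show "bij case_prod" by (rule bij_case_prod)
  show iff: "f \<in> carrier ?P \<longleftrightarrow> case_prod f \<in> C0 ({0..1} \<times> UNIV)" for f
    using C0_box_imp_path path_imp_C0_box by blast
  show "case_prod \<zero>\<^bsub>?P\<^esub> = (\<lambda>p. 0)" by (auto simp: path_algebra_def)
  fix f assume f: "f \<in> carrier ?P"
  show "case_prod (c \<odot>\<^bsub>?P\<^esub> f) = (\<lambda>p. c * case_prod f p)" for c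
    using out[OF f] by (fastforce simp: path_algebra_def)
  show "case_prod (star ?P f) = (\<lambda>p. cnj (case_prod f p))"
    using out[OF f] by (fastforce simp: path_algebra_def)
  show "nrm ?P f = sup_norm (case_prod f)"
  proof -
    have C: "case_prod f \<in> C0 ({0..1} \<times> UNIV)" using f iff by blast
    have "nrm ?P f = (SUP t\<in>{0..1}. sup_norm (f t))"
      by (simp add: path_algebra_def)
    also have "\<dots> = sup_norm (case_prod f)"
    proof (rule antisym)
      have *: "sup_norm (f t) \<le> sup_norm (case_prod f)" for t
        using C0_le_sup_norm[OF C, of "(t, x)" for x] by (intro sup_norm_le) simp
      show "(SUP t\<in>{0..1}. sup_norm (f t)) \<le> sup_norm (case_prod f)"
        using * by (intro cSUP_least) auto
      have bdd: "bdd_above ((\<lambda>t. sup_norm (f t)) ` {0..1})" using * by (auto simp: bdd_above_def)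
      have "cmod (f t x) \<le> (SUP t\<in>{0..1}. sup_norm (f t))" for t x
      proof -
        have up: "sup_norm (f t) \<le> (SUP t\<in>{0..1}. sup_norm (f t))" if "t \<in> {0..1}" for t
          using cSUP_upper[OF that bdd] .
        show ?thesis
        proof (cases "t \<in> {0..1}")
          case True
          then have "f t \<in> C0 UNIV" using f unfolding path_algebra_C0_carrier by auto
          then show ?thesis using C0_le_sup_norm[of "f t" UNIV x] up[OF True] by linarith
        next
          case False
          \<comment> \<open>\<open>f t\<close> vanishes here, so it suffices that the supremum is
            nonnegative, and the slice at 0 shows that.\<close>
          have "f 0 \<in> C0 UNIV" using f unfolding path_algebra_C0_carrier by auto
          then show ?thesis using False out[OF f] up[of 0] sup_norm_nonneg[of "f 0" UNIV] by simp
        qed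
      qed
      then show "sup_norm (case_prod f) \<le> (SUP t\<in>{0..1}. sup_norm (f t))"
        by (intro sup_norm_le) (simp add: case_prod_unfold)
    qed
    finally show ?thesis .
  qed
  fix g assume g: "g \<in> carrier ?P"
  show "case_prod (f \<oplus>\<^bsub>?P\<^esub> g) = (\<lambda>p. case_prod f p + case_prod g p)"
    using out[OF f] out[OF g] by (fastforce simp: path_algebra_def)
  show "case_prod (f \<otimes>\<^bsub>?P\<^esub> g) = (\<lambda>p. case_prod f p * case_prod g p)"
    using out[OF f] out[OF g] by (fastforce simp: path_algebra_def)
qed

section \<open>Hilbert bimodules of functions\<close>

text \<open>Lets \<open>push\<close> also pull functions back from j(X) to \<open>X\<close>; on
  \<open>X\<close> the inverse of the inverse is \<open>j\<close> again.\<close>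

lemma open_embedding_inverse:
  assumes "open_embedding X Y j"
  shows "open_embedding (j ` X) X (inv_into X j)"
proof -
  have jD: "inj_on j X" "continuous_on X j" "continuous_on (j ` X) (inv_into X j)"
    using assms by (auto simp: open_embedding_def)
  have im: "inv_into X j ` (j ` X) = X" using jD(1) by simp
  have inj: "inj_on (inv_into X j) (j ` X)" by (simp add: inj_on_inv_into)
  have "inv_into (j ` X) (inv_into X j) x = j x" if "x \<in> X" for x
    using inv_into_f_f[OF inj, of "j x"] that jD(1) by simp
  then have "continuous_on X (inv_into (j ` X) (inv_into X j))"
    using jD(2) by (simp cong: continuous_on_cong)
  then show ?thesis
    unfolding open_embedding_def im using inj jD(3) by simp
qed

text \<open>\<open>v\<close> is the weight of the inner product read on \<open>X\<close>, and \<pi>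
  the map through which the left algebra acts. The bounds \<open>c\<close> and \<open>C\<close> make
  the Hilbert norm equivalent to the supremum norm; \<open>pos_fun\<close> supplies the strictly
  positive element behind generation, compactness, and uniqueness of adjoints and roots.\<close>

locale function_module = B: function_algebra B \<Phi> Y + E: c0_space E \<Psi> X
  for B :: "('b, 'm) cstar_scheme" and \<Phi> :: "'b \<Rightarrow> 'y::t2_space \<Rightarrow> complex" and Y
    and E :: "('z::t2_space \<Rightarrow> complex, 'b, 'e) bimod"
    and \<Psi> :: "'e \<Rightarrow> 'x::topological_space \<Rightarrow> complex" and X +
  fixes Z :: "'z set" and j :: "'x \<Rightarrow> 'y" and v :: "'x \<Rightarrow> real" and \<pi> :: "'x \<Rightarrow> 'z"
    and c C :: real
  assumes emb: "open_embedding X Y j"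
    and proj: "continuous_on X \<pi>" "\<pi> ` X \<subseteq> Z"
    and weight: "continuous_on X v" "0 < c" "\<And>p. p \<in> X \<Longrightarrow> c \<le> v p" "\<And>p. p \<in> X \<Longrightarrow> v p \<le> C"
    and ip: "\<lbrakk>x \<in> carrier E; y \<in> carrier E\<rbrakk> \<Longrightarrow>
      \<Phi> (ip E x y) = push X j (\<lambda>p. of_real (v p) * cnj (\<Psi> x p) * \<Psi> y p)"
    and ract: "\<lbrakk>x \<in> carrier E; b \<in> carrier B\<rbrakk> \<Longrightarrow> \<Psi> (ract E x b) = (\<lambda>p. \<Psi> x p * \<Phi> b (j p))"
    and lact: "\<lbrakk>a \<in> C0 Z; x \<in> carrier E\<rbrakk> \<Longrightarrow> \<Psi> (lact E a x) = (\<lambda>p. a (\<pi> p) * \<Psi> x p)"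
    and pos_fun: "\<exists>h. (\<forall>p\<in>X. 0 < h p) \<and> (\<lambda>p. complex_of_real (h p)) \<in> C0 X"
begin

text \<open>The bounded continuous functions on \<open>X\<close>, that is, the multiplier algebra of
  C_0(X); values off \<open>X\<close> are left free.\<close>

definition multiplier :: "('x \<Rightarrow> complex) \<Rightarrow> bool" where
  "multiplier m \<longleftrightarrow> continuous_on X m \<and> (\<exists>b. \<forall>p\<in>X. cmod (m p) \<le> b)"

lemma multiplier_C0: "multiplier m \<Longrightarrow> f \<in> C0 X \<Longrightarrow> (\<lambda>p. m p * f p) \<in> C0 X"
  unfolding multiplier_def using C0_mult_bounded by blast

lemma C0_multiplier: "f \<in> C0 X \<Longrightarrow> multiplier f"
  unfolding multiplier_def using C0D(1) C0_bounded by metis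

lemma \<Psi>_C0: "x \<in> carrier E \<Longrightarrow> \<Psi> x \<in> C0 X"
  by (simp add: E.carrier_iff)

lemma \<Psi>_outside: "x \<in> carrier E \<Longrightarrow> p \<notin> X \<Longrightarrow> \<Psi> x p = 0"
  using C0D(2)[OF \<Psi>_C0] .

lemma v_pos: "p \<in> X \<Longrightarrow> 0 < v p"
  using weight by (meson less_le_trans)

lemma v_multiplier: "multiplier (\<lambda>p. of_real (v p))"
  unfolding multiplier_def
proof
  show "continuous_on X (\<lambda>p. complex_of_real (v p))" by (intro continuous_intros weight)
  show "\<exists>b. \<forall>p\<in>X. cmod (complex_of_real (v p)) \<le> b"
    using weight(4) v_pos by (intro exI[of _ C]) (auto simp: less_imp_le)
qed

lemma inverse_v_multiplier: "multiplier (\<lambda>p. of_real (1 / v p))"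
  unfolding multiplier_def
proof
  show "continuous_on X (\<lambda>p. complex_of_real (1 / v p))"
    using v_pos by (intro continuous_intros weight) (auto simp: less_imp_neq[symmetric])
  have "cmod (complex_of_real (1 / v p)) \<le> 1 / c" if "p \<in> X" for p
    unfolding norm_of_real using weight(2) weight(3)[OF that] by (simp add: frac_le)
  then show "\<exists>b. \<forall>p\<in>X. cmod (complex_of_real (1 / v p)) \<le> b" by blast
qed

lemma sqrt_v_multiplier: "multiplier (\<lambda>p. of_real (sqrt (v p)))"
  unfolding multiplier_def
proof
  show "continuous_on X (\<lambda>p. complex_of_real (sqrt (v p)))" by (intro continuous_intros weight)
  show "\<exists>b. \<forall>p\<in>X. cmod (complex_of_real (sqrt (v p))) \<le> b"
    using weight(4) v_pos by (intro exI[of _ "sqrt C"]) (auto simp: less_imp_le)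
qed

lemma proj_multiplier:
  assumes "a \<in> C0 Z"
  shows "multiplier (\<lambda>p. a (\<pi> p))"
proof -
  obtain b where "\<And>z. cmod (a z) \<le> b" using C0_bounded[OF assms] by blast
  then show ?thesis
    unfolding multiplier_def
    using continuous_on_compose2[OF C0D(1)[OF assms] proj] by blast
qed

lemma embedding_multiplier:
  assumes "b \<in> carrier B"
  shows "multiplier (\<lambda>p. \<Phi> b (j p))"
proof -
  have b: "\<Phi> b \<in> C0 Y" using assms B.carrier_iff by blast
  obtain k where "\<And>z. cmod (\<Phi> b z) \<le> k" using C0_bounded[OF b] by blast
  moreover have "j ` X \<subseteq> Y" "continuous_on X j"
    using emb unfolding open_embedding_def by (blast dest: openin_imp_subset)+
  ultimately show ?thesis
    unfolding multiplier_def using continuous_on_compose2[OF C0D(1)[OF b]] by blast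
qed

lemma ip_closed: "x \<in> carrier E \<Longrightarrow> y \<in> carrier E \<Longrightarrow> ip E x y \<in> carrier B"
  using push_C0[OF emb C0_mult[OF multiplier_C0[OF v_multiplier C0_cnj[OF \<Psi>_C0]] \<Psi>_C0], of x y]
  by (simp add: B.carrier_iff ip)

lemma ract_closed: "x \<in> carrier E \<Longrightarrow> b \<in> carrier B \<Longrightarrow> ract E x b \<in> carrier E"
  using multiplier_C0[OF embedding_multiplier \<Psi>_C0, of b x]
  by (simp add: E.carrier_iff ract mult.commute)

lemma lact_closed: "a \<in> C0 Z \<Longrightarrow> x \<in> carrier E \<Longrightarrow> lact E a x \<in> carrier E"
  using multiplier_C0[OF proj_multiplier \<Psi>_C0, of a x] by (simp add: E.carrier_iff lact)

lemma ip_embedded: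
  "\<lbrakk>x \<in> carrier E; y \<in> carrier E; p \<in> X\<rbrakk> \<Longrightarrow>
    \<Phi> (ip E x y) (j p) = of_real (v p) * cnj (\<Psi> x p) * \<Psi> y p"
  by (simp add: ip push_embedded[OF emb])

text \<open>Together with \<open>hnorm_le\<close> this computes the Hilbert norm as the supremum of
  sqrt(v) |x| over \<open>X\<close>, so that operator estimates can be made point by point.\<close>

lemma le_hnorm:
  assumes "x \<in> carrier E" "p \<in> X"
  shows "sqrt (v p) * cmod (\<Psi> x p) \<le> hnorm B E x"
proof -
  have "v p * (cmod (\<Psi> x p))\<^sup>2 = cmod (\<Phi> (ip E x x) (j p))"
    using assms v_pos[OF assms(2)] by (simp add: ip_embedded norm_mult power2_eq_square)
  also have "\<dots> \<le> nrm B (ip E x x)" using assms by (intro B.le_nrm ip_closed)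
  finally have "sqrt (v p * (cmod (\<Psi> x p))\<^sup>2) \<le> hnorm B E x"
    unfolding hnorm_def by (rule real_sqrt_le_mono)
  then show ?thesis by (simp add: real_sqrt_mult)
qed

lemma hnorm_le:
  assumes "x \<in> carrier E" "0 \<le> b" "\<And>p. p \<in> X \<Longrightarrow> sqrt (v p) * cmod (\<Psi> x p) \<le> b"
  shows "hnorm B E x \<le> b"
proof -
  have "cmod (\<Phi> (ip E x x) y) \<le> b\<^sup>2" for y
  proof (cases "y \<in> j ` X")
    case True
    then obtain p where p: "p \<in> X" "y = j p" by blast
    have "(sqrt (v p) * cmod (\<Psi> x p))\<^sup>2 \<le> b\<^sup>2"
      using assms(3)[OF p(1)] v_pos[OF p(1)] by (intro power_mono) (auto simp: less_imp_le)
    then show ?thesis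
      using assms(1) p v_pos[OF p(1)]
      by (simp add: ip_embedded norm_mult power_mult_distrib) (simp add: power2_eq_square)
  next
    case False
    then show ?thesis using assms(1) by (simp add: ip push_outside)
  qed
  then have "nrm B (ip E x x) \<le> b\<^sup>2" using assms(1) by (intro B.nrm_le ip_closed)
  then show ?thesis
    unfolding hnorm_def using assms(2) by (simp add: real_le_lsqrt)
qed

lemma hnorm_ge0: "x \<in> carrier E \<Longrightarrow> 0 \<le> hnorm B E x"
  by (simp add: hnorm_def B.nrm_ge0 ip_closed)

lemma hnorm_complete: "norm_complete E (hnorm B E)"
proof (rule E.norm_completeI)
  \<comment> \<open>\<open>C\<close> bounds \<open>v\<close> only on \<open>X\<close>, which may be
    empty, so \<open>C\<close> itself need not be positive.\<close>
  show "0 < sqrt (\<bar>C\<bar> + 1)" by simp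
  fix x assume x: "x \<in> carrier E"
  show "0 \<le> hnorm B E x" by (rule hnorm_ge0[OF x])
  show "sup_norm (\<Psi> x) \<le> 1 / sqrt c * hnorm B E x"
  proof (rule sup_norm_le)
    fix p
    show "cmod (\<Psi> x p) \<le> 1 / sqrt c * hnorm B E x"
    proof (cases "p \<in> X")
      case True
      have "sqrt c * cmod (\<Psi> x p) \<le> sqrt (v p) * cmod (\<Psi> x p)"
        using weight(3)[OF True] by (intro mult_right_mono) auto
      then show ?thesis
        using le_hnorm[OF x True] weight(2) by (simp add: field_simps)
    next
      case False
      then show ?thesis using x weight(2) by (simp add: \<Psi>_outside hnorm_ge0)
    qed
  qed
  show "hnorm B E x \<le> sqrt (\<bar>C\<bar> + 1) * sup_norm (\<Psi> x)"
  proof (rule hnorm_le[OF x])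
    show "0 \<le> sqrt (\<bar>C\<bar> + 1) * sup_norm (\<Psi> x)" using sup_norm_nonneg[OF \<Psi>_C0[OF x]] by simp
    show "sqrt (v p) * cmod (\<Psi> x p) \<le> sqrt (\<bar>C\<bar> + 1) * sup_norm (\<Psi> x)" if "p \<in> X" for p
      using weight(4)[OF that] C0_le_sup_norm[OF \<Psi>_C0[OF x]] by (intro mult_mono) auto
  qed
qed

lemma hilbert_module: "hilbert_module B E"
proof -
  interpret B': cstar_algebra B by (rule B.cstar_algebra)
  show ?thesis
  proof
    fix x assume x: "x \<in> carrier E"
    show "ip E x x \<in> positive_elements B"
    proof -
      \<comment> \<open>Positivity asks for an explicit factorisation: the weight is a square, so
        <x, x> = b* b with b the transport of sqrt(v) x to \<open>Y\<close>.\<close>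
      obtain b where b: "b \<in> carrier B" "\<Phi> b = push X j (\<lambda>p. of_real (sqrt (v p)) * \<Psi> x p)"
        using B.lift[OF push_C0[OF emb multiplier_C0[OF sqrt_v_multiplier \<Psi>_C0[OF x]]]] .
      have "ip E x x = star B b \<otimes>\<^bsub>B\<^esub> b"
      proof (rule B.eqI)
        fix y
        show "\<Phi> (ip E x x) y = \<Phi> (star B b \<otimes>\<^bsub>B\<^esub> b) y"
        proof (cases "y \<in> j ` X")
          case True
          then obtain p where p: "p \<in> X" "y = j p" by blast
          have "complex_of_real (sqrt (v p)) * complex_of_real (sqrt (v p)) = of_real (v p)"
            using v_pos[OF p(1)] by (metis less_imp_le of_real_mult real_sqrt_mult_self abs_of_nonneg)
          then show ?thesis
            using b x p by (simp add: B.mult B.star B.star_closed push_embedded[OF emb] ip_embedded)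
        next
          case False
          then show ?thesis using b x by (simp add: B.mult B.star B.star_closed push_outside ip)
        qed
      qed
      then show ?thesis using b(1) by (auto simp: positive_elements_def)
    qed
    show "x = \<zero>\<^bsub>E\<^esub>" if "ip E x x = \<zero>\<^bsub>B\<^esub>"
    proof (rule E.eqI)
      fix p
      show "\<Psi> x p = \<Psi> \<zero>\<^bsub>E\<^esub> p"
      proof (cases "p \<in> X")
        case True
        then have "of_real (v p) * cnj (\<Psi> x p) * \<Psi> x p = 0"
          using ip_embedded[OF x x True] that by (simp add: B.zero)
        then show ?thesis using v_pos[OF True] by (simp add: E.zero)
      next
        case False
        then show ?thesis using x by (simp add: \<Psi>_outside E.zero)
      qed
    qed
  next
    show "norm_complete E (hnorm B E)" by (rule hnorm_complete)
  next
    fix x y b assume "x \<in> carrier E" "y \<in> carrier E" "b \<in> carrier B"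
    then show "ip E x (ract E y b) = ip E x y \<otimes>\<^bsub>B\<^esub> b"
      by (intro B.eqI) (auto simp: ip ip_closed ract ract_closed B.mult push_def f_inv_into_f)
  qed (auto intro!: E.eqI B.eqI simp: ip ip_closed ract ract_closed E.add E.smult E.add_closed
        E.smult_closed B.add B.mult B.smult B.mult_closed B.star B.add_closed B.smult_closed
        push_def algebra_simps)
qed

lemma hilbert_bimodule: "hilbert_bimodule (C0_algebra Z) B E"
proof -
  interpret A: cstar_algebra "C0_algebra Z" by (rule cstar_algebra_C0)
  interpret hilbert_module B E by (rule hilbert_module)
  show ?thesis
  proof
    fix a x y assume a: "a \<in> carrier (C0_algebra Z)" and xy: "x \<in> carrier E" "y \<in> carrier E"
    then have "star (C0_algebra Z) a \<in> C0 Z" using C0_cnj[of a Z] by simp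
    then show "ip E (lact E a x) y = ip E x (lact E (star (C0_algebra Z) a) y)"
      using a xy by (intro B.eqI) (auto simp: ip lact lact_closed push_def mult_ac)
  qed (auto intro!: E.eqI simp: lact lact_closed ract ract_closed E.add E.smult E.add_closed
        E.smult_closed C0_add C0_mult C0_smult algebra_simps)
qed

text \<open>One generator suffices. If g has the strictly positive symbol h, multiplying it by the
  coefficient x / (h + d) gives x h / (h + d), which comes arbitrarily close to x as d
  shrinks.\<close>

lemma countably_generated: "countably_generated B E"
proof -
  obtain h where h: "\<And>p. p \<in> X \<Longrightarrow> 0 < h p" "(\<lambda>p. complex_of_real (h p)) \<in> C0 X"
    using pos_fun by blast
  have ch: "continuous_on X h" using continuous_on_Re[OF C0D(1)[OF h(2)]] by simp
  obtain g where g: "g \<in> carrier E" "\<Psi> g = (\<lambda>p. of_real (h p))" using E.lift[OF h(2)] .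
  have "\<exists>y\<in>generated_submodule B E {g}. hnorm B E (x \<ominus>\<^bsub>E\<^esub> y) < e"
    if x: "x \<in> carrier E" and "e > 0" for x e
  proof -
    \<comment> \<open>Passing from the supremum norm to the Hilbert norm costs at most a factor
      sqrt(|C| + 1); the 2 makes the final inequality strict.\<close>
    define e' where "e' = e / (2 * sqrt (\<bar>C\<bar> + 1))"
    have e': "e' > 0" using \<open>e > 0\<close> by (simp add: e'_def)
    obtain d where d: "d > 0"
        "\<And>p. cmod (\<Psi> x p - of_real (h p / (h p + d)) * \<Psi> x p) < e'"
      using C0_approximate_unit[OF \<Psi>_C0[OF x] ch h(1) e'] by blast
    obtain b where b: "b \<in> carrier B"
        "\<Phi> b = push X j (\<lambda>p. of_real (1 / (h p + d)) * \<Psi> x p)"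
      using B.lift[OF push_C0[OF emb C0_divide_shift[OF \<Psi>_C0[OF x] ch h(1) d(1)]]] by blast
    define y where "y = \<zero>\<^bsub>E\<^esub> \<oplus>\<^bsub>E\<^esub> ract E g b"
    have y: "y \<in> generated_submodule B E {g}"
      unfolding y_def using b by (intro generated_submodule.intros) auto
    have y': "y = ract E g b" unfolding y_def using g b by (simp add: ract_closed)
    have yc: "y \<in> carrier E" using g b y' ract_closed by simp
    have "hnorm B E (x \<ominus>\<^bsub>E\<^esub> y) \<le> e / 2"
    proof (rule hnorm_le)
      show "x \<ominus>\<^bsub>E\<^esub> y \<in> carrier E" using x yc by simp
      show "0 \<le> e / 2" using \<open>e > 0\<close> by simp
      fix p assume p: "p \<in> X"
      have "\<Psi> (x \<ominus>\<^bsub>E\<^esub> y) p = \<Psi> x p - of_real (h p / (h p + d)) * \<Psi> x p"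
        using x yc g b p by (simp add: E.minus y' ract_closed ract push_embedded[OF emb])
      then have "sqrt (v p) * cmod (\<Psi> (x \<ominus>\<^bsub>E\<^esub> y) p) \<le> sqrt (\<bar>C\<bar> + 1) * e'"
        using weight(4)[OF p] d(2)[of p] v_pos[OF p] by (intro mult_mono) (auto simp: less_imp_le)
      also have "\<dots> = e / 2" by (simp add: e'_def)
      finally show "sqrt (v p) * cmod (\<Psi> (x \<ominus>\<^bsub>E\<^esub> y) p) \<le> e / 2" .
    qed
    then show ?thesis using y \<open>e > 0\<close> by (intro bexI[of _ y]) auto
  qed
  then show ?thesis
    unfolding countably_generated_def using g(1) by (intro exI[of _ "{g}"]) auto
qed

section \<open>Multiplication operators: adjoints, compactness, cycle axioms\<close>

definition represents :: "('e \<Rightarrow> 'e) \<Rightarrow> ('x \<Rightarrow> complex) \<Rightarrow> bool" where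
  "represents T m \<longleftrightarrow> T \<in> extensional (carrier E) \<and>
     (\<forall>x\<in>carrier E. T x \<in> carrier E \<and> \<Psi> (T x) = (\<lambda>p. m p * \<Psi> x p))"

lemma representsD:
  assumes "represents T m"
  shows "T \<in> carrier E \<rightarrow>\<^sub>E carrier E" "x \<in> carrier E \<Longrightarrow> T x \<in> carrier E"
    "x \<in> carrier E \<Longrightarrow> \<Psi> (T x) = (\<lambda>p. m p * \<Psi> x p)"
  using assms by (auto simp: represents_def PiE_def)

lemma represents_lift:
  assumes "multiplier m"
  obtains T where "represents T m"
proof -
  \<comment> \<open>Operators are undefined off the carrier, as \<open>adjoint_pair\<close> demands,
    hence the restriction. The choice is unambiguous because \<Psi> is injective.\<close>
  define T where "T = (\<lambda>x\<in>carrier E. SOME y. y \<in> carrier E \<and> \<Psi> y = (\<lambda>p. m p * \<Psi> x p))"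
  have "T x \<in> carrier E \<and> \<Psi> (T x) = (\<lambda>p. m p * \<Psi> x p)" if x: "x \<in> carrier E" for x
  proof -
    have "\<exists>y. y \<in> carrier E \<and> \<Psi> y = (\<lambda>p. m p * \<Psi> x p)"
      using E.lift[OF multiplier_C0[OF assms \<Psi>_C0[OF x]]] by metis
    then show ?thesis unfolding T_def restrict_apply'[OF x] by (rule someI_ex)
  qed
  then have "represents T m" by (auto simp: represents_def T_def)
  then show thesis using that by blast
qed

lemma adjoint_pair_multiplication:
  assumes "represents T m" "represents T' (\<lambda>p. cnj (m p))"
  shows "adjoint_pair E T T'"
  unfolding adjoint_pair_def
  using assms[THEN representsD(1)] representsD(2,3)[OF assms(1)] representsD(2,3)[OF assms(2)]
  by (auto intro!: B.eqI simp: ip push_def mult_ac)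

text \<open>The positive weight cancels, so adjointness is a pointwise relation whatever the
  weight.\<close>

lemma adjoint_pairD:
  assumes "adjoint_pair E T T'" "x \<in> carrier E" "y \<in> carrier E" "p \<in> X"
  shows "cnj (\<Psi> (T x) p) * \<Psi> y p = cnj (\<Psi> x p) * \<Psi> (T' y) p"
proof -
  have "T x \<in> carrier E" "T' y \<in> carrier E" "ip E (T x) y = ip E x (T' y)"
    using assms by (auto simp: adjoint_pair_def)
  then have "of_real (v p) * cnj (\<Psi> (T x) p) * \<Psi> y p = of_real (v p) * cnj (\<Psi> x p) * \<Psi> (T' y) p"
    using ip_embedded assms by metis
  then show ?thesis using v_pos[OF assms(4)] by (simp add: mult.assoc)
qed

text \<open>The description in \<open>op_adjoint\<close> requires uniqueness. Testing against one
  strictly positive g determines the adjoint at every point of \<open>X\<close>, and off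
  \<open>X\<close> all elements vanish.\<close>

lemma op_adjoint_eq:
  assumes "adjoint_pair E T T'"
  shows "op_adjoint E T = T'"
  unfolding op_adjoint_def
proof (rule the_equality[of _ T'], rule assms)
  fix T'' assume T'': "adjoint_pair E T T''"
  obtain h where h: "\<And>p. p \<in> X \<Longrightarrow> 0 < h p" "(\<lambda>p. complex_of_real (h p)) \<in> C0 X"
    using pos_fun by blast
  obtain g where g: "g \<in> carrier E" "\<Psi> g = (\<lambda>p. of_real (h p))" using E.lift[OF h(2)] .
  have c: "T' \<in> carrier E \<rightarrow>\<^sub>E carrier E" "T'' \<in> carrier E \<rightarrow>\<^sub>E carrier E"
    using assms T'' by (auto simp: adjoint_pair_def)
  show "T'' = T'"
  proof (rule PiE_ext[OF c(2) c(1)])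
    fix y assume y: "y \<in> carrier E"
    then have yc: "T' y \<in> carrier E" "T'' y \<in> carrier E" using c by auto
    show "T'' y = T' y"
    proof (rule E.eqI)
      fix p
      show "\<Psi> (T'' y) p = \<Psi> (T' y) p"
      proof (cases "p \<in> X")
        case True
        have "cnj (\<Psi> g p) * \<Psi> (T'' y) p = cnj (\<Psi> g p) * \<Psi> (T' y) p"
          using adjoint_pairD[OF assms g(1) y True] adjoint_pairD[OF T'' g(1) y True] by simp
        then show ?thesis using h(1)[OF True] g(2) by simp
      next
        case False
        then show ?thesis using yc by (simp add: \<Psi>_outside)
      qed
    qed
  qed
qed

lemma multiplication_adjointable:
  assumes "represents T m" "multiplier m"
  shows "T \<in> adjointable_ops E"
proof -
  have "multiplier (\<lambda>p. cnj (m p))"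
    using assms(2) by (auto simp: multiplier_def intro!: continuous_intros)
  then show ?thesis
    using represents_lift adjoint_pair_multiplication[OF assms(1)] by (metis (no_types, lifting) adjointable_ops_def mem_Collect_eq)
qed

text \<open>A single rank-one operator approximates: sending z to u <y, z> multiplies z by u v
  cnj(y). With u = k and y = h / (v (h + d)) this symbol is k h / (h + d), which is uniformly close
  to k for small d.\<close>

lemma multiplication_compact:
  assumes T: "represents T k" and k: "k \<in> C0 X"
  shows "T \<in> compact_ops B E"
proof -
  obtain h where h: "\<And>p. p \<in> X \<Longrightarrow> 0 < h p" "(\<lambda>p. complex_of_real (h p)) \<in> C0 X"
    using pos_fun by blast
  have ch: "continuous_on X h" using continuous_on_Re[OF C0D(1)[OF h(2)]] by simp
  obtain u where u: "u \<in> carrier E" "\<Psi> u = k" using E.lift[OF k] .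
  have "\<exists>R\<in>finite_rank_ops E. \<forall>x\<in>carrier E. hnorm B E (T x \<ominus>\<^bsub>E\<^esub> R x) \<le> e * hnorm B E x"
    if "e > 0" for e
  proof -
    obtain d where d: "d > 0" "\<And>p. cmod (k p - of_real (h p / (h p + d)) * k p) < e"
      using C0_approximate_unit[OF k ch h(1) \<open>e > 0\<close>] by blast
    obtain y where y: "y \<in> carrier E"
        "\<Psi> y = (\<lambda>p. of_real (1 / v p) * (of_real (1 / (h p + d)) * of_real (h p)))"
      using E.lift[OF multiplier_C0[OF inverse_v_multiplier C0_divide_shift[OF h(2) ch h(1) d(1)]]]
      by blast
    define R where "R = (\<lambda>z\<in>carrier E. (\<lambda>z\<in>carrier E. \<zero>\<^bsub>E\<^esub>) z \<oplus>\<^bsub>E\<^esub> ract E u (ip E y z))"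
    have R: "R \<in> finite_rank_ops E"
      unfolding R_def using u y by (intro finite_rank_ops.intros)
    have "hnorm B E (T x \<ominus>\<^bsub>E\<^esub> R x) \<le> e * hnorm B E x" if x: "x \<in> carrier E" for x
    proof (rule hnorm_le)
      have Rx: "R x = ract E u (ip E y x)" "ract E u (ip E y x) \<in> carrier E"
        unfolding R_def using x u y by (auto simp: ract_closed ip_closed)
      have Tx: "T x \<in> carrier E" "\<Psi> (T x) = (\<lambda>p. k p * \<Psi> x p)" using representsD[OF T] x by auto
      show "T x \<ominus>\<^bsub>E\<^esub> R x \<in> carrier E" using Rx Tx by simp
      show "0 \<le> e * hnorm B E x" using \<open>e > 0\<close> hnorm_ge0[OF x] by simp
      fix p assume p: "p \<in> X"
      have "\<Psi> (T x \<ominus>\<^bsub>E\<^esub> R x) p = (k p - of_real (h p / (h p + d)) * k p) * \<Psi> x p"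
        using Rx Tx x u y p v_pos[OF p]
        by (simp add: E.minus ract ip_closed ip_embedded left_diff_distrib)
      then have "sqrt (v p) * cmod (\<Psi> (T x \<ominus>\<^bsub>E\<^esub> R x) p) =
          cmod (k p - of_real (h p / (h p + d)) * k p) * (sqrt (v p) * cmod (\<Psi> x p))"
        by (simp add: norm_mult)
      also have "\<dots> \<le> e * hnorm B E x"
        using d(2)[of p] le_hnorm[OF x p] v_pos[OF p] \<open>e > 0\<close> by (intro mult_mono) (auto simp: less_imp_le)
      finally show "sqrt (v p) * cmod (\<Psi> (T x \<ominus>\<^bsub>E\<^esub> R x) p) \<le> e * hnorm B E x" .
    qed
    then show ?thesis using R by blast
  qed
  then show ?thesis
    using multiplication_adjointable[OF T C0_multiplier[OF k]] by (simp add: compact_ops_def)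
qed

text \<open>Commutators with the left action vanish because multiplications commute, and F is
  self-adjoint because m is real. Compactness has content only for F^2 - 1; the conditional in its
  symbol secures the value 0 off \<open>X\<close> that membership in C_0 demands.\<close>

lemma kk_cycle:
  assumes F: "represents F (\<lambda>p. of_real (m p))" and m: "multiplier (\<lambda>p. of_real (m p))"
    and k: "(\<lambda>p. if p \<in> X then of_real ((m p)\<^sup>2 - 1) else 0) \<in> C0 X"
  shows "kk_cycle (C0_algebra Z) B (E, F)"
proof -
  note Fc = representsD(2)[OF F] and F\<Psi> = representsD(3)[OF F]
  have adj: "op_adjoint E F = F"
    by (rule op_adjoint_eq, rule adjoint_pair_multiplication[OF F]) (use F in simp)
  have "(\<lambda>x\<in>carrier E. F (lact E a x) \<ominus>\<^bsub>E\<^esub> lact E a (F x)) \<in> compact_ops B E"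
    if a: "a \<in> C0 Z" for a
    by (rule multiplication_compact[of _ "\<lambda>p. 0"])
      (auto simp: represents_def E.minus Fc F\<Psi> lact[OF a] lact_closed[OF a] mult_ac)
  moreover have "(\<lambda>x\<in>carrier E. lact E a (F (F x) \<ominus>\<^bsub>E\<^esub> x)) \<in> compact_ops B E"
    if a: "a \<in> C0 Z" for a
  proof (rule multiplication_compact)
    let ?k = "\<lambda>p. a (\<pi> p) * (if p \<in> X then of_real ((m p)\<^sup>2 - 1) else 0)"
    show "?k \<in> C0 X" using multiplier_C0[OF proj_multiplier[OF a] k] .
    show "represents (\<lambda>x\<in>carrier E. lact E a (F (F x) \<ominus>\<^bsub>E\<^esub> x)) ?k"
      by (auto simp: represents_def E.minus Fc F\<Psi> lact[OF a] lact_closed[OF a] fun_eq_iff \<Psi>_outside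
          algebra_simps power2_eq_square)
  qed
  moreover have "(\<lambda>x\<in>carrier E. lact E a (F x \<ominus>\<^bsub>E\<^esub> op_adjoint E F x)) \<in> compact_ops B E"
    if a: "a \<in> C0 Z" for a
    unfolding adj
    by (rule multiplication_compact[of _ "\<lambda>p. 0"])
      (auto simp: represents_def E.minus Fc F\<Psi> lact[OF a] lact_closed[OF a])
  ultimately show ?thesis
    unfolding kk_cycle_def
    using hilbert_bimodule countably_generated multiplication_adjointable[OF F m] by simp
qed

end

section \<open>Adjointable operators and the bounded transform\<close>

context function_module
begin

lemma represents_cong:
  assumes "represents T m" "\<And>p. p \<in> X \<Longrightarrow> m p = m' p"
  shows "represents T m'"
  using assms \<Psi>_outside unfolding represents_def fun_eq_iff by (metis mult_zero_right)

lemma represents_unique: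
  assumes "represents T m" "represents T' m'" "\<And>p. p \<in> X \<Longrightarrow> m p = m' p"
  shows "T = T'"
proof (rule PiE_ext[OF representsD(1)[OF assms(1)] representsD(1)[OF assms(2)]])
  fix x assume x: "x \<in> carrier E"
  show "T x = T' x"
    using representsD(3)[OF assms(1) x] representsD(3)[OF assms(2) x] assms(3) \<Psi>_outside[OF x]
    by (intro E.eqI) (metis mult_zero_right)
qed

text \<open>Comparing \<open>\<langle>T x, g\<rangle>\<close> with \<open>\<langle>x, T\<^sup>* g\<rangle>\<close> pointwise for one strictly positive \<open>g\<close> already
  determines \<open>T x\<close>.\<close>

lemma adjointable_is_multiplication:
  assumes "adjoint_pair E T T'"
  obtains q where "\<And>x p. x \<in> carrier E \<Longrightarrow> p \<in> X \<Longrightarrow> \<Psi> (T x) p = q p * \<Psi> x p"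
    and "\<And>x p. x \<in> carrier E \<Longrightarrow> p \<in> X \<Longrightarrow> \<Psi> (T' x) p = cnj (q p) * \<Psi> x p"
proof -
  obtain h where h: "\<And>p. p \<in> X \<Longrightarrow> 0 < h p" "(\<lambda>p. complex_of_real (h p)) \<in> C0 X"
    using pos_fun by blast
  obtain g where g: "g \<in> carrier E" "\<Psi> g = (\<lambda>p. of_real (h p))" using E.lift[OF h(2)] .
  define q where "q p = cnj (\<Psi> (T' g) p / h p)" for p
  have T: "\<Psi> (T x) p = q p * \<Psi> x p" if x: "x \<in> carrier E" and p: "p \<in> X" for x p
  proof -
    have "cnj (\<Psi> (T x) p) * h p = cnj (\<Psi> x p) * \<Psi> (T' g) p"
      using adjoint_pairD[OF assms x g(1) p] g(2) by simp
    then have "cnj (\<Psi> (T x) p) = cnj (q p * \<Psi> x p)"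
      using h(1)[OF p] by (simp add: q_def field_simps)
    then show ?thesis by (metis complex_cnj_cnj)
  qed
  moreover have "\<Psi> (T' x) p = cnj (q p) * \<Psi> x p" if x: "x \<in> carrier E" and p: "p \<in> X" for x p
  proof -
    have "cnj (\<Psi> (T g) p) * \<Psi> x p = cnj (\<Psi> g p) * \<Psi> (T' x) p"
      using adjoint_pairD[OF assms g(1) x p] .
    then show ?thesis using T[OF g(1) p] g(2) h(1)[OF p] by simp
  qed
  ultimately show thesis using that by blast
qed

text \<open>The description in \<open>op_sqrt\<close> ranges over all positive operators, so
  uniqueness must handle an arbitrary T* T: it multiplies by |q|^2, where q is the symbol of
  T.\<close>

lemma positive_op_is_multiplication:
  assumes "Q \<in> positive_ops E"
  obtains q where "represents Q (\<lambda>p. of_real (q p))" "\<And>p. 0 \<le> q p"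
proof -
  obtain T T' where Q: "Q = (\<lambda>x\<in>carrier E. op_adjoint E T (T x))" and T: "adjoint_pair E T T'"
    using assms by (auto simp: positive_ops_def adjointable_ops_def)
  obtain q where q: "\<And>x p. x \<in> carrier E \<Longrightarrow> p \<in> X \<Longrightarrow> \<Psi> (T x) p = q p * \<Psi> x p"
      "\<And>x p. x \<in> carrier E \<Longrightarrow> p \<in> X \<Longrightarrow> \<Psi> (T' x) p = cnj (q p) * \<Psi> x p"
    using adjointable_is_multiplication[OF T] by blast
  have c: "T x \<in> carrier E" "T' x \<in> carrier E" if "x \<in> carrier E" for x
    using T that by (auto simp: adjoint_pair_def)
  have "\<Psi> (T' (T x)) p = of_real ((cmod (q p))\<^sup>2) * \<Psi> x p" if x: "x \<in> carrier E" for x p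
  proof (cases "p \<in> X")
    case True
    then show ?thesis
      using q x c by (simp add: complex_norm_square mult_ac del: of_real_power)
  next
    case False
    then show ?thesis using \<Psi>_outside x c by simp
  qed
  then have "represents Q (\<lambda>p. of_real ((cmod (q p))\<^sup>2))"
    unfolding represents_def Q op_adjoint_eq[OF T] using c by auto
  then show thesis using that[of "\<lambda>p. (cmod (q p))\<^sup>2"] by simp
qed

text \<open>Q is positive because it is T* T for T multiplication by sqrt(r). A competing positive
  root is a multiplication too, and applying its square to a strictly positive element reduces
  uniqueness to that of nonnegative real roots.\<close>

lemma op_sqrt_multiplication:
  assumes R: "represents R (\<lambda>p. of_real ((r p)\<^sup>2))" and Q: "represents Q (\<lambda>p. of_real (r p))"
    and r: "multiplier (\<lambda>p. of_real (r p))" "\<And>p. 0 \<le> r p"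
  shows "op_sqrt E R = Q"
  unfolding op_sqrt_def
proof (rule the_equality)
  have "multiplier (\<lambda>p. of_real (sqrt (r p)))"
    unfolding multiplier_def
  proof
    have "continuous_on X r" using continuous_on_Re[of X "\<lambda>p. complex_of_real (r p)"] r(1)
      by (simp add: multiplier_def)
    then show "continuous_on X (\<lambda>p. complex_of_real (sqrt (r p)))" by (intro continuous_intros)
    obtain b where b: "\<And>p. p \<in> X \<Longrightarrow> r p \<le> b" using r by (auto simp: multiplier_def)
    show "\<exists>b. \<forall>p\<in>X. cmod (complex_of_real (sqrt (r p))) \<le> b"
      using b r(2) by (intro exI[of _ "sqrt b"]) auto
  qed
  then obtain T where T: "represents T (\<lambda>p. of_real (sqrt (r p)))" using represents_lift by blast
  have adj: "adjoint_pair E T T" by (rule adjoint_pair_multiplication[OF T]) (use T in simp)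
  have "(\<lambda>x\<in>carrier E. op_adjoint E T (T x)) = Q"
  proof (rule represents_unique[OF _ Q])
    show "represents (\<lambda>x\<in>carrier E. op_adjoint E T (T x)) (\<lambda>p. of_real (sqrt (r p)) * of_real (sqrt (r p)))"
      unfolding op_adjoint_eq[OF adj] using representsD[OF T] by (auto simp: represents_def mult_ac)
  qed (use r(2) in \<open>simp flip: of_real_mult\<close>)
  then have "Q \<in> positive_ops E" using adj by (auto simp: positive_ops_def adjointable_ops_def)
  moreover have "Q (Q x) = R x" if "x \<in> carrier E" for x
    using that representsD(2,3)[OF Q] representsD(3)[OF R]
    by (intro E.eqI) (simp add: power2_eq_square)
  ultimately show "Q \<in> positive_ops E \<and> (\<forall>x\<in>carrier E. Q (Q x) = R x)" by blast
next
  fix Q' assume Q': "Q' \<in> positive_ops E \<and> (\<forall>x\<in>carrier E. Q' (Q' x) = R x)"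
  then obtain q where q: "represents Q' (\<lambda>p. of_real (q p))" "\<And>p. 0 \<le> q p"
    using positive_op_is_multiplication by blast
  obtain h where h: "\<And>p. p \<in> X \<Longrightarrow> 0 < h p" "(\<lambda>p. complex_of_real (h p)) \<in> C0 X"
    using pos_fun by blast
  obtain g where g: "g \<in> carrier E" "\<Psi> g = (\<lambda>p. of_real (h p))" using E.lift[OF h(2)] .
  show "Q' = Q"
  proof (rule represents_unique[OF q(1) Q])
    fix p assume p: "p \<in> X"
    have "\<Psi> (Q' (Q' g)) p = \<Psi> (R g) p" using Q' g(1) by simp
    then have "of_real (q p * (q p * h p)) = complex_of_real ((r p)\<^sup>2 * h p)"
      using representsD(2,3)[OF q(1)] representsD(3)[OF R] g by simp
    then have "q p * (q p * h p) = (r p)\<^sup>2 * h p" by (simp only: of_real_eq_iff)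
    then have "(q p)\<^sup>2 = (r p)\<^sup>2" using h(1)[OF p] by (simp add: power2_eq_square)
    then show "complex_of_real (q p) = complex_of_real (r p)"
      using q(2) r(2) by (simp add: power2_eq_iff_nonneg)
  qed
qed

text \<open>Although \<open>f\<close> may be unbounded, r = (1 + f^2)^(-1/2) and f r are bounded by
  1. With Q multiplication by r, the resolvent is Q Q and its positive root is Q, so the transform
  is S Q, multiplication by f r.\<close>

lemma bounded_transform_multiplication:
  assumes f: "continuous_on X f" and S: "\<And>x p. \<Psi> (S x) p = of_real (f p) * \<Psi> x p"
  shows "represents (bounded_transform E {x \<in> carrier E. S x \<in> carrier E} S)
    (\<lambda>p. of_real (f p / sqrt (1 + (f p)\<^sup>2)))"
proof -
  let ?D = "{x \<in> carrier E. S x \<in> carrier E}"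
  have pos: "0 < 1 + (f p)\<^sup>2" for p by (simp add: add_pos_nonneg)
  define r where "r p = 1 / sqrt (1 + (f p)\<^sup>2)" for p
  have r0: "0 \<le> r p" and r1: "r p \<le> 1" and fr: "\<bar>f p\<bar> * r p \<le> 1" for p
  proof -
    have "\<bar>f p\<bar> \<le> sqrt (1 + (f p)\<^sup>2)" "1 \<le> sqrt (1 + (f p)\<^sup>2)"
      by (auto intro!: real_le_rsqrt)
    then show "0 \<le> r p" "r p \<le> 1" "\<bar>f p\<bar> * r p \<le> 1"
      using pos[of p] by (auto simp: r_def)
  qed
  have r2: "(r p)\<^sup>2 = 1 / (1 + (f p)\<^sup>2)" for p
    using pos[of p] by (simp add: r_def power_divide)
  have cr: "continuous_on X r"
    unfolding r_def using pos by (intro continuous_intros f) (auto simp: less_imp_neq[symmetric])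
  have mr: "multiplier (\<lambda>p. of_real (r p))"
    unfolding multiplier_def using r0 r1 by (auto intro!: continuous_intros cr)
  have mfr: "multiplier (\<lambda>p. of_real (f p * r p))"
    unfolding multiplier_def
  proof
    show "continuous_on X (\<lambda>p. complex_of_real (f p * r p))" by (intro continuous_intros f cr)
    show "\<exists>b. \<forall>p\<in>X. cmod (complex_of_real (f p * r p)) \<le> b"
      using fr r0 by (intro exI[of _ 1]) (auto simp: abs_mult norm_mult)
  qed
  obtain Q where Q: "represents Q (\<lambda>p. of_real (r p))" using represents_lift[OF mr] .
  note Qc = representsD(2)[OF Q] and Q\<Psi> = representsD(3)[OF Q]
  have SQ: "S (Q x) \<in> carrier E" "\<Psi> (S (Q x)) = (\<lambda>p. of_real (f p * r p) * \<Psi> x p)"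
    if x: "x \<in> carrier E" for x
  proof -
    show \<Psi>: "\<Psi> (S (Q x)) = (\<lambda>p. of_real (f p * r p) * \<Psi> x p)"
      using x by (simp add: fun_eq_iff S Q\<Psi> mult_ac)
    show "S (Q x) \<in> carrier E"
      unfolding E.carrier_iff \<Psi> by (rule multiplier_C0[OF mfr \<Psi>_C0[OF x]])
  qed
  have R: "resolvent_sq E ?D S = (\<lambda>y\<in>carrier E. Q (Q y))"
    unfolding resolvent_sq_def
  proof (rule restrict_ext)
    fix y assume y: "y \<in> carrier E"
    have QQ: "Q (Q y) \<in> carrier E" "S (Q (Q y)) \<in> carrier E" using y Qc SQ(1) by auto
    \<comment> \<open>Letting \<open>S\<close> pass one \<open>Q\<close> writes S S Q Q as (S Q)(S
      Q): each possibly unbounded factor is matched with a bounded one, so the result stays in the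
      module.\<close>
    have "\<Psi> (S (Q (Q y))) = \<Psi> (Q (S (Q y)))"
      using y Qc SQ by (simp add: fun_eq_iff S Q\<Psi> mult_ac)
    then have "S (Q (Q y)) = Q (S (Q y))" by (intro E.eqI) simp
    then have SS: "S (S (Q (Q y))) \<in> carrier E" using SQ y by simp
    show "(THE x. x \<in> ?D \<and> S x \<in> ?D \<and> x \<oplus>\<^bsub>E\<^esub> S (S x) = y) = Q (Q y)"
    proof (rule the_equality)
      have "Q (Q y) \<oplus>\<^bsub>E\<^esub> S (S (Q (Q y))) = y"
      proof (rule E.eqI)
        fix p
        have "(r p)\<^sup>2 + (f p)\<^sup>2 * (r p)\<^sup>2 = 1" using pos[of p] by (simp add: r2 field_simps)
        then have "complex_of_real ((r p)\<^sup>2 + (f p)\<^sup>2 * (r p)\<^sup>2) * \<Psi> y p = \<Psi> y p" by simp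
        then show "\<Psi> (Q (Q y) \<oplus>\<^bsub>E\<^esub> S (S (Q (Q y)))) p = \<Psi> y p"
          using QQ SS y Qc by (simp add: E.add S Q\<Psi> power2_eq_square algebra_simps)
      qed
      then show "Q (Q y) \<in> ?D \<and> S (Q (Q y)) \<in> ?D \<and> Q (Q y) \<oplus>\<^bsub>E\<^esub> S (S (Q (Q y))) = y"
        using QQ SS by simp
    next
      \<comment> \<open>Any solution satisfies y = (1 + f^2) x at every point, and multiplying by
        r^2 solves for x.\<close>
      fix x assume x: "x \<in> ?D \<and> S x \<in> ?D \<and> x \<oplus>\<^bsub>E\<^esub> S (S x) = y"
      then have xc: "x \<in> carrier E" "S (S x) \<in> carrier E" by auto
      show "x = Q (Q y)"
      proof (rule E.eqI)
        fix p
        have "\<Psi> y p = \<Psi> (x \<oplus>\<^bsub>E\<^esub> S (S x)) p" using x by simp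
        also have "\<dots> = of_real (1 + (f p)\<^sup>2) * \<Psi> x p"
          using xc by (simp add: E.add S power2_eq_square algebra_simps)
        finally have "\<Psi> y p = of_real (1 + (f p)\<^sup>2) * \<Psi> x p" .
        then have "of_real ((r p)\<^sup>2) * \<Psi> y p = of_real ((r p)\<^sup>2 * (1 + (f p)\<^sup>2)) * \<Psi> x p" by simp
        also have "(r p)\<^sup>2 * (1 + (f p)\<^sup>2) = 1" using pos[of p] by (simp add: r2)
        finally show "\<Psi> x p = \<Psi> (Q (Q y)) p"
          using y Qc by (simp add: Q\<Psi> power2_eq_square mult_ac)
      qed
    qed
  qed
  have "represents (\<lambda>y\<in>carrier E. Q (Q y)) (\<lambda>p. of_real ((r p)\<^sup>2))"
    using Qc Q\<Psi> by (auto simp: represents_def power2_eq_square mult_ac)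
  then have "op_sqrt E (resolvent_sq E ?D S) = Q"
    unfolding R using op_sqrt_multiplication[OF _ Q mr r0] by blast
  then show ?thesis
    unfolding bounded_transform_def represents_def using SQ by (auto simp: r_def)
qed

end

section \<open>Evaluation of cycles\<close>

text \<open>Evaluation at \<open>t\<close> is onto. Without a lift of \<open>b\<close>, the union
  that defines its right action on an evaluated module would be empty.\<close>

lemma (in cstar_algebra) const_path:
  assumes "b \<in> carrier A" "t \<in> {0..1}"
  shows "\<exists>g\<in>carrier (path_algebra A). g t = b"
proof -
  have "b \<ominus>\<^bsub>A\<^esub> b = \<zero>\<^bsub>A\<^esub>" using assms(1) by (simp add: a_minus_def M.r_neg)
  moreover have "nrm A \<zero>\<^bsub>A\<^esub> = 0" using nrm_eq_0 by simp
  ultimately have "(\<lambda>s. if s \<in> {0..1} then b else \<zero>\<^bsub>A\<^esub>) \<in> carrier (path_algebra A)"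
    using assms(1) by (auto simp: path_algebra_def intro: exI[of _ 1])
  then show ?thesis using assms(2) by (intro bexI[of _ "\<lambda>s. if s \<in> {0..1} then b else \<zero>\<^bsub>A\<^esub>"]) auto
qed

text \<open>A surjection \<rho> onto \<open>E\<close>, compatible with all structure at
  \<open>t\<close>, stands in for the quotient: definiteness of the inner product of
  \<open>E\<close> makes the null submodule the kernel of \<rho>. The cosets are then the fibres of
  \<rho>, and the unitary sends a fibre to its value.\<close>

lemma ev_cycle_unitarily_equivalent:
  assumes H: "hilbert_bimodule A (path_algebra B) H" and E: "hilbert_bimodule A B E"
    and t: "t \<in> {0..1}" and surj: "\<rho> ` carrier H = carrier E"
    and add: "\<And>x y. \<lbrakk>x \<in> carrier H; y \<in> carrier H\<rbrakk> \<Longrightarrow> \<rho> (x \<oplus>\<^bsub>H\<^esub> y) = \<rho> x \<oplus>\<^bsub>E\<^esub> \<rho> y"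
    and smult: "\<And>c x. x \<in> carrier H \<Longrightarrow> \<rho> (c \<odot>\<^bsub>H\<^esub> x) = c \<odot>\<^bsub>E\<^esub> \<rho> x"
    and ract: "\<And>x g. \<lbrakk>x \<in> carrier H; g \<in> carrier (path_algebra B)\<rbrakk> \<Longrightarrow>
      \<rho> (ract H x g) = ract E (\<rho> x) (g t)"
    and ip: "\<And>x y. \<lbrakk>x \<in> carrier H; y \<in> carrier H\<rbrakk> \<Longrightarrow> ip E (\<rho> x) (\<rho> y) = ip H x y t"
    and lact: "\<And>a x. \<lbrakk>a \<in> carrier A; x \<in> carrier H\<rbrakk> \<Longrightarrow> \<rho> (lact H a x) = lact E a (\<rho> x)"
    and F: "\<And>x. x \<in> carrier H \<Longrightarrow> F x \<in> carrier H \<and> \<rho> (F x) = G (\<rho> x)"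
  shows "unitarily_equivalent A B (ev_cycle B t (H, F)) (E, G)"
proof -
  interpret H: hilbert_bimodule A "path_algebra B" H by (rule H)
  interpret E: hilbert_bimodule A B E by (rule E)
  have \<rho>: "\<rho> x \<in> carrier E" if "x \<in> carrier H" for x using surj that by blast
  have \<rho>_diff: "\<rho> (y \<ominus>\<^bsub>H\<^esub> x) = \<rho> y \<ominus>\<^bsub>E\<^esub> \<rho> x" if "x \<in> carrier H" "y \<in> carrier H" for x y
  proof -
    have "\<rho> (y \<ominus>\<^bsub>H\<^esub> x) \<oplus>\<^bsub>E\<^esub> \<rho> x = \<rho> ((y \<ominus>\<^bsub>H\<^esub> x) \<oplus>\<^bsub>H\<^esub> x)" using that by (simp add: add)
    also have "(y \<ominus>\<^bsub>H\<^esub> x) \<oplus>\<^bsub>H\<^esub> x = y" using that by (simp add: a_minus_def H.a_assoc H.l_neg)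
    also have "\<rho> y = (\<rho> y \<ominus>\<^bsub>E\<^esub> \<rho> x) \<oplus>\<^bsub>E\<^esub> \<rho> x"
      using that \<rho> by (simp add: a_minus_def E.a_assoc E.l_neg)
    finally show ?thesis using that \<rho> by simp
  qed
  \<comment> \<open>This puts the kernel of \<rho> inside the null submodule; definiteness gives the
    other inclusion.\<close>
  have ip0: "ip E \<zero>\<^bsub>E\<^esub> \<zero>\<^bsub>E\<^esub> = \<zero>\<^bsub>B\<^esub>"
  proof -
    have "ip E \<zero>\<^bsub>E\<^esub> \<zero>\<^bsub>E\<^esub> \<oplus>\<^bsub>B\<^esub> ip E \<zero>\<^bsub>E\<^esub> \<zero>\<^bsub>E\<^esub> = ip E \<zero>\<^bsub>E\<^esub> \<zero>\<^bsub>E\<^esub> \<oplus>\<^bsub>B\<^esub> \<zero>\<^bsub>B\<^esub>"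
      using E.ip_add[of "\<zero>\<^bsub>E\<^esub>" "\<zero>\<^bsub>E\<^esub>" "\<zero>\<^bsub>E\<^esub>"] E.ip_closed[of "\<zero>\<^bsub>E\<^esub>" "\<zero>\<^bsub>E\<^esub>"] by simp
    then show ?thesis using E.ip_closed[of "\<zero>\<^bsub>E\<^esub>" "\<zero>\<^bsub>E\<^esub>"] by simp
  qed
  define N where "N = ev_null B t H"
  define fib where "fib y = {x \<in> carrier H. \<rho> x = y}" for y
  have N: "x \<in> N \<longleftrightarrow> x \<in> carrier H \<and> \<rho> x = \<zero>\<^bsub>E\<^esub>" for x
    using ip[of x x, symmetric] ip0 E.ip_definite \<rho> by (auto simp: N_def ev_null_def)
  have coset: "N +>\<^bsub>H\<^esub> x = fib (\<rho> x)" if x: "x \<in> carrier H" for x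
  proof (intro equalityI subsetI)
    fix y assume "y \<in> N +>\<^bsub>H\<^esub> x"
    then obtain n where "n \<in> N" "y = n \<oplus>\<^bsub>H\<^esub> x" unfolding a_r_coset_def' by blast
    then show "y \<in> fib (\<rho> x)" using x \<rho> N by (simp add: fib_def add)
  next
    fix y assume y: "y \<in> fib (\<rho> x)"
    have "\<rho> x \<ominus>\<^bsub>E\<^esub> \<rho> x = \<zero>\<^bsub>E\<^esub>" using \<rho>[OF x] by (simp add: a_minus_def E.r_neg)
    then have "y \<ominus>\<^bsub>H\<^esub> x \<in> N" using x y by (simp add: N fib_def \<rho>_diff)
    moreover have "y = (y \<ominus>\<^bsub>H\<^esub> x) \<oplus>\<^bsub>H\<^esub> x"
      using y x by (simp add: fib_def a_minus_def H.a_assoc H.l_neg)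
    ultimately show "y \<in> N +>\<^bsub>H\<^esub> x" unfolding a_r_coset_def' by blast
  qed
  have fib_nonempty: "\<exists>x. x \<in> carrier H \<and> \<rho> x = y" if "y \<in> carrier E" for y
    using that unfolding surj[symmetric] by auto
  have cosets: "a_rcosets\<^bsub>H\<^esub> N = fib ` carrier E"
  proof -
    have "a_rcosets\<^bsub>H\<^esub> N = (\<lambda>x. N +>\<^bsub>H\<^esub> x) ` carrier H" unfolding A_RCOSETS_def' by blast
    also have "\<dots> = (\<lambda>x. fib (\<rho> x)) ` carrier H" by (rule image_cong) (simp_all add: coset)
    also have "\<dots> = fib ` carrier E" unfolding surj[symmetric] by (simp add: image_image)
    finally show ?thesis .
  qed
  have fib_add: "set_add H (fib y) (fib z) = fib (y \<oplus>\<^bsub>E\<^esub> z)"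
    if yz: "y \<in> carrier E" "z \<in> carrier E" for y z
  proof (intro equalityI subsetI)
    fix w assume "w \<in> set_add H (fib y) (fib z)"
    then show "w \<in> fib (y \<oplus>\<^bsub>E\<^esub> z)" unfolding set_add_def' by (auto simp: fib_def add)
  next
    fix w assume w: "w \<in> fib (y \<oplus>\<^bsub>E\<^esub> z)"
    obtain x where x: "x \<in> carrier H" "\<rho> x = y" using fib_nonempty yz by blast
    have "(y \<oplus>\<^bsub>E\<^esub> z) \<ominus>\<^bsub>E\<^esub> y = z"
      using yz by (simp add: a_minus_def E.a_comm[of y z] E.a_assoc E.r_neg)
    then have "w \<ominus>\<^bsub>H\<^esub> x \<in> fib z" using w x by (simp add: fib_def \<rho>_diff)
    moreover have "w = x \<oplus>\<^bsub>H\<^esub> (w \<ominus>\<^bsub>H\<^esub> x)"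
      using w x by (simp add: fib_def a_minus_def H.a_comm[of w] H.a_assoc[symmetric] H.r_neg)
    moreover have "x \<in> fib y" using x by (simp add: fib_def)
    ultimately show "w \<in> set_add H (fib y) (fib z)" unfolding set_add_def' by blast
  qed
  \<comment> \<open>Operations on cosets are unions over representatives. Each representative
    contributes the same fibre, and surjectivity of \<rho> keeps the union from being empty.\<close>
  have fib_UN: "(\<Union>x\<in>fib y. N +>\<^bsub>H\<^esub> T x) = fib z"
    if y: "y \<in> carrier E" and T: "\<And>x. x \<in> carrier H \<Longrightarrow> \<rho> x = y \<Longrightarrow> T x \<in> carrier H \<and> \<rho> (T x) = z" for y z T
  proof -
    have "N +>\<^bsub>H\<^esub> T x = fib z" if "x \<in> fib y" for x
      using coset[of "T x"] T[of x] that by (simp add: fib_def)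
    moreover have "fib y \<noteq> {}" using fib_nonempty[OF y] by (auto simp: fib_def)
    ultimately show ?thesis by auto
  qed
  \<comment> \<open>Any representative will do, since \<rho> is constant on a fibre.\<close>
  define U where "U X = \<rho> (SOME x. x \<in> X)" for X
  have U: "U (fib y) = y" if "y \<in> carrier E" for y
  proof -
    have "\<exists>x. x \<in> fib y" using fib_nonempty[OF that] by (auto simp: fib_def)
    then have "(SOME x. x \<in> fib y) \<in> fib y" by (rule someI_ex)
    then show ?thesis by (simp add: U_def fib_def)
  qed
  have simps: "carrier (ev_bimod B t H) = fib ` carrier E"
    "X \<oplus>\<^bsub>ev_bimod B t H\<^esub> Y = set_add H X Y"
    "c \<odot>\<^bsub>ev_bimod B t H\<^esub> X = (\<Union>x\<in>X. N +>\<^bsub>H\<^esub> (c \<odot>\<^bsub>H\<^esub> x))"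
    "ip (ev_bimod B t H) X Y = (THE b. \<exists>x\<in>X. \<exists>y\<in>Y. b = ip H x y t)"
    "ract (ev_bimod B t H) X b =
      (\<Union>x\<in>X. \<Union>g\<in>{g \<in> carrier (path_algebra B). g t = b}. N +>\<^bsub>H\<^esub> ract H x g)"
    "lact (ev_bimod B t H) a X = (\<Union>x\<in>X. N +>\<^bsub>H\<^esub> lact H a x)" for X Y c b a
    by (simp_all add: ev_bimod_def Let_def N_def[symmetric] cosets)
  have fib_ract: "ract (ev_bimod B t H) (fib y) b = fib (ract E y b)"
    if y: "y \<in> carrier E" and b: "b \<in> carrier B" for y b
  proof -
    have "(\<Union>g\<in>{g \<in> carrier (path_algebra B). g t = b}. N +>\<^bsub>H\<^esub> ract H x g) = fib (ract E y b)"
      if x: "x \<in> fib y" for x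
    proof -
      have "N +>\<^bsub>H\<^esub> ract H x g = fib (ract E y b)"
        if "g \<in> carrier (path_algebra B)" "g t = b" for g
        using x that coset[of "ract H x g"] by (simp add: fib_def ract H.ract_closed)
      then show ?thesis using E.B.const_path[OF b t] by auto
    qed
    moreover have "fib y \<noteq> {}" using fib_nonempty[OF y] by (auto simp: fib_def)
    ultimately show ?thesis unfolding simps by auto
  qed
  have fib_ip: "ip (ev_bimod B t H) (fib y) (fib z) = ip E y z"
    if "y \<in> carrier E" "z \<in> carrier E" for y z
    unfolding simps
  proof (rule the_equality)
    show "\<exists>x\<in>fib y. \<exists>x'\<in>fib z. ip E y z = ip H x x' t"
      using fib_nonempty[OF that(1)] fib_nonempty[OF that(2)] ip by (fastforce simp: fib_def)
  qed (auto simp: fib_def ip[symmetric])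
  show ?thesis
    unfolding unitarily_equivalent_def ev_cycle_def prod.case
  proof (intro exI[of _ U] conjI ballI allI)
    show "bij_betw U (carrier (ev_bimod B t H)) (carrier E)"
      unfolding simps bij_betw_def by (force simp: inj_on_def U image_iff)
    fix X assume "X \<in> carrier (ev_bimod B t H)"
    then obtain y where y: "y \<in> carrier E" "X = fib y" by (auto simp: simps(1))
    show "U (c \<odot>\<^bsub>ev_bimod B t H\<^esub> X) = c \<odot>\<^bsub>E\<^esub> U X" for c
      using y fib_UN[OF y(1), of "\<lambda>x. c \<odot>\<^bsub>H\<^esub> x" "c \<odot>\<^bsub>E\<^esub> y"] smult by (simp add: simps U)
    show "U (ract (ev_bimod B t H) X b) = ract E (U X) b" if "b \<in> carrier B" for b
      using y that by (simp add: fib_ract U E.ract_closed)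
    show "U (lact (ev_bimod B t H) a X) = lact E a (U X)" if "a \<in> carrier A" for a
      using y that fib_UN[OF y(1), of "lact H a" "lact E a y"] lact
      by (simp add: simps U E.lact_closed H.lact_closed)
    have "G y \<in> carrier E" using F fib_nonempty[OF y(1)] \<rho> by metis
    then show "U (ev_op B t H F X) = G (U X)"
      using y fib_UN[OF y(1), of F "G y"] F
      by (simp add: ev_op_def simps(1) U N_def[symmetric])
    fix X' assume "X' \<in> carrier (ev_bimod B t H)"
    then obtain y' where y': "y' \<in> carrier E" "X' = fib y'" by (auto simp: simps(1))
    show "U (X \<oplus>\<^bsub>ev_bimod B t H\<^esub> X') = U X \<oplus>\<^bsub>E\<^esub> U X'"
      using y y' by (simp add: simps fib_add U)
    show "ip E (U X) (U X') = ip (ev_bimod B t H) X X'"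
      using y y' by (simp add: fib_ip U)
  qed
qed

section \<open>Classes of homotopic cycles\<close>

lemma kk_class_in_KK: "kk_cycle A B x \<Longrightarrow> kk_class A B x \<in> KK A B"
  by (auto simp: kk_class_def KK_def intro: quotientI)

lemma kk_class_eq_of_homotopic:
  fixes x y :: "('a, 'b, 'e) cycle"
  assumes "kk_homotopic A B x y"
  shows "kk_class A B x = kk_class A B y"
proof -
  have cyc: "kk_cycle A B x" "kk_cycle A B y" using assms by (auto simp: kk_homotopic_def)
  define R :: "(('a, 'b, 'e) cycle \<times> ('a, 'b, 'e) cycle) set" where "R = kk_rel A B"
  have e: "equivp (equivclp (kk_homotopic A B :: ('a, 'b, 'e) cycle \<Rightarrow> _))"
    by (rule equivp_evquivclp)
  \<comment> \<open>The equivalence closure lives on the whole type; restricted to cycles it is an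
    equivalence on that set, so related cycles have equal classes.\<close>
  have "equiv {x. kk_cycle A B x} R"
  proof (rule equivI)
    show "refl_on {x. kk_cycle A B x} R"
      using equivp_reflp[OF e] by (auto simp: refl_on_def R_def kk_rel_def)
    show "sym R" using equivp_symp[OF e] by (auto simp: sym_def R_def kk_rel_def)
    show "trans R" using equivp_transp[OF e] unfolding trans_def R_def kk_rel_def by blast
  qed (auto simp: R_def kk_rel_def)
  moreover have "(x, y) \<in> R" using assms cyc by (auto simp: R_def kk_rel_def)
  ultimately show ?thesis
    unfolding kk_class_def R_def[symmetric] by (rule equiv_class_eq)
qed

section \<open>Open embeddings and the multiplier of the cycles\<close>

text \<open>j(X') is the preimage of X' under the continuous inverse, hence open in j(X) and so in
  \<open>Y\<close>.\<close>

lemma open_embedding_subset: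
  assumes j: "open_embedding X Y j" and X': "openin (top_of_set X) X'"
  shows "open_embedding X' Y j"
proof -
  have jD: "inj_on j X" "continuous_on X j" "continuous_on (j ` X) (inv_into X j)"
      "openin (top_of_set Y) (j ` X)"
    using j by (auto simp: open_embedding_def)
  have sub: "X' \<subseteq> X" using X' openin_imp_subset by blast
  have inj: "inj_on j X'" using jD(1) sub inj_on_subset by blast
  have inv: "inv_into X' j y = inv_into X j y" if "y \<in> j ` X'" for y
    using that sub inv_into_f_f[OF inj] inv_into_f_f[OF jD(1)] by auto
  have "continuous_on (j ` X') (inv_into X j)"
    using jD(3) sub by (meson continuous_on_subset image_mono)
  then have "continuous_on (j ` X') (inv_into X' j)"
    using inv by (simp cong: continuous_on_cong)
  moreover have "openin (top_of_set (j ` X)) (j ` X')"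
  proof -
    have "j ` X' = j ` X \<inter> inv_into X j -` X'"
      using sub inv_into_f_f[OF jD(1)] by auto
    moreover have "inv_into X j \<in> j ` X \<rightarrow> X" by (auto intro: inv_into_into)
    ultimately show ?thesis
      using continuous_openin_preimage[OF jD(3) _ X'] by simp
  qed
  ultimately show ?thesis
    unfolding open_embedding_def
    using inj jD(2,4) sub by (meson continuous_on_subset openin_trans)
qed

lemma open_embedding_Times:
  fixes j :: "'x::topological_space \<Rightarrow> 'y::topological_space" and T :: "'t::topological_space set"
  assumes "open_embedding X UNIV j"
  shows "open_embedding (T \<times> X) (T \<times> UNIV) (\<lambda>(t, p). (t, j p))"
proof -
  let ?J = "\<lambda>(t, p). (t, j p)"
  have jD: "inj_on j X" "continuous_on X j" "continuous_on (j ` X) (inv_into X j)" "open (j ` X)"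
    using assms by (auto simp: open_embedding_def)
  have im: "?J ` (T \<times> X) = T \<times> j ` X" by force
  have inj: "inj_on ?J (T \<times> X)" using jD(1) by (auto simp: inj_on_def)
  have inv: "inv_into (T \<times> X) ?J q = (fst q, inv_into X j (snd q))" if q: "q \<in> T \<times> j ` X" for q
  proof -
    obtain t p where "q = (t, j p)" "t \<in> T" "p \<in> X" using q by auto
    then show ?thesis
      using inv_into_f_f[OF inj, of "(t, p)"] inv_into_f_f[OF jD(1), of p] by simp
  qed
  have "continuous_on (T \<times> X) ?J"
    unfolding case_prod_unfold
    by (intro continuous_intros continuous_on_compose2[OF jD(2)]) auto
  moreover have "continuous_on (T \<times> j ` X) (\<lambda>q. (fst q, inv_into X j (snd q)))"
    by (intro continuous_intros continuous_on_compose2[OF jD(3)]) auto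
  then have "continuous_on (T \<times> j ` X) (inv_into (T \<times> X) ?J)"
    using inv by (simp cong: continuous_on_cong)
  moreover have "openin (top_of_set (T \<times> UNIV)) (T \<times> j ` X)"
    using jD(4) by (auto simp: openin_open intro!: exI[of _ "UNIV \<times> j ` X"] open_Times)
  ultimately show ?thesis unfolding open_embedding_def im using inj by simp
qed

text \<open>The function is built on the image, which is relatively open in a closed subset of a
  Euclidean space, and then pulled back by pushing along the inverse of \<open>j\<close>.\<close>

lemma open_embedding_strictly_positive:
  fixes j :: "'x::t2_space \<Rightarrow> 'y::euclidean_space"
  assumes j: "open_embedding X Y j" and "closed Y"
  shows "\<exists>h. (\<forall>p\<in>X. 0 < h p) \<and> (\<lambda>p. complex_of_real (h p)) \<in> C0 X"
proof -
  have jD: "inj_on j X" "openin (top_of_set Y) (j ` X)" using j by (auto simp: open_embedding_def)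
  obtain h where h: "\<And>y. y \<in> j ` X \<Longrightarrow> 0 < h y" "(\<lambda>y. complex_of_real (h y)) \<in> C0 (j ` X)"
    using strictly_positive_C0[OF assms(2) jD(2)] by blast
  have im: "inv_into X j ` (j ` X) = X" using jD(1) by simp
  have inj: "inj_on (inv_into X j) (j ` X)" by (simp add: inj_on_inv_into)
  have "inv_into (j ` X) (inv_into X j) p = j p" if "p \<in> X" for p
    using inv_into_f_f[OF inj, of "j p"] that jD(1) by simp
  then have "push (j ` X) (inv_into X j) (\<lambda>y. complex_of_real (h y)) =
      (\<lambda>p. complex_of_real (if p \<in> X then h (j p) else 0))"
    by (auto simp: push_def im fun_eq_iff)
  then have "(\<lambda>p. complex_of_real (if p \<in> X then h (j p) else 0)) \<in> C0 X"
    using push_C0[OF open_embedding_inverse[OF j] h(2)] by simp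
  then show ?thesis using h(1) by (intro exI[of _ "\<lambda>p. if p \<in> X then h (j p) else 0"]) auto
qed

text \<open>The compact set is cut down to the points with |f| at least e: this is closed in
  \<open>K\<close>, and it lies in \<open>X\<close> because \<open>f\<close> vanishes elsewhere.
  Membership in C_0(W) can thus be checked without describing compact subsets of W.\<close>

lemma C0_subset:
  assumes f: "f \<in> C0 Y" and "X \<subseteq> Y" and out: "\<And>x. x \<notin> X \<Longrightarrow> f x = 0"
  shows "f \<in> C0 X"
proof (rule C0I)
  show "continuous_on X f" using C0D(1)[OF f] assms(2) continuous_on_subset by blast
  show "f x = 0" if "x \<notin> X" for x using out[OF that] .
  fix e :: real assume "e > 0"
  then obtain K where K: "compact K" "K \<subseteq> Y" "\<forall>x. x \<notin> K \<longrightarrow> cmod (f x) < e"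
    using C0D(3)[OF f] by blast
  have "continuous_on K f" using C0D(1)[OF f] K(2) continuous_on_subset by blast
  then have "closedin (top_of_set K) (K \<inter> f -` {z. e \<le> cmod z})"
    by (intro continuous_closedin_preimage closed_Collect_le continuous_intros)
  then have "compact (K \<inter> f -` {z. e \<le> cmod z})" using K(1) closedin_compact by blast
  moreover have "K \<inter> f -` {z. e \<le> cmod z} \<subseteq> X" using out \<open>e > 0\<close> by force
  ultimately show "\<exists>K. compact K \<and> K \<subseteq> X \<and> (\<forall>x\<in>X - K. cmod (f x) < e)"
    using K(3) by (intro exI[of _ "K \<inter> f -` {z. e \<le> cmod z}"]) force
qed

text \<open>Elementary tensors. Since \<open>T\<close> is compact, its product with a compact set
  for \<phi> is compact, and \<open>u\<close> is bounded on it.\<close>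

lemma C0_compact_Times:
  fixes u :: "'t::topological_space \<Rightarrow> complex"
  assumes \<phi>: "\<phi> \<in> C0 X" and T: "compact T" and u: "continuous_on T u"
  shows "(\<lambda>(t, p). if t \<in> T then u t * \<phi> p else 0) \<in> C0 (T \<times> X)"
proof -
  have "(\<lambda>(t, p). if t \<in> T then \<phi> p else 0) \<in> C0 (T \<times> X)"
  proof (rule C0I)
    have "continuous_on (T \<times> X) (\<lambda>q. \<phi> (snd q))"
      by (intro continuous_on_compose2[OF C0D(1)[OF \<phi>]] continuous_intros) auto
    then show "continuous_on (T \<times> X) (\<lambda>(t, p). if t \<in> T then \<phi> p else 0)"
      by (rule continuous_on_eq) auto
    show "(case q of (t, p) \<Rightarrow> if t \<in> T then \<phi> p else 0) = 0" if "q \<notin> T \<times> X" for q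
      using that C0D(2)[OF \<phi>, of "snd q"] by (cases q) auto
    fix e :: real assume "e > 0"
    then obtain K where K: "compact K" "K \<subseteq> X" "\<forall>x. x \<notin> K \<longrightarrow> cmod (\<phi> x) < e"
      using C0D(3)[OF \<phi>] by blast
    show "\<exists>K. compact K \<and> K \<subseteq> T \<times> X \<and>
        (\<forall>q\<in>T \<times> X - K. cmod (case q of (t, p) \<Rightarrow> if t \<in> T then \<phi> p else 0) < e)"
      using K T by (intro exI[of _ "T \<times> K"]) (auto intro: compact_Times)
  qed
  moreover obtain b where "\<And>t. t \<in> T \<Longrightarrow> cmod (u t) \<le> b"
    using compact_imp_bounded[OF compact_continuous_image[OF u T]] by (auto simp: bounded_iff)
  ultimately have "(\<lambda>q. u (fst q) * (case q of (t, p) \<Rightarrow> if t \<in> T then \<phi> p else 0)) \<in> C0 (T \<times> X)"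
    by (intro C0_mult_bounded[where c = b] continuous_on_compose2[OF u] continuous_intros) auto
  then show ?thesis by (simp add: case_prod_unfold if_distrib cong: if_cong)
qed

lemma C0_vanishing_outside_interval:
  fixes k :: "real \<Rightarrow> complex"
  assumes "continuous_on UNIV k" "\<And>s. \<bar>s\<bar> \<ge> \<epsilon> \<Longrightarrow> k s = 0"
  shows "k \<in> C0 {-\<epsilon><..<\<epsilon>}"
proof (rule C0I)
  show "continuous_on {-\<epsilon><..<\<epsilon>} k" using assms(1) continuous_on_subset by blast
  show "k s = 0" if "s \<notin> {-\<epsilon><..<\<epsilon>}" for s using that assms(2)[of s] by auto
  fix e :: real assume "e > 0"
  have "closed (k -` {z. e \<le> cmod z})"
    using assms(1) by (intro continuous_closed_vimage closed_Collect_le continuous_intros)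
      (auto simp: continuous_on_eq_continuous_at)
  then have "compact ({-\<epsilon>..\<epsilon>} \<inter> k -` {z. e \<le> cmod z})" by (intro compact_Int_closed) auto
  moreover have "{-\<epsilon>..\<epsilon>} \<inter> k -` {z. e \<le> cmod z} \<subseteq> {-\<epsilon><..<\<epsilon>}"
  proof
    fix s assume "s \<in> {-\<epsilon>..\<epsilon>} \<inter> k -` {z. e \<le> cmod z}"
    then have "k s \<noteq> 0" using \<open>e > 0\<close> by auto
    then show "s \<in> {-\<epsilon><..<\<epsilon>}" using assms(2)[of s] by (force simp: abs_less_iff not_le[symmetric])
  qed
  ultimately show "\<exists>K. compact K \<and> K \<subseteq> {-\<epsilon><..<\<epsilon>} \<and> (\<forall>x\<in>{-\<epsilon><..<\<epsilon>} - K. cmod (k x) < e)"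
    by (intro exI[of _ "{-\<epsilon>..\<epsilon>} \<inter> k -` {z. e \<le> cmod z}"]) auto
qed

section \<open>Tubular neighbourhoods as open embeddings\<close>

lemma smooth_map_continuous_on:
  assumes "smooth_map M f"
  shows "continuous_on M f"
  unfolding continuous_on_def
proof
  fix x assume x: "x \<in> M"
  then obtain U g where U: "open U" "x \<in> U" "\<forall>k. times_differentiable_on k U g" "\<forall>y\<in>U \<inter> M. g y = f y"
    using assms unfolding smooth_map_def by blast
  have "continuous_on U g" using U(3) times_differentiable_on.simps(1) by blast
  then have "continuous_on (U \<inter> M) g" by (rule continuous_on_subset) blast
  then have "continuous_on (U \<inter> M) f" by (rule continuous_on_eq) (use U(4) in auto)
  then have "(f \<longlongrightarrow> f x) (at x within U \<inter> M)" using x U(2) by (auto simp: continuous_on_def)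
  moreover have "at x within U \<inter> M = at x within M" using U(1,2) by (intro at_within_nhd[of x U]) auto
  ultimately show "(f \<longlongrightarrow> f x) (at x within M)" by simp
qed

lemma tubular_neighbourhood_map_open_embedding:
  assumes "tubular_neighbourhood_map j"
  shows "open_embedding (sphere 0 1 \<times> UNIV) UNIV j"
proof -
  obtain T where T: "open T" "bij_betw j (sphere 0 1 \<times> UNIV) T"
      "smooth_map (sphere 0 1 \<times> UNIV) j" "smooth_map T (inv_into (sphere 0 1 \<times> UNIV) j)"
    using assms by (auto simp: tubular_neighbourhood_map_def diffeomorphism_onto_def)
  then show ?thesis
    using smooth_map_continuous_on[OF T(3)] smooth_map_continuous_on[OF T(4)]
    by (auto simp: open_embedding_def bij_betw_def)
qed

section \<open>The bounded function b on the line\<close>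

definition b_fun :: "real \<Rightarrow> real \<Rightarrow> real" where
  "b_fun \<epsilon> s = (if s \<le> -\<epsilon> then -1 else if s < \<epsilon> then f_fun \<epsilon> s / sqrt (1 + (f_fun \<epsilon> s)\<^sup>2) else 1)"

lemma cos_pos_interval:
  assumes "0 < \<epsilon>" "\<bar>s\<bar> < \<epsilon>"
  shows "0 < cos (pi / (2 * \<epsilon>) * s)"
proof (rule cos_gt_zero_pi)
  have "pi / (2 * \<epsilon>) * s < pi / (2 * \<epsilon>) * \<epsilon>" "pi / (2 * \<epsilon>) * (-\<epsilon>) < pi / (2 * \<epsilon>) * s"
    using assms by (intro mult_strict_left_mono; auto)+
  then show "- (pi / 2) < pi / (2 * \<epsilon>) * s" "pi / (2 * \<epsilon>) * s < pi / 2" using assms(1) by auto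
qed

text \<open>Cancelling \<open>cos\<close> in \<open>f / sqrt (1 + f\<^sup>2)\<close> leaves a formula that extends continuously, with the
  values \<open>-1\<close> and \<open>1\<close> at the end points.\<close>

lemma b_fun_eq:
  fixes \<epsilon> s :: real
  assumes "0 < \<epsilon>"
  defines "\<alpha> \<equiv> pi / (2 * \<epsilon>)" and "u \<equiv> max (-\<epsilon>) (min \<epsilon> s)"
  shows "b_fun \<epsilon> s = \<alpha> * sin (\<alpha> * u) / sqrt ((cos (\<alpha> * u))\<^sup>2 + (\<alpha> * sin (\<alpha> * u))\<^sup>2)"
proof -
  have \<alpha>: "\<alpha> > 0" "\<alpha> * \<epsilon> = pi / 2" using assms(1) by (auto simp: \<alpha>_def)
  have end_values: "cos (\<alpha> * \<epsilon>) = 0" "sin (\<alpha> * \<epsilon>) = 1" by (simp_all add: \<alpha>(2))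
  consider "s \<le> -\<epsilon>" | "\<bar>s\<bar> < \<epsilon>" | "s \<ge> \<epsilon>" by linarith
  then show ?thesis
  proof cases
    case 1
    then have "u = -\<epsilon>" using assms(1) by (auto simp: u_def)
    then show ?thesis using 1 \<alpha>(1) end_values by (simp add: b_fun_def)
  next
    case 3
    then have "u = \<epsilon>" using assms(1) by (auto simp: u_def)
    then show ?thesis using 3 \<alpha>(1) end_values assms(1) by (simp add: b_fun_def)
  next
    case 2
    then have s: "- \<epsilon> < s" "s < \<epsilon>" and u: "u = s" by (auto simp: u_def)
    have c: "0 < cos (\<alpha> * s)" using cos_pos_interval[OF assms(1) 2] by (simp add: \<alpha>_def)
    have f: "f_fun \<epsilon> s = \<alpha> * sin (\<alpha> * s) / cos (\<alpha> * s)"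
      by (simp add: f_fun_def Let_def \<alpha>_def tan_def)
    have "1 + (f_fun \<epsilon> s)\<^sup>2 = ((cos (\<alpha> * s))\<^sup>2 + (\<alpha> * sin (\<alpha> * s))\<^sup>2) / (cos (\<alpha> * s))\<^sup>2"
      using c by (simp add: f field_simps power2_eq_square)
    then have "sqrt (1 + (f_fun \<epsilon> s)\<^sup>2) = sqrt ((cos (\<alpha> * s))\<^sup>2 + (\<alpha> * sin (\<alpha> * s))\<^sup>2) / cos (\<alpha> * s)"
      using c by (simp add: real_sqrt_divide)
    then show ?thesis
      using s c u by (simp add: b_fun_def f)
  qed
qed

text \<open>Clamping the argument makes one formula valid on the whole line, and its denominator
  cannot vanish because sine and cosine have no common zero.\<close>

lemma b_fun_continuous:
  assumes "0 < \<epsilon>"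
  shows "continuous_on UNIV (b_fun \<epsilon>)"
proof -
  let ?\<alpha> = "pi / (2 * \<epsilon>)" and ?u = "\<lambda>s. max (-\<epsilon>) (min \<epsilon> s)"
  have "sqrt ((cos x)\<^sup>2 + (?\<alpha> * sin x)\<^sup>2) \<noteq> 0" for x :: real
  proof (cases "cos x = 0")
    case True
    then have "sin x \<noteq> 0" using sin_zero_abs_cos_one by fastforce
    then show ?thesis using assms by (simp add: sum_power2_eq_zero_iff)
  qed (simp add: sum_power2_eq_zero_iff)
  then have "continuous_on UNIV (\<lambda>s. ?\<alpha> * sin (?\<alpha> * ?u s) /
      sqrt ((cos (?\<alpha> * ?u s))\<^sup>2 + (?\<alpha> * sin (?\<alpha> * ?u s))\<^sup>2))"
    by (intro continuous_intros) auto
  then show ?thesis by (simp add: b_fun_eq[OF assms] cong: continuous_on_cong)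
qed

lemma abs_b_fun_le: "\<bar>b_fun \<epsilon> s\<bar> \<le> 1"
proof -
  have "\<bar>x\<bar> \<le> sqrt (1 + x\<^sup>2)" for x :: real by (rule real_le_rsqrt) simp
  moreover have "0 < sqrt (1 + x\<^sup>2)" for x :: real by (simp add: add_pos_nonneg)
  ultimately show ?thesis by (simp add: b_fun_def abs_divide)
qed

lemma f_fun_continuous:
  assumes "0 < \<epsilon>"
  shows "continuous_on {-\<epsilon><..<\<epsilon>} (f_fun \<epsilon>)"
proof -
  have "cos (pi / (2 * \<epsilon>) * s) \<noteq> 0" if "s \<in> {-\<epsilon><..<\<epsilon>}" for s
    using cos_pos_interval[OF assms, of s] that by (auto simp: abs_less_iff)
  then show ?thesis
    unfolding f_fun_def Let_def by (intro continuous_intros) auto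
qed

lemma b_fun_defect:
  assumes "0 < \<epsilon>"
  shows "(\<lambda>s. complex_of_real ((b_fun \<epsilon> s)\<^sup>2 - 1)) \<in> C0 {-\<epsilon><..<\<epsilon>}"
proof (rule C0_vanishing_outside_interval)
  show "continuous_on UNIV (\<lambda>s. complex_of_real ((b_fun \<epsilon> s)\<^sup>2 - 1))"
    by (intro continuous_intros b_fun_continuous assms)
  show "complex_of_real ((b_fun \<epsilon> s)\<^sup>2 - 1) = 0" if "\<epsilon> \<le> \<bar>s\<bar>" for s
    using that assms by (auto simp: b_fun_def)
qed

section \<open>The homotopy\<close>

lemma (in function_module) b_fun_multiplier:
  assumes "0 < \<epsilon>" "continuous_on X g"
  shows "multiplier (\<lambda>p. of_real (b_fun \<epsilon> (g p)))"
  unfolding multiplier_def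
proof
  show "continuous_on X (\<lambda>p. complex_of_real (b_fun \<epsilon> (g p)))"
    by (intro continuous_on_of_real continuous_on_compose2[OF b_fun_continuous[OF assms(1)] assms(2)]) auto
  show "\<exists>b. \<forall>p\<in>X. cmod (complex_of_real (b_fun \<epsilon> (g p))) \<le> b"
    using abs_b_fun_le by (intro exI[of _ 1]) auto
qed

lemma function_module_transported:
  fixes j :: "'v::euclidean_space \<times> real \<Rightarrow> 'v"
  assumes j: "open_embedding X UNIV j" and "X \<subseteq> sphere 0 1 \<times> UNIV"
    and "continuous_on X (\<lambda>p. w (j p))" "0 < c"
    and "\<And>p. p \<in> X \<Longrightarrow> c \<le> w (j p)" "\<And>p. p \<in> X \<Longrightarrow> w (j p) \<le> C"
  shows "function_module (C0_algebra UNIV) (\<lambda>f. f) UNIV (transported_bimod X w j) (\<lambda>f. f) X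
    (sphere 0 1) j (\<lambda>p. w (j p)) fst c C"
proof -
  interpret B: function_algebra "C0_algebra (UNIV :: 'v set)" "\<lambda>f. f" UNIV
    by (rule function_algebra_C0)
  show ?thesis
  proof
    show "\<exists>h. (\<forall>p\<in>X. 0 < h p) \<and> (\<lambda>p. complex_of_real (h p)) \<in> C0 X"
      by (rule open_embedding_strictly_positive[OF j]) simp
    show "fst ` X \<subseteq> sphere 0 1" using assms(2) by auto
    show "ip (transported_bimod X w j) x y = push X j (\<lambda>p. of_real (w (j p)) * cnj (x p) * y p)" for x y
      by (auto simp: transported_bimod_def push_def fun_eq_iff f_inv_into_f)
  qed (use assms in \<open>auto simp: transported_bimod_def bij_def intro!: continuous_intros\<close>)
qed

definition b_op :: "real \<Rightarrow> ('v \<times> real \<Rightarrow> complex) \<Rightarrow> 'v \<times> real \<Rightarrow> complex" where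
  "b_op \<epsilon> \<psi> p = of_real (b_fun \<epsilon> (snd p)) * \<psi> p"

definition homotopy_domain :: "real \<Rightarrow> (real \<times> 'v::euclidean_space \<times> real) set" where
  "homotopy_domain \<epsilon> = {(t, \<theta>, s). t \<in> {0..1} \<and> \<theta> \<in> sphere 0 1 \<and> (0 < t \<or> s \<in> {-\<epsilon><..<\<epsilon>})}"

text \<open>Elements are curried because \<open>kk_homotopic\<close> prescribes carriers of
  functions on the real line. The inner product is unweighted, so a weight enters only in the
  comparison at the end t = 0.\<close>

definition homotopy_bimod :: "real \<Rightarrow> ('v::euclidean_space \<times> real \<Rightarrow> 'v) \<Rightarrow>
    ('v \<Rightarrow> complex, real \<Rightarrow> 'v \<Rightarrow> complex, real \<Rightarrow> 'v \<times> real \<Rightarrow> complex) bimod" where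
  "homotopy_bimod \<epsilon> j =
    \<lparr>carrier = {\<psi>. case_prod \<psi> \<in> C0 (homotopy_domain \<epsilon>)},
     mult = undefined,
     one = undefined,
     zero = (\<lambda>t p. 0),
     add = (\<lambda>\<psi> \<phi> t p. \<psi> t p + \<phi> t p),
     smult = (\<lambda>c \<psi> t p. c * \<psi> t p),
     ip = (\<lambda>\<psi> \<phi> t x. push (homotopy_domain \<epsilon>) (\<lambda>(t, p). (t, j p)) (\<lambda>(t, p). cnj (\<psi> t p) * \<phi> t p) (t, x)),
     ract = (\<lambda>\<psi> h t p. \<psi> t p * h t (j p)),
     lact = (\<lambda>g \<psi> t p. g (fst p) * \<psi> t p)\<rparr>"

definition homotopy_op :: "real \<Rightarrow> ('v::euclidean_space \<times> real \<Rightarrow> 'v) \<Rightarrow>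
    (real \<Rightarrow> 'v \<times> real \<Rightarrow> complex) \<Rightarrow> real \<Rightarrow> 'v \<times> real \<Rightarrow> complex" where
  "homotopy_op \<epsilon> j = (\<lambda>\<psi>\<in>carrier (homotopy_bimod \<epsilon> j). \<lambda>t. b_op \<epsilon> (\<psi> t))"

text \<open>The parameter of type \<open>itself\<close> fixes the ambient Euclidean space.\<close>

locale annulus =
  fixes n :: nat and \<epsilon> :: real and V :: "'v::euclidean_space itself"
  assumes \<epsilon>: "0 < \<epsilon>" "\<epsilon> < 1"
begin

abbreviation "X\<^sub>0 \<equiv> (sphere 0 1 :: 'v set) \<times> {-\<epsilon><..<\<epsilon>}"

lemma norm_sph_emb: "p \<in> X\<^sub>0 \<Longrightarrow> norm (sph_emb p) = snd p + 1"
  using \<epsilon> by (auto simp: sph_emb_def)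

text \<open>The inverse is explicit, namely polar coordinates, and continuous on the image because
  \<epsilon> < 1 keeps the annulus away from the origin.\<close>

lemma emb_X\<^sub>0: "open_embedding X\<^sub>0 UNIV sph_emb"
proof -
  let ?A = "{x :: 'v. 1 - \<epsilon> < norm x \<and> norm x < 1 + \<epsilon>}"
  let ?g = "\<lambda>x :: 'v. (x /\<^sub>R norm x, norm x - 1)"
  have inv: "?g (sph_emb p) = p" if "p \<in> X\<^sub>0" for p
    using that \<epsilon> norm_sph_emb[OF that] by (auto simp: sph_emb_def)
  have inj: "inj_on sph_emb X\<^sub>0" by (rule inj_on_inverseI[of _ ?g]) (rule inv)
  have img: "sph_emb ` X\<^sub>0 = ?A"
  proof
    show "sph_emb ` X\<^sub>0 \<subseteq> ?A" using norm_sph_emb by auto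
    show "?A \<subseteq> sph_emb ` X\<^sub>0"
    proof
      fix x assume x: "x \<in> ?A"
      then have "x \<noteq> 0" using \<epsilon> by auto
      then have "?g x \<in> X\<^sub>0" using x by simp
      moreover from \<open>x \<noteq> 0\<close> have "x = sph_emb (?g x)" by (simp add: sph_emb_def)
      ultimately show "x \<in> sph_emb ` X\<^sub>0" by blast
    qed
  qed
  have "continuous_on X\<^sub>0 (sph_emb :: 'v \<times> real \<Rightarrow> 'v)"
    unfolding sph_emb_def case_prod_unfold by (intro continuous_intros)
  moreover have "continuous_on ?A ?g" using \<epsilon> by (intro continuous_intros) auto
  then have "continuous_on ?A (inv_into X\<^sub>0 sph_emb)"
    by (rule continuous_on_eq) (use inv inv_into_f_f[OF inj] in \<open>auto simp flip: img\<close>)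
  moreover have "open ?A" by (intro open_Collect_conj open_Collect_less continuous_intros)
  ultimately show ?thesis using inj by (simp add: open_embedding_def img)
qed

text \<open>The radius stays between 1 - \<epsilon> > 0 and 2, whence the two bounds on the
  weight.\<close>

lemma function_module_E:
  "function_module (C0_algebra UNIV) (\<lambda>f. f) UNIV (E_mod n \<epsilon>) (\<lambda>f. f) X\<^sub>0 (sphere 0 1) sph_emb
     (\<lambda>p. 1 / norm (sph_emb p) ^ n) fst (1 / 2 ^ n) (1 / (1 - \<epsilon>) ^ n)"
  unfolding E_mod_def
proof (rule function_module_transported[OF emb_X\<^sub>0])
  have pos: "0 < snd p + 1" "snd p + 1 \<le> 2" "1 - \<epsilon> \<le> snd p + 1" if "p \<in> X\<^sub>0" for p
    using that \<epsilon> by auto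
  have "continuous_on X\<^sub>0 (\<lambda>p. 1 / (snd p + 1) ^ n)"
    using pos(1) by (intro continuous_intros) (auto simp: less_imp_neq[symmetric])
  then show "continuous_on X\<^sub>0 (\<lambda>p. 1 / norm (sph_emb p) ^ n)"
    by (rule continuous_on_eq) (simp add: norm_sph_emb)
  fix p assume p: "p \<in> X\<^sub>0"
  show "1 / 2 ^ n \<le> 1 / norm (sph_emb p) ^ n"
    unfolding norm_sph_emb[OF p] using pos[OF p] by (intro divide_left_mono power_mono) auto
  show "1 / norm (sph_emb p) ^ n \<le> 1 / (1 - \<epsilon>) ^ n"
    unfolding norm_sph_emb[OF p] using pos[OF p] \<epsilon> by (intro divide_left_mono power_mono) auto
qed auto

sublocale E: function_module "C0_algebra UNIV" "\<lambda>f. f" UNIV "E_mod n \<epsilon>" "\<lambda>f. f" X\<^sub>0 "sphere 0 1"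
    sph_emb "\<lambda>p. 1 / norm (sph_emb p) ^ n" fst "1 / 2 ^ n" "1 / (1 - \<epsilon>) ^ n"
  by (rule function_module_E)

lemma defect_X\<^sub>0: "(\<lambda>p. if p \<in> X\<^sub>0 then of_real ((b_fun \<epsilon> (snd p))\<^sup>2 - 1) else 0) \<in> C0 X\<^sub>0"
proof -
  have "(\<lambda>(\<theta>, s). if \<theta> \<in> sphere 0 1 then 1 * complex_of_real ((b_fun \<epsilon> s)\<^sup>2 - 1) else 0) \<in> C0 X\<^sub>0"
    by (rule C0_compact_Times[OF b_fun_defect[OF \<epsilon>(1)]]) auto
  moreover have "complex_of_real ((b_fun \<epsilon> s)\<^sup>2 - 1) = 0" if "s \<notin> {-\<epsilon><..<\<epsilon>}" for s
    using C0D(2)[OF b_fun_defect[OF \<epsilon>(1)] that] .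
  ultimately show ?thesis
    by (elim rev_iffD1[OF _ arg_cong[where f = "\<lambda>f. f \<in> C0 X\<^sub>0"]]) (auto simp: fun_eq_iff)
qed

text \<open>The transform multiplies by f / sqrt(1 + f^2), which is \<open>b_fun\<close> for |s| <
  \<epsilon>; this covers the whole of \<open>X\<^sub>0\<close>.\<close>

lemma bS_represents: "E.represents (bS_op n \<epsilon>) (\<lambda>p. of_real (b_fun \<epsilon> (snd p)))"
proof (rule E.represents_cong)
  have "continuous_on X\<^sub>0 (\<lambda>p. f_fun \<epsilon> (snd p))"
    by (rule continuous_on_compose2[OF f_fun_continuous[OF \<epsilon>(1)]]) (auto intro: continuous_intros)
  then show "E.represents (bS_op n \<epsilon>)
      (\<lambda>p. of_real (f_fun \<epsilon> (snd p) / sqrt (1 + (f_fun \<epsilon> (snd p))\<^sup>2)))"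
    unfolding bS_op_def S_dom_def
    by (rule E.bounded_transform_multiplication) (simp add: S_op_def case_prod_unfold)
qed (auto simp: b_fun_def)

lemma kk_cycle_E: "kk_cycle (C0_algebra (sphere 0 1)) (C0_algebra UNIV) (E_mod n \<epsilon> :: ('v \<Rightarrow> complex, _, _) bimod, bS_op n \<epsilon>)"
  by (intro E.kk_cycle[OF bS_represents _ defect_X\<^sub>0] E.b_fun_multiplier \<epsilon> continuous_intros)

end

section \<open>The shriek cycle and the homotopy module\<close>

locale sphere_tube = annulus n \<epsilon> "TYPE('v)"
  for n \<epsilon> and j :: "'v::euclidean_space \<times> real \<Rightarrow> 'v" +
  assumes tubular: "tubular_neighbourhood_map j"
    and agree: "\<And>p. p \<in> sphere 0 1 \<times> {-\<epsilon><..<\<epsilon>} \<Longrightarrow> j p = sph_emb p"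
begin

abbreviation "X\<^sub>1 \<equiv> (sphere 0 1 :: 'v set) \<times> (UNIV :: real set)"
abbreviation "W \<equiv> homotopy_domain \<epsilon> :: (real \<times> 'v \<times> real) set"
abbreviation "J \<equiv> (\<lambda>(t, p). (t, j p)) :: real \<times> 'v \<times> real \<Rightarrow> real \<times> 'v"
abbreviation "H \<equiv> homotopy_bimod \<epsilon> j"

lemma openin_X\<^sub>0: "openin (top_of_set X\<^sub>1) X\<^sub>0"
  by (auto simp: openin_open intro!: exI[of _ "UNIV \<times> {-\<epsilon><..<\<epsilon>}"] open_Times)

lemma emb_X\<^sub>1: "open_embedding X\<^sub>1 UNIV j"
  using tubular by (rule tubular_neighbourhood_map_open_embedding)

lemma openin_W: "openin (top_of_set ({0..1} \<times> X\<^sub>1)) W"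
proof -
  have "open ({0<..} \<times> UNIV \<union> UNIV \<times> UNIV \<times> {-\<epsilon><..<\<epsilon>} :: (real \<times> 'v \<times> real) set)"
    by (intro open_Un open_Times) auto
  moreover have "W = {0..1} \<times> X\<^sub>1 \<inter> ({0<..} \<times> UNIV \<union> UNIV \<times> UNIV \<times> {-\<epsilon><..<\<epsilon>})"
    by (auto simp: homotopy_domain_def)
  ultimately show ?thesis by (auto simp: openin_open)
qed

lemma emb_W: "open_embedding W ({0..1} \<times> UNIV) J"
  by (rule open_embedding_subset[OF open_embedding_Times[OF emb_X\<^sub>1] openin_W])

lemma slice_0: "{p. (0, p) \<in> W} = X\<^sub>0" and slice_1: "{p. (1, p) \<in> W} = X\<^sub>1"
  by (auto simp: homotopy_domain_def)

lemma function_module_E_CS: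
  "function_module (C0_algebra UNIV) (\<lambda>f. f) UNIV (E_CS j) (\<lambda>f. f) X\<^sub>1 (sphere 0 1) j
     (\<lambda>p. 1) fst 1 1"
  unfolding E_CS_def by (rule function_module_transported[OF emb_X\<^sub>1]) auto

lemma function_module_H:
  "function_module (path_algebra (C0_algebra UNIV)) case_prod ({0..1} \<times> UNIV) H case_prod W
     (sphere 0 1) J (\<lambda>p. 1) (\<lambda>p. fst (snd p)) 1 1"
proof -
  interpret B: function_algebra "path_algebra (C0_algebra (UNIV :: 'v set))" case_prod "{0..1} \<times> UNIV"
    by (rule function_algebra_path)
  show ?thesis
  proof
    show "\<exists>h. (\<forall>p\<in>W. 0 < h p) \<and> (\<lambda>p. complex_of_real (h p)) \<in> C0 W"
      by (rule open_embedding_strictly_positive[OF emb_W]) (intro closed_Times; simp)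
    show "(\<lambda>p. fst (snd p)) ` W \<subseteq> sphere 0 1" by (auto simp: homotopy_domain_def)
    show "case_prod (ip H x y) = push W J (\<lambda>p. of_real 1 * cnj (case_prod x p) * case_prod y p)" for x y
      by (auto simp: homotopy_bimod_def fun_eq_iff case_prod_unfold)
  qed (auto simp: homotopy_bimod_def bij_case_prod emb_W intro!: continuous_intros)
qed

sublocale CS: function_module "C0_algebra UNIV" "\<lambda>f. f" UNIV "E_CS j" "\<lambda>f. f" X\<^sub>1 "sphere 0 1"
    j "\<lambda>p. 1" fst 1 1
  by (rule function_module_E_CS)

sublocale H: function_module "path_algebra (C0_algebra UNIV)" case_prod "{0..1} \<times> UNIV" H case_prod W
    "sphere 0 1" J "\<lambda>p. 1" "\<lambda>p. fst (snd p)" 1 1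
  by (rule function_module_H)

lemma defect_X\<^sub>1: "(\<lambda>p. if p \<in> X\<^sub>1 then of_real ((b_fun \<epsilon> (snd p))\<^sup>2 - 1) else 0) \<in> C0 X\<^sub>1"
proof -
  have "complex_of_real ((b_fun \<epsilon> s)\<^sup>2 - 1) = 0" if "s \<notin> {-\<epsilon><..<\<epsilon>}" for s
    using C0D(2)[OF b_fun_defect[OF \<epsilon>(1)] that] .
  then show ?thesis
    using C0_openin_mono[OF openin_X\<^sub>0 defect_X\<^sub>0]
    by (elim rev_iffD1[OF _ arg_cong[where f = "\<lambda>f. f \<in> C0 X\<^sub>1"]]) (auto simp: fun_eq_iff)
qed

text \<open>The only part of the cylinder missing from \<open>W\<close> lies over t = 0 outside
  \<open>X\<^sub>0\<close>, and the two alternatives are two ways to vanish there. They supply the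
  lifts for evaluation at 1 and at 0.\<close>

lemma lift_closed:
  assumes "\<phi> \<in> C0 X\<^sub>1" "continuous_on {0..1} u" "u 0 = 0 \<or> \<phi> \<in> C0 X\<^sub>0"
  shows "(\<lambda>t p. if t \<in> {0..1} then u t * \<phi> p else 0) \<in> carrier H"
proof -
  have "(\<lambda>(t, p). if t \<in> {0..1} then u t * \<phi> p else 0) \<in> C0 W"
  proof (rule C0_subset[OF C0_compact_Times[OF assms(1) compact_Icc assms(2)]])
    show "W \<subseteq> {0..1} \<times> X\<^sub>1" by (auto simp: homotopy_domain_def)
    fix q :: "real \<times> 'v \<times> real" assume q: "q \<notin> W"
    obtain t p where tp: "q = (t, p)" by (cases q)
    show "(case q of (t, p) \<Rightarrow> if t \<in> {0..1} then u t * \<phi> p else 0) = 0"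
    proof (cases "t \<in> {0..1} \<and> p \<in> X\<^sub>1")
      case True
      then have "t = 0" "p \<notin> X\<^sub>0" using q tp by (auto simp: homotopy_domain_def)
      then show ?thesis using assms(3) C0D(2)[of \<phi> X\<^sub>0 p] tp by auto
    next
      case False
      then show ?thesis using C0D(2)[OF assms(1), of p] tp by auto
    qed
  qed
  then show ?thesis by (simp add: homotopy_bimod_def)
qed

text \<open>The defect is independent of t and lives on |s| < \<epsilon>, so it is a constant path
  in C_0(\<open>X\<^sub>0\<close>).\<close>

lemma defect_W: "(\<lambda>q. if q \<in> W then of_real ((b_fun \<epsilon> (snd (snd q)))\<^sup>2 - 1) else 0) \<in> C0 W"
proof -
  let ?k = "\<lambda>p :: 'v \<times> real. if p \<in> X\<^sub>0 then complex_of_real ((b_fun \<epsilon> (snd p))\<^sup>2 - 1) else 0"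
  have "(\<lambda>t p. if t \<in> {0..1} then 1 * ?k p else 0) \<in> carrier H"
    by (rule lift_closed[OF C0_openin_mono[OF openin_X\<^sub>0 defect_X\<^sub>0]]) (auto intro: defect_X\<^sub>0)
  then have "(\<lambda>(t, p). if t \<in> {0..1} then ?k p else 0) \<in> C0 W"
    by (simp add: homotopy_bimod_def cong: if_cong)
  moreover have "complex_of_real ((b_fun \<epsilon> s)\<^sup>2 - 1) = 0" if "s \<notin> {-\<epsilon><..<\<epsilon>}" for s
    using C0D(2)[OF b_fun_defect[OF \<epsilon>(1)] that] .
  ultimately show ?thesis
    by (elim rev_iffD1[OF _ arg_cong[where f = "\<lambda>f. f \<in> C0 W"]])
      (auto simp: fun_eq_iff homotopy_domain_def)
qed

lemma F_CS_represents: "CS.represents (F_CS \<epsilon> j) (\<lambda>p. of_real (b_fun \<epsilon> (snd p)))"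
proof -
  have "F_CS \<epsilon> j \<psi> = (\<lambda>p. of_real (b_fun \<epsilon> (snd p)) * \<psi> p)" if "\<psi> \<in> carrier (E_CS j)" for \<psi>
    using that by (auto simp: F_CS_def b_fun_def fun_eq_iff)
  moreover have "(\<lambda>p. of_real (b_fun \<epsilon> (snd p)) * \<psi> p) \<in> carrier (E_CS j)"
    if "\<psi> \<in> carrier (E_CS j)" for \<psi>
    unfolding CS.E.carrier_iff
    by (intro CS.multiplier_C0 CS.b_fun_multiplier CS.\<Psi>_C0 that \<epsilon> continuous_intros)
  ultimately show ?thesis by (simp add: CS.represents_def F_CS_def extensional_def)
qed

lemma homotopy_op_represents:
  "H.represents (homotopy_op \<epsilon> j) (\<lambda>q. of_real (b_fun \<epsilon> (snd (snd q))))"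
proof -
  have eq: "case_prod (homotopy_op \<epsilon> j \<psi>) = (\<lambda>q. of_real (b_fun \<epsilon> (snd (snd q))) * case_prod \<psi> q)"
    if "\<psi> \<in> carrier H" for \<psi>
    using that by (auto simp: homotopy_op_def b_op_def fun_eq_iff)
  moreover have "homotopy_op \<epsilon> j \<psi> \<in> carrier H" if "\<psi> \<in> carrier H" for \<psi>
    unfolding H.E.carrier_iff eq[OF that]
    by (intro H.multiplier_C0 H.b_fun_multiplier H.\<Psi>_C0 that \<epsilon> continuous_intros)
  ultimately show ?thesis by (simp add: H.represents_def homotopy_op_def extensional_def)
qed

section \<open>Cycle axioms and the two ends of the homotopy\<close>

lemma kk_cycle_E_CS: "kk_cycle (C0_algebra (sphere 0 1)) (C0_algebra UNIV) (E_CS j, F_CS \<epsilon> j)"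
  by (intro CS.kk_cycle[OF F_CS_represents _ defect_X\<^sub>1] CS.b_fun_multiplier \<epsilon> continuous_intros)

lemma kk_cycle_H:
  "kk_cycle (C0_algebra (sphere 0 1)) (path_algebra (C0_algebra UNIV)) (H, homotopy_op \<epsilon> j)"
  by (intro H.kk_cycle[OF homotopy_op_represents _ defect_W] H.b_fun_multiplier \<epsilon> continuous_intros)

text \<open>A second embedding \<open>i\<close> is allowed because the module at t = 0 is defined
  with \<open>sph_emb\<close>, which is known to agree with \<open>j\<close> only on the slice
  \<open>X\<^sub>0\<close>.\<close>

lemma push_slice:
  fixes i :: "'v \<times> real \<Rightarrow> 'v"
  assumes "open_embedding {p. (t, p) \<in> W} UNIV i" "\<And>p. (t, p) \<in> W \<Longrightarrow> j p = i p"
  shows "push W J g (t, x) = push {p. (t, p) \<in> W} i (\<lambda>p. g (t, p)) x"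
proof (cases "x \<in> i ` {p. (t, p) \<in> W}")
  case True
  then obtain p where p: "(t, p) \<in> W" "x = i p" by blast
  have "push W J g (t, x) = push W J g (J (t, p))" using p assms(2) by simp
  also have "\<dots> = g (t, p)" by (rule push_embedded[OF emb_W p(1)])
  also have "\<dots> = push {p. (t, p) \<in> W} i (\<lambda>p. g (t, p)) x"
    unfolding p(2) by (rule push_embedded[OF assms(1), symmetric]) (use p in simp)
  finally show ?thesis .
next
  case False
  then have "(t, x) \<notin> J ` W" using assms(2) by force
  then show ?thesis using False by (simp add: push_outside)
qed

text \<open>The map to the end module restricts to the slice at \<open>t\<close> and multiplies by
  \<kappa>. The relation between \<open>w\<close> and \<kappa> makes it compatible with inner
  products, boundedness of \<kappa> keeps it inside C_0(X), and it commutes with the operators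
  because all of them are multiplications.\<close>

lemma homotopy_evaluation:
  fixes E :: "('v \<Rightarrow> complex, 'v \<Rightarrow> complex, 'v \<times> real \<Rightarrow> complex) bimod" and i \<kappa> w
  defines "\<rho> \<equiv> \<lambda>\<psi> p. of_real (\<kappa> p) * \<psi> p"
  assumes t: "t \<in> {0..1}" and X: "X = {p. (t, p) \<in> W}" and E: "E = transported_bimod X w i"
    and bimod: "hilbert_bimodule (C0_algebra (sphere 0 1)) (C0_algebra UNIV) E"
    and i: "open_embedding X UNIV i" "\<And>p. p \<in> X \<Longrightarrow> j p = i p"
    and \<kappa>: "continuous_on X \<kappa>" "\<And>p. p \<in> X \<Longrightarrow> \<bar>\<kappa> p\<bar> \<le> b"
      "\<And>p. p \<in> X \<Longrightarrow> w (i p) * (\<kappa> p)\<^sup>2 = 1"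
    and surj: "\<And>\<phi>. \<phi> \<in> C0 X \<Longrightarrow> \<exists>\<psi>\<in>carrier H. \<rho> (\<psi> t) = \<phi>"
    and G: "\<And>\<phi>. \<phi> \<in> C0 X \<Longrightarrow> G \<phi> = (\<lambda>p. of_real (b_fun \<epsilon> (snd p)) * \<phi> p)"
  shows "unitarily_equivalent (C0_algebra (sphere 0 1)) (C0_algebra UNIV)
    (ev_cycle (C0_algebra UNIV) t (H, homotopy_op \<epsilon> j)) (E, G)"
proof (rule ev_cycle_unitarily_equivalent[where \<rho> = "\<lambda>\<psi>. \<rho> (\<psi> t)", OF H.hilbert_bimodule bimod t])
  have slice: "\<psi> t \<in> C0 X" if "\<psi> \<in> carrier H" for \<psi>
    using C0_slice[OF H.\<Psi>_C0[OF that], of t] by (simp add: X)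
  have \<rho>C: "\<rho> (\<psi> t) \<in> C0 X" if "\<psi> \<in> carrier H" for \<psi>
    unfolding \<rho>_def
    by (rule C0_mult_bounded[OF slice[OF that], where c = b]) (use \<kappa> in \<open>auto intro: continuous_intros\<close>)
  show "(\<lambda>\<psi>. \<rho> (\<psi> t)) ` carrier H = carrier E"
  proof
    show "carrier E \<subseteq> (\<lambda>\<psi>. \<rho> (\<psi> t)) ` carrier H"
      using surj by (fastforce simp: E transported_bimod_def)
  qed (use \<rho>C in \<open>auto simp: E transported_bimod_def\<close>)
  fix \<psi> assume \<psi>: "\<psi> \<in> carrier H"
  have out: "\<psi> t p = 0" if "p \<notin> X" for p using C0D(2)[OF slice[OF \<psi>] that] .
  show "\<rho> ((c \<odot>\<^bsub>H\<^esub> \<psi>) t) = c \<odot>\<^bsub>E\<^esub> \<rho> (\<psi> t)" for c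
    by (simp add: homotopy_bimod_def E transported_bimod_def \<rho>_def mult_ac)
  show "\<rho> (ract H \<psi> g t) = ract E (\<rho> (\<psi> t)) (g t)" for g
    using i(2) out by (auto simp: homotopy_bimod_def E transported_bimod_def \<rho>_def fun_eq_iff mult_ac) metis
  show "\<rho> (lact H a \<psi> t) = lact E a (\<rho> (\<psi> t))" for a
    by (simp add: homotopy_bimod_def E transported_bimod_def \<rho>_def mult_ac)
  show "homotopy_op \<epsilon> j \<psi> \<in> carrier H \<and> \<rho> (homotopy_op \<epsilon> j \<psi> t) = G (\<rho> (\<psi> t))"
    using H.representsD(2)[OF homotopy_op_represents \<psi>] G[OF \<rho>C[OF \<psi>]] \<psi>
    by (simp add: homotopy_op_def b_op_def \<rho>_def mult_ac fun_eq_iff)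
  fix \<phi> assume \<phi>: "\<phi> \<in> carrier H"
  show "\<rho> ((\<psi> \<oplus>\<^bsub>H\<^esub> \<phi>) t) = \<rho> (\<psi> t) \<oplus>\<^bsub>E\<^esub> \<rho> (\<phi> t)"
    by (simp add: homotopy_bimod_def E transported_bimod_def \<rho>_def distrib_left)
  show "ip E (\<rho> (\<psi> t)) (\<rho> (\<phi> t)) = ip H \<psi> \<phi> t"
  proof
    fix x
    have "ip H \<psi> \<phi> t x = push X i (\<lambda>p. cnj (\<psi> t p) * \<phi> t p) x"
      using push_slice[of t i] i by (simp add: homotopy_bimod_def X)
    also have "\<dots> = ip E (\<rho> (\<psi> t)) (\<rho> (\<phi> t)) x"
    proof (cases "x \<in> i ` X")
      case True
      then obtain p where p: "p \<in> X" "x = i p" by blast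
      have inv: "inv_into X i (i p) = p" using i(1) p(1) by (simp add: open_embedding_def)
      have "of_real (w (i p)) * cnj (\<rho> (\<psi> t) p) * \<rho> (\<phi> t) p =
          complex_of_real (w (i p) * (\<kappa> p)\<^sup>2) * (cnj (\<psi> t p) * \<phi> t p)"
        by (simp add: \<rho>_def power2_eq_square mult_ac)
      then show ?thesis
        using p \<kappa>(3)[OF p(1)] inv by (simp add: push_def E transported_bimod_def)
    next
      case False
      then show ?thesis by (simp add: push_def E transported_bimod_def)
    qed
    finally show "ip E (\<rho> (\<psi> t)) (\<rho> (\<phi> t)) x = ip H \<psi> \<phi> t x" by simp
  qed
qed

lemma evaluation_at_0:
  "unitarily_equivalent (C0_algebra (sphere 0 1)) (C0_algebra UNIV)
    (ev_cycle (C0_algebra UNIV) 0 (H, homotopy_op \<epsilon> j)) (E_mod n \<epsilon>, bS_op n \<epsilon>)"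
proof (rule homotopy_evaluation[where X = X\<^sub>0 and \<kappa> = "\<lambda>p. sqrt ((snd p + 1) ^ n)" and b = "sqrt (2 ^ n)",
      OF _ slice_0[symmetric] E_mod_def E.hilbert_bimodule emb_X\<^sub>0 agree])
  have pos: "0 < snd p + 1" "snd p + 1 \<le> 2" if "p \<in> X\<^sub>0" for p :: "'v \<times> real"
    using that \<epsilon> by auto
  show "continuous_on X\<^sub>0 (\<lambda>p. sqrt ((snd p + 1) ^ n))" by (intro continuous_intros)
  show "\<bar>sqrt ((snd p + 1) ^ n)\<bar> \<le> sqrt (2 ^ n)" if "p \<in> X\<^sub>0" for p
    using pos[OF that] by (simp add: power_mono)
  show "1 / norm (sph_emb p) ^ n * (sqrt ((snd p + 1) ^ n))\<^sup>2 = 1" if "p \<in> X\<^sub>0" for p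
    using pos[OF that] by (simp add: norm_sph_emb[OF that])
  show "bS_op n \<epsilon> \<phi> = (\<lambda>p. of_real (b_fun \<epsilon> (snd p)) * \<phi> p)" if "\<phi> \<in> C0 X\<^sub>0" for \<phi>
    using E.representsD(3)[OF bS_represents] that by (simp add: E.E.carrier_iff)
  fix \<phi> :: "'v \<times> real \<Rightarrow> complex" assume \<phi>: "\<phi> \<in> C0 X\<^sub>0"
  \<comment> \<open>A preimage of \<phi> must undo the rescaling; the divisor is bounded away from 0
    since the radius is at least 1 - \<epsilon>.\<close>
  define \<eta> where "\<eta> p = of_real (1 / sqrt ((snd p + 1) ^ n)) * \<phi> p" for p
  have "\<eta> \<in> C0 X\<^sub>0"
    unfolding \<eta>_def
  proof (rule C0_mult_bounded[OF \<phi>])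
    show "continuous_on X\<^sub>0 (\<lambda>p. complex_of_real (1 / sqrt ((snd p + 1) ^ n)))"
      using pos(1) by (intro continuous_intros) (auto simp: less_imp_neq[symmetric])
    fix p assume p: "p \<in> X\<^sub>0"
    have "sqrt ((1 - \<epsilon>) ^ n) \<le> sqrt ((snd p + 1) ^ n)" "0 < sqrt ((1 - \<epsilon>) ^ n)"
      using p \<epsilon> by (auto intro!: power_mono)
    then show "cmod (complex_of_real (1 / sqrt ((snd p + 1) ^ n))) \<le> 1 / sqrt ((1 - \<epsilon>) ^ n)"
      unfolding norm_of_real using pos[OF p] by (simp add: frac_le)
  qed
  \<comment> \<open>The constant path is admissible at t = 0 because \<eta> belongs to
    C_0(\<open>X\<^sub>0\<close>), and at positive t by extension by zero.\<close>
  then have "(\<lambda>t p. if t \<in> {0..1} then 1 * \<eta> p else 0) \<in> carrier H"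
    using C0_openin_mono[OF openin_X\<^sub>0] by (intro lift_closed) auto
  moreover have "of_real (sqrt ((snd p + 1) ^ n)) * \<eta> p = \<phi> p" for p
    using pos(1)[of p] C0D(2)[OF \<phi>, of p] by (cases "p \<in> X\<^sub>0") (auto simp: \<eta>_def)
  ultimately show "\<exists>\<psi>\<in>carrier H. (\<lambda>p. of_real (sqrt ((snd p + 1) ^ n)) * \<psi> 0 p) = \<phi>"
    by (intro bexI[of _ "\<lambda>t p. if t \<in> {0..1} then 1 * \<eta> p else 0"]) auto
qed auto

lemma evaluation_at_1:
  "unitarily_equivalent (C0_algebra (sphere 0 1)) (C0_algebra UNIV)
    (ev_cycle (C0_algebra UNIV) 1 (H, homotopy_op \<epsilon> j)) (E_CS j, F_CS \<epsilon> j)"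
proof (rule homotopy_evaluation[where X = X\<^sub>1 and \<kappa> = "\<lambda>p. 1" and b = 1,
      OF _ slice_1[symmetric] E_CS_def CS.hilbert_bimodule emb_X\<^sub>1])
  show "F_CS \<epsilon> j \<phi> = (\<lambda>p. of_real (b_fun \<epsilon> (snd p)) * \<phi> p)" if "\<phi> \<in> C0 X\<^sub>1" for \<phi>
    using CS.representsD(3)[OF F_CS_represents] that by (simp add: CS.E.carrier_iff)
  fix \<phi> :: "'v \<times> real \<Rightarrow> complex" assume "\<phi> \<in> C0 X\<^sub>1"
  \<comment> \<open>A function on the whole tube need not vanish outside \<open>X\<^sub>0\<close>,
    so no constant path is available; the factor t is 0 at t = 0 and 1 at the evaluated end.\<close>
  then have "(\<lambda>t p. if t \<in> {0..1} then of_real t * \<phi> p else 0) \<in> carrier H"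
    by (intro lift_closed continuous_intros) auto
  then show "\<exists>\<psi>\<in>carrier H. (\<lambda>p. of_real 1 * \<psi> 1 p) = \<phi>"
    by (intro bexI[of _ "\<lambda>t p. if t \<in> {0..1} then of_real t * \<phi> p else 0"]) auto
qed auto

lemma kk_homotopic:
  "kk_homotopic (C0_algebra (sphere 0 1)) (C0_algebra UNIV)
     (E_mod n \<epsilon>, bS_op n \<epsilon>) (E_CS j, F_CS \<epsilon> j)"
  unfolding kk_homotopic_def
  using kk_cycle_E kk_cycle_E_CS kk_cycle_H evaluation_at_0 evaluation_at_1 by blast

end

theorem proposition2p6:
  fixes n :: nat and \<epsilon> :: real and i_CS :: "'v::euclidean_space \<times> real \<Rightarrow> 'v"
  assumes "n \<ge> 1" and "DIM('v) = n + 1"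
    and "0 < \<epsilon>" and "\<epsilon> < 1"
    and "tubular_neighbourhood_map i_CS"
    and "\<forall>p \<in> sphere 0 1 \<times> {-\<epsilon><..<\<epsilon>}. i_CS p = sph_emb p"
  shows "kk_homotopic (C0_algebra (sphere 0 1)) (C0_algebra UNIV)
           (E_mod n \<epsilon>, bS_op n \<epsilon>) (E_CS i_CS, F_CS \<epsilon> i_CS) \<and>
         kk_class (C0_algebra (sphere 0 1)) (C0_algebra UNIV) (E_mod n \<epsilon>, bS_op n \<epsilon>)
           \<in> KK (C0_algebra (sphere 0 1)) (C0_algebra UNIV) \<and>
         kk_class (C0_algebra (sphere 0 1)) (C0_algebra UNIV) (E_mod n \<epsilon>, bS_op n \<epsilon>)
           = kk_class (C0_algebra (sphere 0 1)) (C0_algebra UNIV) (E_CS i_CS, F_CS \<epsilon> i_CS)"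
proof -
  interpret sphere_tube n \<epsilon> i_CS
    using assms by unfold_locales auto
  \<comment> \<open>The second conjunct does not mention \<open>i_CS\<close>: its ambient space has a type of its own.\<close>
  have "annulus \<epsilon>" using assms by unfold_locales
  then show ?thesis
    using kk_homotopic kk_class_eq_of_homotopic[OF kk_homotopic]
      kk_class_in_KK[OF annulus.kk_cycle_E] by blast
qed

end
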